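(* Let $f:\mathbb T^n\to\mathbb T^n$ be a hyperbolic toral automorphism, let $k\ge1$ and let $\epsilon=(\epsilon_1,\dots,\epsilon_k)$ with $\epsilon_1,\dots,\epsilon_k>0$. For a $k$-tuple $V=(V_1,\dots,V_k)$ of $C^2$ unit vector fields on $\mathbb T^n$ that are linearly independent at every point, let $\mathcal F_V$ be the corresponding rank $k$ random perturbation of $f$. Then there is a residual subset $\mathcal V$ of the space of such $k$-tuples (with the $C^2$ topology) such that for every $V\in\mathcal V$ all the invariant measures of $\mathcal F_V$ are absolutely continuous with respect to the Riemannian measure $m$ on $\mathbb T^n$.
   Context: $\mathbb T^n=\mathbb R^n/\mathbb Z^n$ with its standard flat metric. For $1\le i\le k$ and $x\in \mathbb T^n$, let $I^i_{\epsilon_i}(x)$ be the arc through $x$ of the integral curve of $V_i$, namely the maximal connected piece containing $x$ all of whose points are at Riemannian distance $\le\epsilon_i$ from $x$, and let $\mathcal F_i$ be the Markov chain whose transition probability from $x$ is the uniform distribution (normalized one-dimensional Riemannian measure) on $I^i_{\epsilon_i}(x)$; $(\mathcal F_i)_*$ denotes its action on measures. Put $Q_x=(\mathcal F_k)_*(\cdots(\mathcal F_2)_*((\mathcal F_1)_*\delta_x))$. The rank $k$ random perturbation $\mathcal F_V$ of $f$ is the Markov chain with $P(\cdot|x)=Q_{f(x)}$. An invariant measure of $\mathcal F_V$ is a Borel probability measure $\mu$ with $\int P(A|x)\,d\mu(x)=\mu(A)$ for all Borel $A$. A residual set is one containing a countable intersection of open dense sets. *)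

theory Defs
  imports "HOL-Probability.Probability"
begin

section \<open>The flat torus\<close>

definition int_lattice :: "(real ^ 'n) set"
  where "int_lattice = {v. \<forall>i. v $ i \<in> \<int>}"

definition lattice_equiv :: "real ^ 'n \<Rightarrow> real ^ 'n \<Rightarrow> bool"
  where "lattice_equiv x y \<longleftrightarrow> x - y \<in> int_lattice"

lemma int_lattice_zero: "0 \<in> int_lattice"
  by (simp add: int_lattice_def)

lemma int_lattice_uminus: "v \<in> int_lattice \<Longrightarrow> - v \<in> int_lattice"
  by (simp add: int_lattice_def)

lemma int_lattice_add: "u \<in> int_lattice \<Longrightarrow> v \<in> int_lattice \<Longrightarrow> u + v \<in> int_lattice"
  by (simp add: int_lattice_def)

lemma closed_int_lattice: "closed (int_lattice :: (real ^ 'n) set)"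
proof -
  have "int_lattice = (\<Inter>i. (\<lambda>v :: real ^ 'n. v $ i) -` \<int>)"
    by (auto simp: int_lattice_def)
  moreover have "closed ((\<lambda>v :: real ^ 'n. v $ i) -` \<int>)" for i
    by (intro closed_vimage) (auto intro!: continuous_intros)
  ultimately show ?thesis
    by (metis closed_INT)
qed

quotient_type (overloaded) 'n torus = "real ^ ('n :: finite)" / lattice_equiv
  morphisms rep_torus torus_of
proof (rule equivpI)
  show "reflp (lattice_equiv :: real ^ 'n \<Rightarrow> _)"
    by (simp add: reflp_def lattice_equiv_def int_lattice_zero)
  show "symp (lattice_equiv :: real ^ 'n \<Rightarrow> _)"
    unfolding symp_def lattice_equiv_def using int_lattice_uminus by fastforce
  show "transp (lattice_equiv :: real ^ 'n \<Rightarrow> _)"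
    unfolding transp_def lattice_equiv_def using int_lattice_add by fastforce
qed

lemma torus_of_eq_iff: "torus_of x = torus_of y \<longleftrightarrow> x - y \<in> int_lattice"
  by (simp add: torus.abs_eq_iff lattice_equiv_def)

lemma surj_torus_of: "\<exists>x. X = torus_of x"
  by (metis Quotient_abs_rep[OF Quotient_torus])

lemma torus_of_add_lattice: "v \<in> int_lattice \<Longrightarrow> torus_of (x + v) = torus_of x"
  by (simp add: torus_of_eq_iff)

text \<open>
  The flat Riemannian metric makes the projection a local isometry, and its geodesics are the
  projected straight lines; so the Riemannian distance of two points is the least Euclidean
  distance between their lifts.
\<close>

instantiation torus :: (finite) metric_space
begin

definition dist_torus :: "'a torus \<Rightarrow> 'a torus \<Rightarrow> real"
  where "dist_torus X Y = Inf {dist x y | x y. torus_of x = X \<and> torus_of y = Y}"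

definition uniformity_torus :: "('a torus \<times> 'a torus) filter"
  where "uniformity_torus = (INF e\<in>{0 <..}. principal {(X, Y). dist X Y < e})"

definition open_torus :: "'a torus set \<Rightarrow> bool"
  where "open_torus U \<longleftrightarrow> (\<forall>X\<in>U. eventually (\<lambda>(X', Y). X' = X \<longrightarrow> Y \<in> U) uniformity)"

lemma dist_torus_of_infdist:
  "dist (torus_of x) (torus_of y) = infdist (x - y) (int_lattice :: (real ^ 'a) set)"
proof -
  have "{dist x' y' | x' y'. torus_of x' = torus_of x \<and> torus_of y' = torus_of y}
        = dist (x - y) ` int_lattice" (is "?L = ?R")
  proof (intro equalityI subsetI)
    fix r assume "r \<in> ?L"
    then obtain x' y' where r: "r = dist x' y'" "x' - x \<in> int_lattice" "y' - y \<in> int_lattice"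
      by (auto simp: torus_of_eq_iff)
    have "(y' - y) + - (x' - x) \<in> int_lattice"
      using r int_lattice_add int_lattice_uminus by blast
    moreover have "r = dist (x - y) ((y' - y) + - (x' - x))"
      by (simp add: r dist_norm algebra_simps)
    ultimately show "r \<in> ?R" by blast
  next
    fix r assume "r \<in> ?R"
    then obtain v where "v \<in> int_lattice" "r = dist (x - y) v" by blast
    moreover have "dist (x - y) v = dist x (y + v)"
      by (simp add: dist_norm algebra_simps)
    ultimately show "r \<in> ?L"
      using torus_of_add_lattice by fastforce
  qed
  moreover have "(int_lattice :: (real ^ 'a) set) \<noteq> {}"
    using int_lattice_zero by auto
  ultimately show ?thesis
    by (simp add: dist_torus_def infdist_notempty)
qed

instance
proof
  fix X Y Z :: "'a torus"
  obtain x y z where XYZ: "X = torus_of x" "Y = torus_of y" "Z = torus_of z"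
    using surj_torus_of by metis
  have ne: "(int_lattice :: (real ^ 'a) set) \<noteq> {}"
    using int_lattice_zero by auto
  show "dist X Y = 0 \<longleftrightarrow> X = Y"
    unfolding XYZ dist_torus_of_infdist torus_of_eq_iff
    using in_closed_iff_infdist_zero[OF closed_int_lattice ne] by blast
  obtain u where u: "u \<in> int_lattice" "infdist (x - z) int_lattice = dist (x - z) u"
    using infdist_attains_inf[OF closed_int_lattice ne] by blast
  obtain v where v: "v \<in> int_lattice" "infdist (y - z) int_lattice = dist (y - z) v"
    using infdist_attains_inf[OF closed_int_lattice ne] by blast
  have "u + - v \<in> int_lattice"
    using u v int_lattice_add int_lattice_uminus by blast
  then have "infdist (x - y) int_lattice \<le> dist (x - y) (u + - v)"
    by (rule infdist_le)
  also have "\<dots> = norm ((x - z - u) - (y - z - v))"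
    by (simp add: dist_norm algebra_simps)
  also have "\<dots> \<le> dist (x - z) u + dist (y - z) v"
    by (simp only: dist_norm norm_triangle_ineq4)
  finally show "dist X Y \<le> dist X Z + dist Y Z"
    using u v by (simp add: XYZ dist_torus_of_infdist)
qed (fact uniformity_torus_def, fact open_torus_def)

end

lemma dist_torus_of_le: "dist (torus_of x) (torus_of y) \<le> dist x y"
  unfolding dist_torus_of_infdist
  by (rule infdist_le2[OF int_lattice_zero]) (simp add: dist_norm)

lemma continuous_on_torus_of: "continuous_on S torus_of"
  unfolding continuous_on_iff using dist_torus_of_le le_less_trans by blast

lemma open_torus_iff_open_vimage: "open U \<longleftrightarrow> open (torus_of -` U)"
proof
  show "open (torus_of -` U)" if "open U"
    using continuous_on_open_vimage[OF open_UNIV, of torus_of] continuous_on_torus_of that by auto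
next
  assume op: "open (torus_of -` U)"
  show "open U"
    unfolding open_dist
  proof
    fix X assume "X \<in> U"
    obtain x where x: "X = torus_of x"
      using surj_torus_of by blast
    obtain e where e: "e > 0" "\<And>y. dist y x < e \<Longrightarrow> torus_of y \<in> U"
      using op \<open>X \<in> U\<close> by (auto simp: open_dist x)
    have "Y \<in> U" if "dist Y X < e" for Y
    proof -
      obtain y where y: "Y = torus_of y"
        using surj_torus_of by blast
      obtain u where u: "u \<in> int_lattice" "infdist (y - x) int_lattice = dist (y - x) u"
        using infdist_attains_inf[OF closed_int_lattice] int_lattice_zero by blast
      have "dist (y + - u) x < e"
        using that u by (simp add: x y dist_torus_of_infdist dist_norm algebra_simps)
      then show ?thesis
        using e(2) torus_of_add_lattice[OF int_lattice_uminus[OF u(1)], of y] y by metis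
    qed
    then show "\<exists>e>0. \<forall>Y. dist Y X < e \<longrightarrow> Y \<in> U"
      using e(1) by blast
  qed
qed

lemma borel_measurable_torus_of [measurable]: "torus_of \<in> borel_measurable borel"
  by (rule borel_measurable_continuous_onI[OF continuous_on_torus_of])

text \<open>The Riemannian measure, obtained from Lebesgue measure on a fundamental domain.\<close>

definition unit_cube :: "(real ^ 'n) set"
  where "unit_cube = {x. \<forall>i. 0 \<le> x $ i \<and> x $ i < 1}"

definition torus_measure :: "'n::finite torus measure"
  where "torus_measure = distr (restrict_space lborel unit_cube) borel torus_of"

lemma unit_cube_borel [measurable]: "unit_cube \<in> sets borel"
  unfolding unit_cube_def by measurable

lemma sets_torus_measure: "sets torus_measure = sets borel"
  by (simp add: torus_measure_def)

lemma One_vec: "(One :: real ^ 'n) = 1"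
proof -
  have "(One :: real ^ 'n) \<bullet> axis i 1 = 1" for i
    by (simp add: axis_in_Basis_iff)
  then show ?thesis
    by (simp add: vec_eq_iff inner_axis)
qed

lemma prob_space_torus_measure: "prob_space torus_measure"
proof -
  have "box 0 One \<subseteq> (unit_cube :: (real ^ 'a) set)"
    by (auto simp: unit_cube_def mem_box_cart One_vec less_imp_le)
  then have "1 \<le> emeasure lborel (unit_cube :: (real ^ 'a) set)"
    using emeasure_mono[of "box 0 One" "unit_cube :: (real ^ 'a) set" lborel] by simp
  moreover have "(unit_cube :: (real ^ 'a) set) \<subseteq> cbox 0 One"
    by (auto simp: unit_cube_def mem_box_cart One_vec less_imp_le)
  then have "emeasure lborel (unit_cube :: (real ^ 'a) set) \<le> 1"
    using emeasure_mono[of "unit_cube :: (real ^ 'a) set" "cbox 0 One" lborel] by simp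
  ultimately have "prob_space (restrict_space lborel (unit_cube :: (real ^ 'a) set))"
    by (intro prob_spaceI) (simp add: space_restrict_space emeasure_restrict_space)
  then show ?thesis
    unfolding torus_measure_def
    by (rule prob_space.prob_space_distr) (simp add: measurable_restrict_space1)
qed

section \<open>Hyperbolic toral automorphisms\<close>

definition hyperbolic_toral_automorphism :: "('n::finite torus \<Rightarrow> 'n torus) \<Rightarrow> bool"
  where "hyperbolic_toral_automorphism f \<longleftrightarrow>
    (\<exists>A :: int ^ 'n ^ 'n. \<bar>det A\<bar> = 1 \<and>
      (\<forall>(c :: complex) v. v \<noteq> 0 \<and> map_matrix of_int A *v v = c *s v \<longrightarrow> cmod c \<noteq> 1) \<and>
      (\<forall>x. f (torus_of x) = torus_of (map_matrix of_int A *v x)))"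

section \<open>The space of \<open>C\<^sup>2\<close> vector fields\<close>

definition blinfun_derivative ::
    "('a::real_normed_vector \<Rightarrow> 'b::real_normed_vector) \<Rightarrow> 'a \<Rightarrow> 'a \<Rightarrow>\<^sub>L 'b"
  where "blinfun_derivative g x = Blinfun (frechet_derivative g (at x))"

definition C2_map :: "('a::real_normed_vector \<Rightarrow> 'b::real_normed_vector) \<Rightarrow> bool"
  where "C2_map g \<longleftrightarrow>
    (\<forall>x. g differentiable at x) \<and>
    (\<forall>x. blinfun_derivative g differentiable at x) \<and>
    continuous_on UNIV (blinfun_derivative (blinfun_derivative g))"

text \<open>
  The tangent bundle of the torus is canonically trivial, so a vector field is a function from
  the torus to \<^typ>\<open>real ^ 'n\<close>, and its regularity is that of its periodic lift.
\<close>

type_synonym 'n vector_field = "'n torus \<Rightarrow> real ^ 'n"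

definition lift_field :: "'n::finite vector_field \<Rightarrow> real ^ 'n \<Rightarrow> real ^ 'n"
  where "lift_field V x = V (torus_of x)"

definition C2_fields :: "'n::finite vector_field set"
  where "C2_fields = {V. C2_map (lift_field V)}"

definition sup_dist :: "('a \<Rightarrow> 'b::metric_space) \<Rightarrow> ('a \<Rightarrow> 'b) \<Rightarrow> real"
  where "sup_dist g h = (SUP x. dist (g x) (h x))"

text \<open>The case distinction only serves the totality that \<^locale>\<open>Metric_space\<close> requires.\<close>

definition C2_dist :: "'n::finite vector_field \<Rightarrow> 'n vector_field \<Rightarrow> real"
  where "C2_dist V W =
    (if V \<in> C2_fields \<and> W \<in> C2_fields then
       sup_dist (lift_field V) (lift_field W)
       + sup_dist (blinfun_derivative (lift_field V)) (blinfun_derivative (lift_field W))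
       + sup_dist (blinfun_derivative (blinfun_derivative (lift_field V)))
                  (blinfun_derivative (blinfun_derivative (lift_field W)))
     else 0)"

definition C2_topology :: "'n::finite vector_field topology"
  where "C2_topology = Metric_space.mtopology C2_fields C2_dist"

definition unit_frames :: "nat \<Rightarrow> (nat \<Rightarrow> 'n::finite vector_field) set"
  where "unit_frames k = {V. \<forall>x.
    (\<forall>i\<in>{1..k}. norm (V i x) = 1) \<and>
    inj_on (\<lambda>i. V i x) {1..k} \<and> independent ((\<lambda>i. V i x) ` {1..k})}"

definition frame_topology :: "nat \<Rightarrow> (nat \<Rightarrow> 'n::finite vector_field) topology"
  where "frame_topology k =
    subtopology (product_topology (\<lambda>i. C2_topology) {1..k}) (unit_frames k)"

definition residual_in :: "'a topology \<Rightarrow> 'a set \<Rightarrow> bool"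
  where "residual_in X S \<longleftrightarrow> S \<subseteq> topspace X \<and>
    (\<exists>\<G>. countable \<G> \<and> (\<forall>U\<in>\<G>. openin X U \<and> X closure_of U = topspace X) \<and>
         topspace X \<inter> \<Inter>\<G> \<subseteq> S)"

subsection \<open>The distance is a metric\<close>

definition lattice_periodic :: "(real ^ 'n \<Rightarrow> 'b) \<Rightarrow> bool"
  where "lattice_periodic g \<longleftrightarrow> (\<forall>x. \<forall>v\<in>int_lattice. g (x + v) = g x)"

lemma lattice_periodic_lift_field: "lattice_periodic (lift_field V)"
  by (simp add: lattice_periodic_def lift_field_def torus_of_add_lattice)

lemma lattice_periodic_blinfun_derivative:
  assumes "lattice_periodic g"
  shows "lattice_periodic (blinfun_derivative g)"
proof -
  have "(g has_derivative D) (at (x + v))"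
    if "v \<in> int_lattice" "(g has_derivative D) (at x)" for x v D
  proof -
    have "((\<lambda>y. y + - v) has_derivative (\<lambda>h. h)) (at (x + v))"
      by (auto intro!: derivative_eq_intros)
    then have "(g \<circ> (\<lambda>y. y + - v) has_derivative D \<circ> (\<lambda>h. h)) (at (x + v))"
      by (rule diff_chain_at) (simp add: that(2))
    moreover have "g \<circ> (\<lambda>y. y + - v) = g"
      using assms int_lattice_uminus[OF that(1)]
      by (simp add: lattice_periodic_def fun_eq_iff del: add_uminus_conv_diff)
    ultimately show ?thesis
      by (simp add: o_def)
  qed
  then have "(g has_derivative D) (at (x + v)) \<longleftrightarrow> (g has_derivative D) (at x)"
    if "v \<in> int_lattice" for x v D
    using that int_lattice_uminus[OF that] by fastforce
  then show ?thesis
    by (simp add: lattice_periodic_def blinfun_derivative_def frechet_derivative_def)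
qed

lemma bounded_lattice_periodic:
  fixes g :: "real ^ 'n \<Rightarrow> 'b::metric_space"
  assumes "continuous_on UNIV g" "lattice_periodic g"
  shows "bounded (range g)"
proof -
  have "range g \<subseteq> g ` cbox 0 One"
  proof clarify
    fix x :: "real ^ 'n"
    define v :: "real ^ 'n" where "v = (\<chi> i. - of_int \<lfloor>x $ i\<rfloor>)"
    have "v \<in> int_lattice"
      by (simp add: v_def int_lattice_def)
    moreover have "x + v \<in> cbox 0 One"
      by (auto simp: mem_box_cart One_vec v_def) linarith
    ultimately show "g x \<in> g ` cbox 0 One"
      using assms(2) unfolding lattice_periodic_def by (metis image_eqI)
  qed
  moreover have "bounded (g ` cbox 0 One)"
    by (meson assms(1) compact_cbox compact_continuous_image compact_imp_bounded
        continuous_on_subset subset_UNIV)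
  ultimately show ?thesis
    by (rule bounded_subset[rotated])
qed

lemma bounded_C2_field:
  assumes "V \<in> C2_fields"
  shows "bounded (range (lift_field V))"
    and "bounded (range (blinfun_derivative (lift_field V)))"
    and "bounded (range (blinfun_derivative (blinfun_derivative (lift_field V))))"
proof -
  have C2: "C2_map (lift_field V)"
    using assms by (simp add: C2_fields_def)
  have per: "lattice_periodic (lift_field V)" by (rule lattice_periodic_lift_field)
  show "bounded (range (lift_field V))"
    using C2 per by (intro bounded_lattice_periodic)
      (auto simp: C2_map_def intro!: differentiable_imp_continuous_on
         simp: differentiable_on_def)
  show "bounded (range (blinfun_derivative (lift_field V)))"
    using C2 per by (intro bounded_lattice_periodic lattice_periodic_blinfun_derivative)
      (auto simp: C2_map_def intro!: differentiable_imp_continuous_on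
         simp: differentiable_on_def)
  show "bounded (range (blinfun_derivative (blinfun_derivative (lift_field V))))"
    using C2 per by (intro bounded_lattice_periodic lattice_periodic_blinfun_derivative)
      (auto simp: C2_map_def)
qed

lemma bdd_above_sup_dist:
  assumes "bounded (range g)" "bounded (range h)"
  shows "bdd_above (range (\<lambda>x. dist (g x) (h x)))"
proof -
  have "bounded (range g \<union> range h)"
    using assms by simp
  then obtain e where "\<forall>y\<in>range g \<union> range h. \<forall>z\<in>range g \<union> range h. dist y z \<le> e"
    by (auto simp only: bounded_two_points)
  then show ?thesis
    by (intro bdd_aboveI[of _ e]) auto
qed

lemma sup_dist_upper:
  assumes "bounded (range g)" "bounded (range h)"
  shows "dist (g x) (h x) \<le> sup_dist g h"
  unfolding sup_dist_def by (rule cSUP_upper[OF UNIV_I bdd_above_sup_dist[OF assms]])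

lemma sup_dist_nonneg:
  assumes "bounded (range g)" "bounded (range h)"
  shows "0 \<le> sup_dist g h"
  using order_trans[OF zero_le_dist sup_dist_upper[OF assms]] .

lemma sup_dist_commute: "sup_dist g h = sup_dist h g"
  by (simp add: sup_dist_def dist_commute)

lemma sup_dist_self: "sup_dist g g = 0"
  by (simp add: sup_dist_def)

lemma sup_dist_triangle:
  assumes "bounded (range f)" "bounded (range g)" "bounded (range h)"
  shows "sup_dist f h \<le> sup_dist f g + sup_dist g h"
proof -
  have "dist (f x) (h x) \<le> sup_dist f g + sup_dist g h" for x
    using dist_triangle[of "f x" "h x" "g x"] sup_dist_upper[OF assms(1,2), of x]
      sup_dist_upper[OF assms(2,3), of x] by linarith
  then show ?thesis
    unfolding sup_dist_def[of f h] by (intro cSUP_least) auto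
qed

lemma Metric_space_C2: "Metric_space C2_fields C2_dist"
proof
  fix U V W :: "'a vector_field"
  show "0 \<le> C2_dist V W"
    by (simp add: C2_dist_def sup_dist_nonneg bounded_C2_field)
  show "C2_dist V W = C2_dist W V"
    by (simp add: C2_dist_def sup_dist_commute)
  show "C2_dist V W = 0 \<longleftrightarrow> V = W" if VW: "V \<in> C2_fields" "W \<in> C2_fields"
  proof
    assume "C2_dist V W = 0"
    then have 0: "sup_dist (lift_field V) (lift_field W) \<le> 0"
      using VW bounded_C2_field sup_dist_nonneg unfolding C2_dist_def
      by (smt (verit, best))
    have "V X = W X" for X
    proof -
      obtain x where "X = torus_of x" using surj_torus_of by blast
      then show ?thesis
        using sup_dist_upper[OF bounded_C2_field(1)[OF VW(1)] bounded_C2_field(1)[OF VW(2)], of x] 0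
        by (simp add: lift_field_def) (metis dist_le_zero_iff order_trans)
    qed
    then show "V = W" by blast
  qed (simp add: C2_dist_def sup_dist_self)
  show "C2_dist U W \<le> C2_dist U V + C2_dist V W"
    if "U \<in> C2_fields" "V \<in> C2_fields" "W \<in> C2_fields"
    using sup_dist_triangle[OF bounded_C2_field(1)[OF that(1)] bounded_C2_field(1)[OF that(2)]
        bounded_C2_field(1)[OF that(3)]]
      sup_dist_triangle[OF bounded_C2_field(2)[OF that(1)] bounded_C2_field(2)[OF that(2)]
        bounded_C2_field(2)[OF that(3)]]
      sup_dist_triangle[OF bounded_C2_field(3)[OF that(1)] bounded_C2_field(3)[OF that(2)]
        bounded_C2_field(3)[OF that(3)]] that
    by (simp add: C2_dist_def)
qed

lemma topspace_frame_topology: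
  "topspace (frame_topology k) = (\<Pi>\<^sub>E i\<in>{1..k}. C2_fields) \<inter> unit_frames k"
  by (simp add: frame_topology_def C2_topology_def Metric_space.topspace_mtopology[OF Metric_space_C2])

section \<open>Random perturbations\<close>

definition integral_curve :: "'n::finite vector_field \<Rightarrow> (real \<Rightarrow> 'n torus) \<Rightarrow> bool"
  where "integral_curve V \<gamma> \<longleftrightarrow>
    (\<exists>\<Gamma>. \<forall>t. \<gamma> t = torus_of (\<Gamma> t) \<and> (\<Gamma> has_vector_derivative V (\<gamma> t)) (at t))"

text \<open>
  Uniquely determined for the fields in \<^const>\<open>C2_fields\<close>, which are bounded and
  Lipschitz continuous.
\<close>

definition integral_curve_through :: "'n::finite vector_field \<Rightarrow> 'n torus \<Rightarrow> real \<Rightarrow> 'n torus"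
  where "integral_curve_through V x = (THE \<gamma>. integral_curve V \<gamma> \<and> \<gamma> 0 = x)"

text \<open>
  The arc is the image of this set; connectedness is understood along the curve, hence in the
  parameter.
\<close>

definition arc_domain :: "'n::finite vector_field \<Rightarrow> real \<Rightarrow> 'n torus \<Rightarrow> real set"
  where "arc_domain V e x =
    connected_component_set {t. dist (integral_curve_through V x t) x \<le> e} 0"

text \<open>
  The curve is injective on \<^const>\<open>arc_domain\<close> unless it is closed and entirely within
  distance \<open>e\<close> of \<open>x\<close>. In that case the condition below cuts the parameters down to one
  period centred at \<open>0\<close>, so that (up to a null set) each point of the arc is counted once.
\<close>

definition arc_parameters :: "'n::finite vector_field \<Rightarrow> real \<Rightarrow> 'n torus \<Rightarrow> real set"
  where "arc_parameters V e x = {t \<in> arc_domain V e x. \<forall>s\<in>arc_domain V e x.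
    integral_curve_through V x s = integral_curve_through V x t \<longrightarrow> \<bar>t\<bar> \<le> \<bar>s\<bar>}"

text \<open>
  For a unit field the parameter is arc length. If the arc has infinite length there is no
  uniform distribution on it, and \<^const>\<open>uniform_measure\<close> yields the null measure. An
  invariant probability measure then gives mass \<open>0\<close> to the points whose transition
  probability is not a probability measure.
\<close>

lemma uniform_measure_infinite: "emeasure M A = \<infinity> \<Longrightarrow> uniform_measure M A = null_measure M"
  by (simp add: uniform_measure_def null_measure_eq_density)

definition arc_kernel :: "'n::finite vector_field \<Rightarrow> real \<Rightarrow> 'n torus \<Rightarrow> 'n torus measure"
  where "arc_kernel V e x =
    distr (uniform_measure lborel (arc_parameters V e x)) borel (integral_curve_through V x)"

primrec composed_arc_kernel ::
    "(nat \<Rightarrow> 'n::finite vector_field) \<Rightarrow> (nat \<Rightarrow> real) \<Rightarrow> nat \<Rightarrow> 'n torus \<Rightarrow> 'n torus measure"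
  where
    "composed_arc_kernel V \<epsilon> 0 x = return borel x"
  | "composed_arc_kernel V \<epsilon> (Suc i) x =
      composed_arc_kernel V \<epsilon> i x \<bind> arc_kernel (V (Suc i)) (\<epsilon> (Suc i))"

definition random_perturbation ::
    "('n::finite torus \<Rightarrow> 'n torus) \<Rightarrow> nat \<Rightarrow> (nat \<Rightarrow> 'n vector_field) \<Rightarrow> (nat \<Rightarrow> real) \<Rightarrow>
      'n torus \<Rightarrow> 'n torus measure"
  where "random_perturbation f k V \<epsilon> x = composed_arc_kernel V \<epsilon> k (f x)"

definition invariant_measure ::
    "('a::topological_space \<Rightarrow> 'a measure) \<Rightarrow> 'a measure \<Rightarrow> bool"
  where "invariant_measure P \<mu> \<longleftrightarrow> prob_space \<mu> \<and> sets \<mu> = sets borel \<and>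
    (\<forall>A\<in>sets borel. (\<integral>\<^sup>+x. emeasure (P x) A \<partial>\<mu>) = emeasure \<mu> A)"

end

theory Submission
  imports Defs
begin

text \<open>
  If an invariant measure has a singular part, that part is carried by a nonempty null set \<open>B\<close>
  which the chain almost surely does not leave. Conditioning on the times spent on the arcs, from
  every \<open>p \<in> B\<close> almost all small times lead back to \<open>B\<close>. After \<open>N\<close> steps the derivative in the
  times spent along \<open>V\<^sub>1\<close>, taken at time \<open>0\<close>, has the columns \<open>A\<^sup>N\<^sup>-\<^sup>j V\<^sub>1(A\<^sup>j p)\<close>; if these span,
  then \<open>B\<close> cannot be null.

  For generic \<open>V\<^sub>1\<close> they span whenever the first \<open>N\<close> images of \<open>p\<close> are distinct: \<open>V\<^sub>1\<close> can be
  perturbed independently at these images, and annihilation by a covector imposes \<open>N\<close> conditions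
  on \<open>2n - 1\<close> parameters. The remaining points form a countable set, by hyperbolicity, and the
  flow leaves it at almost all times.
\<close>

section \<open>Flows of bounded Lipschitz fields\<close>

text \<open>The obstacle is that only almost all times lead back to \<open>B\<close>: the orbit with
  all times equal to 0 may leave it, so the endpoint map cannot simply be evaluated there. What is
  carried along instead is a family of maps of one n-dimensional parameter \<open>v\<close>,
  arbitrarily close near 0 to a fixed affine model and sending almost every small \<open>v\<close>
  into the current set. At every arc a small generic offset of the time is frozen; the rest of the
  time is linear in \<open>v\<close> on the arcs of \<open>V 1\<close> and zero on the others. Once
  the linear part is the identity, the maps are bi-Lipschitz near 0 and would pull a null set back
  to almost a whole ball. Covectors are normalized by one coordinate equal to 1. Each of the n
  choices of this coordinate gets 2n + 1 bumps of its own, one more than the dimension of the pairs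
  (point, covector); hence N = n (2n + 1). The perturbation works only near one point. Spanning on a
  compact ball is an open condition on \<open>V 1\<close>, so countably many balls covering the
  complement of the exceptional set give countably many open dense sets.\<close>

lemma has_vector_derivative_affine:
  assumes "(\<gamma> has_vector_derivative v) (at (c * s + d))"
  shows "((\<lambda>s. \<gamma> (c * s + d)) has_vector_derivative c *\<^sub>R v) (at s)"
proof -
  have "((\<lambda>s. c * s + d) has_vector_derivative c) (at s)"
    unfolding has_real_derivative_iff_has_vector_derivative[symmetric]
    by (auto intro!: derivative_eq_intros)
  from vector_diff_chain_at[OF this assms] show ?thesis
    by (simp add: o_def)
qed

text \<open>The mean value inequality for both signs of time. For negative \<open>t\<close> the
  curve is reflected, which is why the majorant is evaluated at the absolute value.\<close>

lemma norm_diff_le_of_derivative: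
  fixes H :: "real \<Rightarrow> 'a::real_normed_vector"
  assumes H: "\<And>t. (H has_vector_derivative h t) (at t)"
    and p: "\<And>t. (p has_real_derivative p' t) (at t)"
    and le: "\<And>s. norm (h s) \<le> p' \<bar>s\<bar>"
  shows "norm (H t - H 0) \<le> p \<bar>t\<bar> - p 0"
proof -
  have pos: "norm (H' t - H' 0) \<le> p t - p 0"
    if H': "\<And>t. (H' has_vector_derivative h' t) (at t)" and "\<And>s. norm (h' s) \<le> p' \<bar>s\<bar>" "t \<ge> 0"
    for H' :: "real \<Rightarrow> 'a" and h' t
  proof (cases "t = 0")
    case False
    show ?thesis
    proof (rule differentiable_bound_general[where f' = h' and \<phi>' = p'])
      show "0 < t" using False that by simp
      show "continuous_on {0..t} H'"
        using H' by (meson continuous_at_imp_continuous_on has_vector_derivative_continuous)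
      show "continuous_on {0..t} p"
        using p by (meson DERIV_isCont continuous_at_imp_continuous_on)
      show "(p has_vector_derivative p' x) (at x)" for x
        using p by (simp add: has_real_derivative_iff_has_vector_derivative)
      show "norm (h' x) \<le> p' x" if "0 < x" for x
        using \<open>\<And>s. norm (h' s) \<le> p' \<bar>s\<bar>\<close>[of x] that by simp
    qed (use H' in auto)
  qed auto
  show ?thesis
  proof (cases "t \<ge> 0")
    case True
    then show ?thesis using pos[OF H le] by simp
  next
    case False
    have "((\<lambda>t. H (- t)) has_vector_derivative - h (- s)) (at s)" for s
      using has_vector_derivative_affine[of H "h (- s)" "-1" s 0] H by simp
    then show ?thesis
      using pos[of "\<lambda>t. H (- t)" "\<lambda>s. - h (- s)" "- t"] le[of "- s" for s] False by simp
  qed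
qed

lemma antiderivative_exists:
  fixes h :: "real \<Rightarrow> 'a::banach"
  assumes "continuous_on UNIV h"
  shows "\<exists>H. H 0 = 0 \<and> (\<forall>t. (H has_vector_derivative h t) (at t))"
proof -
  \<comment> \<open>One of the two integrals always vanishes, so this is the signed integral from 0
    to \<open>t\<close>.\<close>
  define H where "H t = integral {0..t} h - integral {t..0} h" for t
  have int: "h integrable_on {a..b}" for a b
    using assms by (meson continuous_on_subset integrable_continuous_real subset_UNIV)
  have eq: "H t = integral {a..t} h - integral {a..0} h" if "a \<le> t" "a \<le> 0" for a t
  proof (cases "t \<ge> 0")
    case True
    have "integral {t..0} h = 0"
      using True by (cases "t = 0") auto
    then show ?thesis
      using Henstock_Kurzweil_Integration.integral_combine[OF \<open>a \<le> 0\<close> True int] unfolding H_def by (simp add: algebra_simps)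
  next
    case False
    then show ?thesis
      using Henstock_Kurzweil_Integration.integral_combine[OF \<open>a \<le> t\<close> _ int, of 0] unfolding H_def by (simp add: algebra_simps)
  qed
  have "(H has_vector_derivative h t) (at t)" for t
  proof -
    define a where "a = - \<bar>t\<bar> - 1"
    define b where "b = \<bar>t\<bar> + 1"
    have t: "t \<in> {a<..<b}" by (auto simp: a_def b_def)
    have "((\<lambda>u. integral {a..u} h) has_vector_derivative h t) (at t within {a..b})"
      using t by (intro integral_has_vector_derivative continuous_on_subset[OF assms]) auto
    then have "((\<lambda>u. integral {a..u} h) has_vector_derivative h t) (at t)"
      using t by (auto simp: at_within_Icc_at)
    then have "((\<lambda>u. integral {a..u} h - integral {a..0} h) has_vector_derivative h t) (at t)"
      by (auto intro!: derivative_eq_intros)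
    then show ?thesis
      by (rule has_vector_derivative_transform_within_open[of _ _ _ "{a<..<b}"])
        (use t in \<open>auto simp: eq[of a] a_def\<close>)
  qed
  moreover have "H 0 = 0" by (simp add: H_def)
  ultimately show ?thesis by blast
qed

locale lipschitz_field =
  fixes g :: "'a::euclidean_space \<Rightarrow> 'a" and L :: real
  assumes L_pos: "L > 0"
    and lip: "\<And>x y. norm (g x - g y) \<le> L * norm (x - y)"
    and bound: "\<And>x. norm (g x) \<le> 1"

definition solution :: "('a::euclidean_space \<Rightarrow> 'a) \<Rightarrow> 'a \<Rightarrow> (real \<Rightarrow> 'a) \<Rightarrow> bool"
  where "solution g x \<gamma> \<longleftrightarrow> \<gamma> 0 = x \<and> (\<forall>t. (\<gamma> has_vector_derivative g (\<gamma> t)) (at t))"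

definition flow :: "('a::euclidean_space \<Rightarrow> 'a) \<Rightarrow> real \<Rightarrow> 'a \<Rightarrow> 'a"
  where "flow g t x = (SOME \<gamma>. solution g x \<gamma>) t"

context lipschitz_field
begin

lemma continuous_field: "continuous_on S g"
proof (rule continuous_on_subset[OF _ subset_UNIV])
  have "L-lipschitz_on UNIV g"
    using lip L_pos by (intro lipschitz_onI) (auto simp: dist_norm)
  then show "continuous_on UNIV g" by (rule lipschitz_on_continuous_on)
qed

text \<open>Fixed points in the space of curves with the norm weighted by \<open>exp (-2L|t|)\<close>.\<close>

lemma solution_exists: "\<exists>\<gamma>. solution g x \<gamma>"
proof -
  \<comment> \<open>The bounded function \<open>u\<close> stands for the curve x + exp (2L|s|) u(s),
    so that the sup norm of \<open>u\<close> is the weighted norm of the displacement.\<close>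
  define h where "h u s = g (x + exp (2 * L * \<bar>s\<bar>) *\<^sub>R apply_bcontfun u s)" for u s
  define H where "H u = (SOME H. H 0 = 0 \<and> (\<forall>t. (H has_vector_derivative h u t) (at t)))" for u
  have "continuous_on UNIV (h u)" for u
    unfolding h_def
    by (intro continuous_on_compose2[OF continuous_field[of UNIV]] continuous_intros) auto
  then have H: "H u 0 = 0" "(H u has_vector_derivative h u t) (at t)" for u t
    using someI_ex[OF antiderivative_exists] unfolding H_def by blast+
  have hb: "norm (h u s) \<le> 1" for u s
    by (simp add: h_def bound)
  have Hb: "norm (H u t) \<le> \<bar>t\<bar>" for u t
    using norm_diff_le_of_derivative[OF H(2), where p = "\<lambda>t. t" and p' = "\<lambda>_. 1"] hb H(1) by simp
  define T where "T u = Bcontfun (\<lambda>t. exp (- (2 * L * \<bar>t\<bar>)) *\<^sub>R H u t)" for u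
  have "(\<lambda>t. exp (- (2 * L * \<bar>t\<bar>)) *\<^sub>R H u t) \<in> bcontfun" for u
  proof (rule bcontfun_normI)
    have "continuous_on UNIV (H u)"
      using H by (meson continuous_at_imp_continuous_on has_vector_derivative_continuous)
    then show "continuous_on UNIV (\<lambda>t. exp (- (2 * L * \<bar>t\<bar>)) *\<^sub>R H u t)"
      by (intro continuous_intros)
    fix t
    have "\<bar>t\<bar> * (2 * L) \<le> exp (2 * L * \<bar>t\<bar>)"
      using exp_ge_add_one_self[of "2 * L * \<bar>t\<bar>"] by (simp add: mult_ac del: exp_ge_add_one_self)
    then have "\<bar>t\<bar> \<le> exp (2 * L * \<bar>t\<bar>) / (2 * L)"
      using L_pos by (simp add: field_simps)
    then have "norm (H u t) \<le> exp (2 * L * \<bar>t\<bar>) / (2 * L)"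
      using Hb order_trans by blast
    then show "norm (exp (- (2 * L * \<bar>t\<bar>)) *\<^sub>R H u t) \<le> 1 / (2 * L)"
      using L_pos by (simp add: exp_minus field_simps)
  qed
  then have T: "apply_bcontfun (T u) t = exp (- (2 * L * \<bar>t\<bar>)) *\<^sub>R H u t" for u t
    by (simp add: T_def Bcontfun_inverse)
  \<comment> \<open>The rate 2L in the weight produces the contraction factor 1/2: the integral of L
    exp (2Ls) from 0 to |t| is below exp (2L|t|) / 2.\<close>
  have "dist (T u) (T w) \<le> 1/2 * dist u w" for u w
  proof (rule dist_bound)
    fix t
    have "norm (h u s - h w s) \<le> L * exp (2 * L * \<bar>s\<bar>) * dist u w" for s
    proof -
      have "norm (h u s - h w s) \<le> L * norm (exp (2 * L * \<bar>s\<bar>) *\<^sub>R (u s - w s))"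
        unfolding h_def using lip[of "x + exp (2 * L * \<bar>s\<bar>) *\<^sub>R u s" "x + exp (2 * L * \<bar>s\<bar>) *\<^sub>R w s"]
        by (simp add: scaleR_diff_right)
      also have "\<dots> \<le> L * (exp (2 * L * \<bar>s\<bar>) * dist u w)"
        using dist_bounded[of u s w] L_pos by (simp add: dist_norm)
      finally show ?thesis by (simp add: mult_ac)
    qed
    moreover have "((\<lambda>t. exp (2 * L * t) / 2 * dist u w) has_real_derivative L * exp (2 * L * t) * dist u w) (at t)" for t
      by (auto intro!: derivative_eq_intros)
    ultimately have "norm ((H u t - H w t) - (H u 0 - H w 0)) \<le> exp (2 * L * \<bar>t\<bar>) / 2 * dist u w - exp (2 * L * 0) / 2 * dist u w"
      by (intro norm_diff_le_of_derivative[where h = "\<lambda>t. h u t - h w t"])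
        (auto intro!: has_vector_derivative_diff H)
    then have "norm (H u t - H w t) \<le> exp (2 * L * \<bar>t\<bar>) / 2 * dist u w"
      by (simp add: H(1)) (use zero_le_dist[of u w] in linarith)
    then have "exp (- (2 * L * \<bar>t\<bar>)) * norm (H u t - H w t) \<le> 1/2 * dist u w"
      by (simp add: exp_minus field_simps)
    then show "dist (T u t) (T w t) \<le> 1/2 * dist u w"
      by (simp add: T dist_norm flip: scaleR_diff_right)
  qed
  then have "\<exists>!u. T u = u"
    by (intro banach_fix_type[of "1/2"]) auto
  then obtain u where u: "T u = u" by blast
  have "h u t = g (x + H u t)" for t
  proof -
    have "apply_bcontfun u t = exp (- (2 * L * \<bar>t\<bar>)) *\<^sub>R H u t"
      using T[of u t] u by simp
    then show ?thesis
      by (simp add: h_def flip: exp_add)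
  qed
  then have "((\<lambda>t. x + H u t) has_vector_derivative g (x + H u t)) (at t)" for t
    using H(2)[of u t] by (auto intro!: derivative_eq_intros)
  then have "solution g x (\<lambda>t. x + H u t)"
    by (simp add: solution_def H(1))
  then show ?thesis by blast
qed

text \<open>By Cauchy-Schwarz the squared distance times exp (-2Lt) has nonpositive derivative. The
  square is used because the norm is not differentiable at 0.\<close>

lemma solution_gronwall_pos:
  assumes \<gamma>: "\<And>t. (\<gamma> has_vector_derivative g (\<gamma> t)) (at t)"
    and \<eta>: "\<And>t. (\<eta> has_vector_derivative g (\<eta> t)) (at t)" and "t \<ge> 0"
  shows "norm (\<gamma> t - \<eta> t) \<le> exp (L * t) * norm (\<gamma> 0 - \<eta> 0)"
proof -
  define d where "d t = \<gamma> t - \<eta> t" for t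
  define q where "q t = (d t \<bullet> d t) * exp (- (2 * L * t))" for t
  have d: "(d has_vector_derivative g (\<gamma> t) - g (\<eta> t)) (at t)" for t
    unfolding d_def by (intro has_vector_derivative_diff \<gamma> \<eta>)
  have dd: "((\<lambda>t. d t \<bullet> d t) has_real_derivative 2 * (d t \<bullet> (g (\<gamma> t) - g (\<eta> t)))) (at t)" for t
    unfolding has_field_derivative_def
    by (rule has_derivative_eq_rhs[OF has_derivative_inner[OF d[unfolded has_vector_derivative_def] d[unfolded has_vector_derivative_def]]])
      (auto simp: inner_commute algebra_simps)
  have q: "(q has_real_derivative (2 * (d t \<bullet> (g (\<gamma> t) - g (\<eta> t))) - 2 * L * (d t \<bullet> d t)) * exp (- (2 * L * t))) (at t)" for t
    unfolding q_def by (auto intro!: derivative_eq_intros dd simp: algebra_simps)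
  have "q t \<le> q 0"
  proof (rule DERIV_nonpos_imp_nonincreasing[OF \<open>t \<ge> 0\<close>])
    fix s
    have "d s \<bullet> (g (\<gamma> s) - g (\<eta> s)) \<le> norm (d s) * norm (g (\<gamma> s) - g (\<eta> s))"
      by (rule norm_cauchy_schwarz)
    also have "\<dots> \<le> norm (d s) * (L * norm (d s))"
      unfolding d_def by (intro mult_left_mono lip) auto
    also have "\<dots> = L * (d s \<bullet> d s)"
      by (simp add: power2_norm_eq_inner[symmetric] power2_eq_square)
    finally show "\<exists>y. (q has_real_derivative y) (at s) \<and> y \<le> 0"
      by (intro exI[of _ "(2 * (d s \<bullet> (g (\<gamma> s) - g (\<eta> s))) - 2 * L * (d s \<bullet> d s)) * exp (- (2 * L * s))"] conjI q)
        (simp add: mult_le_0_iff)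
  qed
  then have "(norm (d t))\<^sup>2 * exp (- (2 * L * t)) \<le> (norm (d 0))\<^sup>2"
    by (simp add: q_def power2_norm_eq_inner)
  then have "(norm (d t))\<^sup>2 \<le> (exp (L * t) * norm (d 0))\<^sup>2"
    by (simp add: power_mult_distrib exp_minus field_simps flip: exp_double)
  then show ?thesis
    unfolding d_def[symmetric] by (rule power2_le_imp_le) auto
qed

end

lemma lipschitz_field_uminus: "lipschitz_field g L \<Longrightarrow> lipschitz_field (\<lambda>x. - g x) L"
  by (auto simp: lipschitz_field_def norm_minus_commute)

context lipschitz_field
begin

lemma solution_gronwall:
  assumes \<gamma>: "\<And>t. (\<gamma> has_vector_derivative g (\<gamma> t)) (at t)"
    and \<eta>: "\<And>t. (\<eta> has_vector_derivative g (\<eta> t)) (at t)"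
  shows "norm (\<gamma> t - \<eta> t) \<le> exp (L * \<bar>t\<bar>) * norm (\<gamma> 0 - \<eta> 0)"
proof (cases "t \<ge> 0")
  case True
  then show ?thesis using solution_gronwall_pos[OF assms] by simp
next
  case False
  interpret r: lipschitz_field "\<lambda>x. - g x" L
    by (rule lipschitz_field_uminus) unfold_locales
  have "((\<lambda>t. \<zeta> (- t)) has_vector_derivative - g (\<zeta> (- s))) (at s)"
    if "\<And>t. (\<zeta> has_vector_derivative g (\<zeta> t)) (at t)" for s \<zeta>
    using has_vector_derivative_affine[of \<zeta> "g (\<zeta> (- s))" "-1" s 0] that by simp
  from r.solution_gronwall_pos[OF this[OF \<gamma>] this[OF \<eta>], of "- t"] False show ?thesis by simp
qed

lemma solution_unique: "solution g x \<gamma> \<Longrightarrow> solution g x \<eta> \<Longrightarrow> \<gamma> = \<eta>"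
  using solution_gronwall[of \<gamma> \<eta>] by (force simp: solution_def fun_eq_iff)

lemma solution_flow: "solution g x (\<lambda>t. flow g t x)"
  using someI_ex[OF solution_exists[of x]] unfolding flow_def .

lemma flow_0 [simp]: "flow g 0 x = x"
  using solution_flow[of x] by (simp add: solution_def)

lemma flow_has_vector_derivative: "((\<lambda>t. flow g t x) has_vector_derivative g (flow g t x)) (at t)"
  using solution_flow[of x] by (simp add: solution_def)

lemma flow_unique: "solution g x \<gamma> \<Longrightarrow> \<gamma> t = flow g t x"
  using solution_unique[OF _ solution_flow, of x \<gamma>] by simp

lemma flow_lipschitz: "norm (flow g t x - flow g t y) \<le> exp (L * \<bar>t\<bar>) * norm (x - y)"
  using solution_gronwall[OF flow_has_vector_derivative flow_has_vector_derivative] by simp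

lemma flow_add: "flow g (s + t) x = flow g s (flow g t x)"
proof (rule flow_unique[of "flow g t x" "\<lambda>s. flow g (s + t) x"])
  have "((\<lambda>s. flow g (s + t) x) has_vector_derivative g (flow g (s + t) x)) (at s)" for s
    using has_vector_derivative_affine[of "\<lambda>t. flow g t x" "g (flow g (s + t) x)" 1 s t]
      flow_has_vector_derivative by simp
  then show "solution g (flow g t x) (\<lambda>s. flow g (s + t) x)"
    by (simp add: solution_def)
qed

lemma flow_uminus: "flow g t (flow g (- t) x) = x"
  using flow_add[of t "- t" x] by simp

lemma flow_time_lipschitz: "norm (flow g t x - flow g s x) \<le> \<bar>t - s\<bar>"
proof -
  have "norm (flow g (t - s) (flow g s x) - flow g 0 (flow g s x)) \<le> \<bar>t - s\<bar> - 0"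
    by (rule norm_diff_le_of_derivative[OF flow_has_vector_derivative, where p = "\<lambda>t. t" and p' = "\<lambda>_. 1"])
      (auto simp: bound)
  then show ?thesis by (simp flip: flow_add)
qed

lemma continuous_on_flow: "continuous_on UNIV (\<lambda>(t, x). flow g t x)"
  unfolding continuous_on_iff
proof (clarsimp simp: case_prod_unfold)
  fix t x and e :: real assume "e > 0"
  define M where "M = exp (L * (\<bar>t\<bar> + 1))"
  have M: "M \<ge> 1" using L_pos by (simp add: M_def)
  define d where "d = min 1 (e / (2 * M))"
  have "d > 0" using M \<open>e > 0\<close> by (simp add: d_def)
  have "dist (flow g s y) (flow g t x) < e" if "dist (s, y) (t, x) < d" for s y
  proof -
    have s: "\<bar>s - t\<bar> < d" and y: "norm (y - x) < d"
      using that dist_fst_le[of "(s, y)" "(t, x)"] dist_snd_le[of "(s, y)" "(t, x)"]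
      by (auto simp: dist_norm)
    have "norm (flow g s y - flow g s x) \<le> exp (L * \<bar>s\<bar>) * norm (y - x)"
      by (rule flow_lipschitz)
    also have "\<dots> \<le> M * norm (y - x)"
      unfolding M_def using s d_def L_pos by (intro mult_right_mono) auto
    also have "\<dots> < M * d"
      using y M by simp
    also have "M * d \<le> e / 2"
      using M by (simp add: d_def min_def field_simps)
    finally have 1: "norm (flow g s y - flow g s x) < e / 2" .
    have "d \<le> e / (2 * M)" by (simp add: d_def)
    also have "\<dots> \<le> e / 2" using M \<open>e > 0\<close> by (simp add: field_simps)
    finally have "norm (flow g s x - flow g t x) < e / 2"
      using flow_time_lipschitz[of s x t] s by linarith
    with 1 show ?thesis
      using dist_triangle_half_r[of "flow g s x" "flow g s y" e "flow g t x"]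
      by (simp add: dist_norm norm_minus_commute)
  qed
  then show "\<exists>d>0. \<forall>s y. dist (s, y) (t, x) < d \<longrightarrow> dist (flow g s y) (flow g t x) < e"
    using \<open>d > 0\<close> by blast
qed

text \<open>Along the orbit the field changes by at most L|s| after time s, and this is integrated.
  The estimate later excludes short closed orbits.\<close>

lemma flow_near_line: "norm (flow g t x - x - t *\<^sub>R g x) \<le> L * t\<^sup>2"
proof -
  have "norm ((flow g t x - t *\<^sub>R g x) - (flow g 0 x - 0 *\<^sub>R g x)) \<le> L * \<bar>t\<bar>\<^sup>2 / 2 - L * 0\<^sup>2 / 2"
  proof (rule norm_diff_le_of_derivative)
    show "((\<lambda>t. flow g t x - t *\<^sub>R g x) has_vector_derivative g (flow g t x) - g x) (at t)" for t
      by (auto intro!: derivative_eq_intros flow_has_vector_derivative)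
    show "((\<lambda>t. L * t\<^sup>2 / 2) has_real_derivative L * t) (at t)" for t
      by (auto intro!: derivative_eq_intros)
    show "norm (g (flow g s x) - g x) \<le> L * \<bar>s\<bar>" for s
      using lip[of "flow g s x" x] flow_time_lipschitz[of s x 0] L_pos
      by (smt (verit, best) flow_0 mult_left_mono diff_zero)
  qed
  then show ?thesis
    using L_pos by (simp add: field_simps) (smt (verit) zero_le_power2 mult_nonneg_nonneg)
qed

text \<open>
  Strict differentiability of the flow at \<open>(0, p)\<close>; unlike continuous differentiability it
  follows from Gronwall's inequality without the variational equation.
\<close>

lemma flow_strict_derivative:
  assumes "e > 0"
  shows "\<exists>d>0. \<forall>t t' x x'. \<bar>t\<bar> \<le> d \<longrightarrow> \<bar>t'\<bar> \<le> d \<longrightarrow> norm (x - p) \<le> d \<longrightarrow> norm (x' - p) \<le> d \<longrightarrow>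
    norm (flow g t x - flow g t' x' - ((x - x') + (t - t') *\<^sub>R g p)) \<le> e * (\<bar>t - t'\<bar> + norm (x - x'))"
proof -
  \<comment> \<open>Within time 1 two orbits separate at most by the factor exp L, so L exp L bounds
    the rate at which their difference changes per unit of |x - x'|; times \<open>d\<close> this
    stays below e/2.\<close>
  define d where "d = min 1 (e / (2 * (L * exp L)))"
  have "d > 0" using assms L_pos by (simp add: d_def)
  have d1: "d \<le> 1" by (simp add: d_def)
  have d2: "L * exp L * d \<le> e / 2" using L_pos by (simp add: d_def min_def field_simps)
  have d3: "2 * (L * d) \<le> e"
  proof -
    have "L * d * 1 \<le> L * d * exp L"
      using L_pos \<open>d > 0\<close> by (intro mult_left_mono) auto
    then show ?thesis using d2 by (simp add: mult_ac)
  qed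
  have "norm (flow g t x - flow g t' x' - ((x - x') + (t - t') *\<^sub>R g p)) \<le> e * (\<bar>t - t'\<bar> + norm (x - x'))"
    if t: "\<bar>t\<bar> \<le> d" "\<bar>t'\<bar> \<le> d" and x: "norm (x - p) \<le> d" "norm (x' - p) \<le> d" for t t' x x'
  proof -
    \<comment> \<open>The increment is split into a change of time at the base point
      \<open>x\<close> and a change of the base point at the time \<open>t'\<close>. In both parts
      the mean value inequality is applied in the time variable only.\<close>
    have 1: "norm (flow g t x - flow g t' x - (t - t') *\<^sub>R g p) \<le> e * \<bar>t - t'\<bar>"
    proof -
      have "norm ((flow g t x - t *\<^sub>R g p) - (flow g t' x - t' *\<^sub>R g p)) \<le> e * norm (t - t')"
      proof (rule differentiable_bound[of "{-d..d}"])
        show "((\<lambda>t. flow g t x - t *\<^sub>R g p) has_derivative (\<lambda>h. h *\<^sub>R (g (flow g s x) - g p))) (at s within {-d..d})" for s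
          using has_vector_derivative_diff[OF flow_has_vector_derivative[of x s] has_vector_derivative_affine[of "\<lambda>t. t *\<^sub>R g p" "g p" 1 s 0]]
            has_vector_derivative_scaleR[of "\<lambda>t. t" 1 s UNIV "\<lambda>_. g p" 0]
          by (simp add: has_vector_derivative_def has_derivative_at_withinI)
        show "onorm (\<lambda>h. h *\<^sub>R (g (flow g s x) - g p)) \<le> e" if "s \<in> {-d..d}" for s
        proof (rule onorm_bound)
          have "norm (flow g s x - p) \<le> norm (flow g s x - flow g 0 x) + norm (x - p)"
            using norm_triangle_ineq[of "flow g s x - x" "x - p"] by simp
          also have "\<dots> \<le> 2 * d"
            using flow_time_lipschitz[of s x 0] that x by auto
          finally have "norm (flow g s x - p) \<le> 2 * d" .
          then have "L * norm (flow g s x - p) \<le> L * (2 * d)"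
            using L_pos by simp
          then have le: "norm (g (flow g s x) - g p) \<le> e"
            using lip[of "flow g s x" p] d3 by linarith
          fix h :: real
          show "norm (h *\<^sub>R (g (flow g s x) - g p)) \<le> e * norm h"
            using mult_left_mono[OF le, of "\<bar>h\<bar>"] by (simp add: mult_ac)
        qed (use assms in simp)
      qed (use t in auto)
      then show ?thesis by (simp add: algebra_simps)
    qed
    have 2: "norm (flow g t' x - flow g t' x' - (x - x')) \<le> e * norm (x - x')"
    proof -
      have "norm ((flow g t' x - flow g t' x') - (flow g 0 x - flow g 0 x')) \<le> e * norm (x - x') * norm (t' - 0) / d"
      proof (rule differentiable_bound[of "{-d..d}" _ _ "e * norm (x - x') / d", simplified times_divide_eq_left])
        show "((\<lambda>t. flow g t x - flow g t x') has_derivative (\<lambda>h. h *\<^sub>R (g (flow g s x) - g (flow g s x')))) (at s within {-d..d})" for s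
          using has_vector_derivative_diff[OF flow_has_vector_derivative[of x s] flow_has_vector_derivative[of x' s]]
          by (auto simp: has_vector_derivative_def intro!: has_derivative_at_withinI)
        show "onorm (\<lambda>h. h *\<^sub>R (g (flow g s x) - g (flow g s x'))) \<le> e * norm (x - x') / d" if "s \<in> {-d..d}" for s
        proof (rule onorm_bound)
          have "norm (g (flow g s x) - g (flow g s x')) \<le> L * (exp (L * \<bar>s\<bar>) * norm (x - x'))"
            using lip[of "flow g s x" "flow g s x'"] flow_lipschitz[of s x x'] L_pos
            by (meson mult_left_mono less_imp_le order_trans)
          also have "\<dots> \<le> L * (exp L * norm (x - x'))"
            using that d1 L_pos by (intro mult_left_mono mult_right_mono) auto
          also have "\<dots> \<le> e * norm (x - x') / d"
          proof -
            have "L * exp L * d * norm (x - x') \<le> e * norm (x - x')"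
              using d2 assms by (intro mult_right_mono) auto
            then show ?thesis using \<open>d > 0\<close> by (simp add: field_simps)
          qed
          finally have le: "norm (g (flow g s x) - g (flow g s x')) \<le> e * norm (x - x') / d" .
          fix h :: real
          show "norm (h *\<^sub>R (g (flow g s x) - g (flow g s x'))) \<le> e * norm (x - x') / d * norm h"
            using mult_left_mono[OF le, of "\<bar>h\<bar>"] by (simp add: mult_ac)
        qed (use assms \<open>d > 0\<close> in simp)
      qed (use t \<open>d > 0\<close> in auto)
      also have "\<dots> \<le> e * norm (x - x') * d / d"
        using t assms \<open>d > 0\<close> by (intro divide_right_mono mult_left_mono) auto
      finally show ?thesis using \<open>d > 0\<close> by simp
    qed
    have "flow g t x - flow g t' x' - ((x - x') + (t - t') *\<^sub>R g p)
        = (flow g t x - flow g t' x - (t - t') *\<^sub>R g p) + (flow g t' x - flow g t' x' - (x - x'))"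
      by simp
    also have "norm \<dots> \<le> e * \<bar>t - t'\<bar> + e * norm (x - x')"
      using 1 2 norm_triangle_mono by blast
    finally show ?thesis by (simp add: algebra_simps)
  qed
  then show ?thesis using \<open>d > 0\<close> by blast
qed

end

section \<open>The torus\<close>

lemma vimage_image_torus_of: "torus_of -` torus_of ` S = (\<Union>v\<in>int_lattice. (+) v ` S)"
proof (intro equalityI subsetI)
  fix x assume "x \<in> torus_of -` torus_of ` S"
  then obtain y where y: "y \<in> S" "x - y \<in> int_lattice"
    by (auto simp: torus_of_eq_iff)
  then have "x = (x - y) + y" by simp
  with y show "x \<in> (\<Union>v\<in>int_lattice. (+) v ` S)" by blast
next
  fix x assume "x \<in> (\<Union>v\<in>int_lattice. (+) v ` S)"
  then show "x \<in> torus_of -` torus_of ` S"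
    by (auto simp: torus_of_eq_iff image_iff) (metis add_diff_cancel_right')
qed

lemma open_image_torus_of: "open S \<Longrightarrow> open (torus_of ` S)"
  unfolding open_torus_iff_open_vimage vimage_image_torus_of
  by (intro open_UN ballI open_translation)

text \<open>This makes \<open>borel_prod\<close> available: Borel sets of products with the torus,
  such as closed sets of pairs (point, time), belong to the product sigma-algebra.\<close>

instance torus :: (finite) second_countable_topology
proof
  obtain B :: "(real ^ 'a) set set" where B: "countable B" "topological_basis B"
    using ex_countable_basis by blast
  have "topological_basis ((`) torus_of ` B)"
  proof (rule topological_basisI)
    show "open U" if "U \<in> (`) torus_of ` B" for U :: "'a torus set"
      using that B(2) by (auto intro: open_image_torus_of topological_basis_open)
    fix O' :: "'a torus set" and X assume O': "open O'" "X \<in> O'"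
    obtain x where x: "X = torus_of x" using surj_torus_of by blast
    have "open (torus_of -` O')" "x \<in> torus_of -` O'"
      using O' by (simp_all add: x open_torus_iff_open_vimage)
    then obtain U where "U \<in> B" "x \<in> U" "U \<subseteq> torus_of -` O'"
      using B(2) topological_basisE by metis
    then show "\<exists>B'\<in>(`) torus_of ` B. X \<in> B' \<and> B' \<subseteq> O'"
      by (intro bexI[of _ "torus_of ` U"]) (auto simp: x)
  qed
  then show "\<exists>B :: 'a torus set set. countable B \<and> open = generate_topology B"
    using B(1) topological_basis_imp_subbasis by blast
qed

lemma countable_int_lattice: "countable (int_lattice :: (real ^ 'n) set)"
proof -
  have "int_lattice \<subseteq> range (\<lambda>z. (\<chi> i. real_of_int (z i)) :: real ^ 'n)"
  proof
    fix v :: "real ^ 'n" assume "v \<in> int_lattice"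
    then have "v = (\<chi> i. real_of_int \<lfloor>v $ i\<rfloor>)"
      by (simp add: int_lattice_def vec_eq_iff)
    then show "v \<in> range (\<lambda>z. (\<chi> i. real_of_int (z i)))"
      by (rule range_eqI[where x = "\<lambda>i. \<lfloor>v $ i\<rfloor>"])
  qed
  moreover have "countable (range (\<lambda>z :: 'n \<Rightarrow> int. (\<chi> i. real_of_int (z i)) :: real ^ 'n))"
    by auto
  ultimately show ?thesis by (rule countable_subset)
qed

lemma exists_unit_cube: "\<exists>y\<in>unit_cube. torus_of y = torus_of x"
proof -
  define y where "y = (\<chi> i. frac (x $ i))"
  have "y \<in> unit_cube" by (simp add: y_def unit_cube_def frac_lt_1)
  moreover have "y - x \<in> int_lattice" by (simp add: y_def int_lattice_def frac_def)
  ultimately show ?thesis by (auto simp: torus_of_eq_iff)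
qed

lemma exists_cbox: "\<exists>y\<in>cbox 0 1. torus_of y = torus_of (x :: real ^ 'n)"
  using exists_unit_cube[of x] by (auto simp: unit_cube_def mem_box_cart less_imp_le intro!: bexI)

lemma dist_torus_attained:
  obtains x y where "X = torus_of x" "Y = torus_of y" "dist X Y = norm (x - y)"
proof -
  obtain x y where XY: "X = torus_of x" "Y = torus_of y"
    using surj_torus_of by metis
  obtain u where u: "u \<in> int_lattice" "infdist (x - y) int_lattice = dist (x - y) u"
    using infdist_attains_inf[OF closed_int_lattice] int_lattice_zero by blast
  show thesis
  proof (rule that)
    show "Y = torus_of (y + u)" using u by (simp add: XY torus_of_add_lattice)
    show "dist X Y = norm (x - (y + u))"
      by (simp add: XY dist_torus_of_infdist u dist_norm algebra_simps)
  qed (rule XY)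
qed

text \<open>The preimage in the covering space is a union of countably many lattice translates of
  its part in \<open>unit_cube\<close>. Null sets can therefore be handled in the covering space,
  where flows and the automorphism have lifts.\<close>

lemma null_torus_measure_iff:
  assumes "S \<in> sets borel"
  shows "emeasure torus_measure S = 0 \<longleftrightarrow> emeasure lborel (torus_of -` S) = 0"
proof -
  have meas [measurable]: "torus_of -` S \<in> sets borel"
    using measurable_sets[OF borel_measurable_torus_of assms] by simp
  have eq: "emeasure torus_measure S = emeasure lborel (unit_cube \<inter> torus_of -` S)"
    using assms unfolding torus_measure_def
    by (subst emeasure_distr)
      (auto simp: measurable_restrict_space1 emeasure_restrict_space space_restrict_space Int_commute)
  show ?thesis
  proof
    assume "emeasure torus_measure S = 0"
    then have null: "unit_cube \<inter> torus_of -` S \<in> null_sets lborel"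
      by (auto simp: eq null_sets_def)
    have "torus_of -` S \<subseteq> (\<Union>v\<in>int_lattice. (+) v ` (unit_cube \<inter> torus_of -` S))"
    proof
      fix x assume x: "x \<in> torus_of -` S"
      obtain y where y: "y \<in> unit_cube" "torus_of x = torus_of y" using exists_unit_cube[of x] by metis
      then have "y \<in> unit_cube \<inter> torus_of -` S"
        using x by simp
      moreover have "x - y \<in> int_lattice" "x = (x - y) + y"
        using y(2) by (simp_all add: torus_of_eq_iff)
      ultimately show "x \<in> (\<Union>v\<in>int_lattice. (+) v ` (unit_cube \<inter> torus_of -` S))" by blast
    qed
    moreover have "(\<Union>v\<in>int_lattice. (+) v ` (unit_cube \<inter> torus_of -` S)) \<in> null_sets lborel"
    proof (rule null_sets_UN'[OF countable_int_lattice])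
      fix v :: "real ^ 'a"
      show "(+) v ` (unit_cube \<inter> torus_of -` S) \<in> null_sets lborel"
        using null_sets_translation[OF null, of v]
        by (rule back_subst[of "\<lambda>S. S \<in> null_sets lborel"])
          (auto simp: image_iff intro!: image_eqI[of _ _ "_ - v"])
    qed
    ultimately have "torus_of -` S \<in> null_sets lborel"
      by (rule null_sets_subset[rotated 2]) simp
    then show "emeasure lborel (torus_of -` S) = 0" by (simp add: null_setsD1)
  next
    assume "emeasure lborel (torus_of -` S) = 0"
    moreover have "emeasure lborel (unit_cube \<inter> torus_of -` S) \<le> emeasure lborel (torus_of -` S)"
      by (intro emeasure_mono) auto
    ultimately show "emeasure torus_measure S = 0" by (simp add: eq)
  qed
qed

section \<open>Unit fields on the torus and their arcs\<close>

locale unit_field =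
  fixes V :: "'n::finite vector_field" and L :: real
  assumes unit: "\<And>x. norm (V x) = 1"
    and lipschitz: "lipschitz_field (lift_field V) L"

sublocale unit_field \<subseteq> lipschitz_field "lift_field V" L
  by (rule lipschitz)

text \<open>The derivative is continuous and periodic, hence bounded, and the mean value inequality
  applies. The maximum with 1 makes the constant positive.\<close>

lemma C2_field_lipschitz:
  fixes V :: "'n::finite vector_field"
  assumes "V \<in> C2_fields" "\<And>x. norm (V x) = 1"
  shows "\<exists>L. unit_field V L"
proof -
  obtain B where B: "\<And>x. norm (blinfun_derivative (lift_field V) x) \<le> B"
    using bounded_C2_field(2)[OF assms(1)] by (auto simp: bounded_iff)
  define L where "L = max B 1"
  have "norm (lift_field V x - lift_field V y) \<le> L * norm (x - y)" for x y
  proof (rule differentiable_bound[of UNIV])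
    fix x :: "real ^ 'n"
    have "lift_field V differentiable at x"
      using assms(1) by (simp add: C2_fields_def C2_map_def)
    then show "(lift_field V has_derivative blinfun_derivative (lift_field V) x) (at x within UNIV)"
      using frechet_derivative_works has_derivative_bounded_linear
      by (metis blinfun_derivative_def bounded_linear_Blinfun_apply)
    show "onorm (blinfun_derivative (lift_field V) x) \<le> L"
      using B[of x] by (simp add: norm_blinfun.rep_eq L_def)
  qed auto
  then have "unit_field V L"
    using assms(2) by unfold_locales (auto simp: L_def lift_field_def)
  then show ?thesis ..
qed

definition torus_flow :: "'n::finite vector_field \<Rightarrow> real \<Rightarrow> 'n torus \<Rightarrow> 'n torus"
  where "torus_flow V t X = integral_curve_through V X t"

context unit_field
begin

abbreviation "\<Phi> \<equiv> flow (lift_field V)"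

lemma flow_add_lattice:
  assumes "v \<in> int_lattice"
  shows "\<Phi> t (x + v) = \<Phi> t x + v"
proof (rule flow_unique[of _ "\<lambda>t. \<Phi> t x + v", symmetric])
  have "((\<lambda>t. \<Phi> t x + v) has_vector_derivative lift_field V (\<Phi> t x)) (at t)" for t
    using flow_has_vector_derivative[of x t] by (auto intro!: derivative_eq_intros)
  then show "solution (lift_field V) (x + v) (\<lambda>t. \<Phi> t x + v)"
    using assms by (simp add: solution_def lift_field_def torus_of_add_lattice)
qed

lemma torus_flow_torus_of: "torus_flow V t (torus_of x) = torus_of (\<Phi> t x)"
proof -
  have "integral_curve_through V (torus_of x) = (\<lambda>t. torus_of (\<Phi> t x))"
    unfolding integral_curve_through_def
  proof (rule the_equality)
    show "integral_curve V (\<lambda>t. torus_of (\<Phi> t x)) \<and> torus_of (\<Phi> 0 x) = torus_of x"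
      using flow_has_vector_derivative[of x] by (auto simp: integral_curve_def lift_field_def)
  next
    fix \<gamma> assume \<gamma>: "integral_curve V \<gamma> \<and> \<gamma> 0 = torus_of x"
    then obtain \<Gamma> where \<Gamma>: "\<And>t. \<gamma> t = torus_of (\<Gamma> t)" "\<And>t. (\<Gamma> has_vector_derivative V (\<gamma> t)) (at t)"
      unfolding integral_curve_def by blast
    have v: "\<Gamma> 0 - x \<in> int_lattice"
      using \<gamma> \<Gamma>(1)[of 0] by (simp add: torus_of_eq_iff)
    have "solution (lift_field V) (x + (\<Gamma> 0 - x)) \<Gamma>"
      using \<Gamma> by (simp add: solution_def lift_field_def)
    from flow_unique[OF this] have "\<Gamma> t = \<Phi> t x + (\<Gamma> 0 - x)" for t
      unfolding flow_add_lattice[OF v] by this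
    then have "\<gamma> t = torus_of (\<Phi> t x)" for t
      using \<Gamma>(1)[of t] torus_of_add_lattice[OF v, of "\<Phi> t x"] by metis
    then show "\<gamma> = (\<lambda>t. torus_of (\<Phi> t x))" by blast
  qed
  then show ?thesis by (simp add: torus_flow_def)
qed

lemma torus_flow_0 [simp]: "torus_flow V 0 X = X"
  using surj_torus_of[of X] by (auto simp: torus_flow_torus_of)

lemma torus_flow_add: "torus_flow V (s + t) X = torus_flow V s (torus_flow V t X)"
  using surj_torus_of[of X] by (auto simp: torus_flow_torus_of flow_add)

lemma dist_torus_flow_time: "dist (torus_flow V t X) (torus_flow V s X) \<le> \<bar>t - s\<bar>"
proof -
  obtain x where "X = torus_of x" using surj_torus_of by blast
  then show ?thesis
    using dist_torus_of_le[of "\<Phi> t x" "\<Phi> s x"] flow_time_lipschitz[of t x s]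
    by (simp add: torus_flow_torus_of dist_norm)
qed

lemma dist_torus_flow: "dist (torus_flow V t X) (torus_flow V t Y) \<le> exp (L * \<bar>t\<bar>) * dist X Y"
proof -
  obtain x y where xy: "X = torus_of x" "Y = torus_of y" "dist X Y = norm (x - y)"
    using dist_torus_attained[of X Y] by blast
  have "dist (torus_flow V t X) (torus_flow V t Y) \<le> dist (\<Phi> t x) (\<Phi> t y)"
    unfolding xy torus_flow_torus_of by (rule dist_torus_of_le)
  also have "\<dots> \<le> exp (L * \<bar>t\<bar>) * dist X Y"
    unfolding xy(3) dist_norm by (rule flow_lipschitz)
  finally show ?thesis .
qed

lemma continuous_on_torus_flow: "continuous_on UNIV (\<lambda>(t, X). torus_flow V t X)"
  unfolding continuous_on_sequentially
proof (clarsimp simp: o_def case_prod_unfold)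
  fix u :: "nat \<Rightarrow> real \<times> 'n torus" and t X assume u: "u \<longlonglongrightarrow> (t, X)"
  have t: "(\<lambda>n. fst (u n)) \<longlonglongrightarrow> t" and X: "(\<lambda>n. snd (u n)) \<longlonglongrightarrow> X"
    using tendsto_fst[OF u] tendsto_snd[OF u] by simp_all
  have "(\<lambda>n. exp (L * \<bar>fst (u n)\<bar>) * dist (snd (u n)) X + \<bar>fst (u n) - t\<bar>) \<longlonglongrightarrow> exp (L * \<bar>t\<bar>) * dist X X + \<bar>t - t\<bar>"
    by (intro tendsto_intros t X)
  then have lim: "(\<lambda>n. exp (L * \<bar>fst (u n)\<bar>) * dist (snd (u n)) X + \<bar>fst (u n) - t\<bar>) \<longlonglongrightarrow> 0"
    by simp
  have le: "dist (torus_flow V (fst (u n)) (snd (u n))) (torus_flow V t X)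
      \<le> exp (L * \<bar>fst (u n)\<bar>) * dist (snd (u n)) X + \<bar>fst (u n) - t\<bar>" for n
    using dist_triangle[of "torus_flow V (fst (u n)) (snd (u n))" "torus_flow V t X" "torus_flow V (fst (u n)) X"]
      dist_torus_flow[of "fst (u n)" "snd (u n)" X] dist_torus_flow_time[of "fst (u n)" X t]
    by linarith
  have "(\<lambda>n. dist (torus_flow V (fst (u n)) (snd (u n))) (torus_flow V t X)) \<longlonglongrightarrow> 0"
    by (rule tendsto_sandwich[OF _ _ tendsto_const lim]) (simp, intro always_eventually allI le)
  then show "(\<lambda>n. torus_flow V (fst (u n)) (snd (u n))) \<longlonglongrightarrow> torus_flow V t X"
    by (subst tendsto_dist_iff)
qed

lemma continuous_on_torus_flow' [continuous_intros]:
  assumes "continuous_on S a" "continuous_on S b"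
  shows "continuous_on S (\<lambda>z. torus_flow V (a z) (b z))"
  using continuous_on_compose2[OF continuous_on_torus_flow continuous_on_Pair[OF assms]] by simp

text \<open>On a closed orbit the lift moves by a lattice vector. In time below 1 this vector is
  shorter than 1, hence 0; but by \<open>flow_near_line\<close> the displacement differs from a
  vector of length |t| by at most L t^2 < |t|.\<close>

lemma torus_flow_neq:
  assumes "t \<noteq> 0" "\<bar>t\<bar> < 1" "\<bar>t\<bar> < 1 / L"
  shows "torus_flow V t X \<noteq> X"
proof
  assume eq: "torus_flow V t X = X"
  obtain x where x: "X = torus_of x" using surj_torus_of by blast
  have "\<Phi> t x - x \<in> int_lattice"
    using eq by (simp add: x torus_flow_torus_of torus_of_eq_iff)
  have lt: "norm (\<Phi> t x - x) < 1"
    using flow_time_lipschitz[of t x 0] assms by simp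
  have "(\<Phi> t x - x) $ i = 0" for i
  proof -
    have "(\<Phi> t x - x) $ i \<in> \<int>"
      using \<open>\<Phi> t x - x \<in> int_lattice\<close> by (simp only: int_lattice_def mem_Collect_eq)
    moreover have "\<bar>(\<Phi> t x - x) $ i\<bar> < 1"
      using component_le_norm_cart[of "\<Phi> t x - x" i] lt by linarith
    ultimately show ?thesis using Ints_nonzero_abs_less1 by blast
  qed
  then have "\<Phi> t x - x = 0" by (simp add: vec_eq_iff)
  then have "norm (t *\<^sub>R lift_field V x) \<le> L * t\<^sup>2"
    using flow_near_line[of t x] by (simp add: norm_minus_commute)
  then have "\<bar>t\<bar> \<le> L * \<bar>t\<bar> * \<bar>t\<bar>"
    by (simp add: lift_field_def unit power2_eq_square abs_mult_self_eq mult.assoc)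
  moreover have "L * \<bar>t\<bar> * \<bar>t\<bar> < 1 * \<bar>t\<bar>"
    using assms L_pos by (intro mult_strict_right_mono) (auto simp: field_simps)
  ultimately show False by simp
qed

lemma torus_flow_inj:
  assumes "\<bar>t - s\<bar> < 1" "\<bar>t - s\<bar> < 1 / L" "torus_flow V t X = torus_flow V s X"
  shows "t = s"
proof (rule ccontr)
  assume "t \<noteq> s"
  moreover have "torus_flow V (t - s) (torus_flow V s X) = torus_flow V s X"
    using assms(3) torus_flow_add[of "t - s" s X] by simp
  ultimately show False
    using torus_flow_neq[of "t - s"] assms by auto
qed

end

text \<open>Projection along a compact factor is a closed map. It serves to remove an existential
  quantifier over times in a bounded interval.\<close>

lemma closed_projection_compact:
  fixes S :: "'a::topological_space set" and T :: "('a \<times> 'b::topological_space) set"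
  assumes "compact S" "closed T"
  shows "closed {y. \<exists>x. x \<in> S \<and> (x, y) \<in> T}"
proof -
  have top: "prod_topology (top_of_set S) euclidean = top_of_set (S \<times> (UNIV :: 'b set))"
    using prod_topology_subtopology_eu[of S "UNIV :: 'b set"] by simp
  have "closed_map (top_of_set (S \<times> (UNIV :: 'b set))) euclidean snd"
    using closed_map_snd[of "top_of_set S" "euclidean :: 'b topology"] assms(1)
    by (simp add: top compact_space_subtopology)
  moreover have "closedin (top_of_set (S \<times> (UNIV :: 'b set))) ((S \<times> UNIV) \<inter> T)"
    using assms(2) by (rule closedin_closed_Int)
  ultimately have "closed (snd ` ((S \<times> UNIV) \<inter> T))"
    unfolding closed_map_def by (metis closed_closedin)
  moreover have "snd ` ((S \<times> UNIV) \<inter> T) = {y. \<exists>x. x \<in> S \<and> (x, y) \<in> T}"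
    by force
  ultimately show ?thesis by simp
qed

context unit_field
begin

text \<open>Connected sets of reals are intervals, so \<open>t\<close> lies in the component of 0
  iff the whole segment up to \<open>t\<close> stays in the set. Scaling the segment to [0, 1] turns
  membership into an intersection of closed conditions on the pair (X, t).\<close>

lemma mem_arc_domain_iff:
  assumes "e \<ge> 0"
  shows "t \<in> arc_domain V e X \<longleftrightarrow> (\<forall>r\<in>{0..1}. dist (torus_flow V (r * t) X) X \<le> e)"
proof -
  define S where "S = {t. dist (torus_flow V t X) X \<le> e}"
  have "t \<in> arc_domain V e X \<longleftrightarrow> connected_component S 0 t"
    by (simp add: arc_domain_def S_def torus_flow_def)
  also have "\<dots> \<longleftrightarrow> closed_segment 0 t \<subseteq> S"
  proof
    assume "connected_component S 0 t"
    then obtain T where T: "connected T" "T \<subseteq> S" "0 \<in> T" "t \<in> T"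
      by (auto simp: connected_component_def)
    then show "closed_segment 0 t \<subseteq> S"
      using connected_contains_Icc[OF T(1)] by (auto simp: closed_segment_eq_real_ivl split: if_splits)
  next
    assume "closed_segment 0 t \<subseteq> S"
    then show "connected_component S 0 t"
      unfolding connected_component_def using convex_connected[OF convex_closed_segment] by blast
  qed
  also have "closed_segment 0 t = (\<lambda>r. r * t) ` {0..1}"
    by (auto simp: closed_segment_def image_iff)
  also have "\<dots> \<subseteq> S \<longleftrightarrow> (\<forall>r\<in>{0..1}. dist (torus_flow V (r * t) X) X \<le> e)"
    by (auto simp: S_def)
  finally show ?thesis .
qed

lemma closed_arc_domain:
  assumes "e \<ge> 0"
  shows "closed {(X, t). t \<in> arc_domain V e X}"
proof -
  have "{(X, t). t \<in> arc_domain V e X} = (\<Inter>r\<in>{0..1}. {(X, t). dist (torus_flow V (r * t) X) X \<le> e})"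
    by (auto simp: mem_arc_domain_iff[OF assms])
  moreover have "closed {(X, t). dist (torus_flow V (r * t) X) X \<le> e}" for r
    unfolding case_prod_unfold by (intro closed_Collect_le continuous_intros)
  ultimately show ?thesis by (simp add: closed_INT)
qed

text \<open>A parameter \<open>t\<close> is discarded iff some \<open>s\<close> of smaller absolute
  value gives the same point. A rational \<open>q\<close> with |s| < q < |t| separates the two; for
  fixed \<open>q\<close> the times \<open>s\<close> range over a compact interval, so the set
  \<open>R q\<close> of pairs having such an \<open>s\<close> is closed. Only countably many
  \<open>q\<close> occur.\<close>

lemma borel_arc_parameters:
  assumes "e \<ge> 0"
  shows "{(X, t). t \<in> arc_parameters V e X} \<in> sets (borel \<Otimes>\<^sub>M borel)"
proof -
  define D where "D = {(X, t). t \<in> arc_domain V e X}"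
  define R where "R q = {z. \<exists>s. s \<in> {-q..q} \<and> (s, z) \<in> {(s, X, t). (X, s) \<in> D \<and> torus_flow V s X = torus_flow V t X}}" for q
  have D: "closed D" unfolding D_def by (rule closed_arc_domain[OF assms])
  have R: "closed (R q)" for q
  proof -
    have "{(s, X, t). (X, s) \<in> D \<and> torus_flow V s X = torus_flow V t X} =
       (\<lambda>(s, X, t). (X, s)) -` D \<inter> {(s, X, t). torus_flow V s X = torus_flow V t X}"
      by auto
    moreover have "closed ((\<lambda>(s, X, t). (X, s)) -` D)"
      unfolding case_prod_unfold by (intro closed_vimage D continuous_intros)
    moreover have "closed {(s, X, t). torus_flow V s X = torus_flow V t X}"
      unfolding case_prod_unfold by (intro closed_Collect_eq continuous_intros)
    ultimately have cl: "closed {(s, X, t). (X, s) \<in> D \<and> torus_flow V s X = torus_flow V t X}"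
      by auto
    show ?thesis
      unfolding R_def
    by (rule closed_projection_compact[OF compact_Icc cl])
  qed
  have "{(X, t). t \<in> arc_parameters V e X} = D - (\<Union>q\<in>\<rat>. R q \<inter> {(X, t). q < \<bar>t\<bar>})"
  proof (intro set_eqI, clarsimp simp: D_def, intro iffI)
    fix X t assume t: "t \<in> arc_parameters V e X"
    then show "t \<in> arc_domain V e X \<and> (\<forall>q\<in>\<rat>. (X, t) \<in> R q \<longrightarrow> \<not> q < \<bar>t\<bar>)"
      by (force simp: arc_parameters_def R_def D_def torus_flow_def)
  next
    fix X t assume t: "t \<in> arc_domain V e X \<and> (\<forall>q\<in>\<rat>. (X, t) \<in> R q \<longrightarrow> \<not> q < \<bar>t\<bar>)"
    have "\<bar>t\<bar> \<le> \<bar>s\<bar>" if s: "s \<in> arc_domain V e X" "torus_flow V s X = torus_flow V t X" for s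
    proof (rule ccontr)
      assume "\<not> \<bar>t\<bar> \<le> \<bar>s\<bar>"
      then obtain q where "q \<in> \<rat>" "\<bar>s\<bar> < q" "q < \<bar>t\<bar>"
        using Rats_dense_in_real[of "\<bar>s\<bar>" "\<bar>t\<bar>"] by auto
      moreover have "(X, t) \<in> R q"
        using s \<open>\<bar>s\<bar> < q\<close> by (auto simp: R_def D_def intro!: exI[of _ s])
      ultimately show False using t by blast
    qed
    then show "t \<in> arc_parameters V e X"
      using t by (simp add: arc_parameters_def torus_flow_def)
  qed
  moreover have "R q \<inter> {(X, t). q < \<bar>t\<bar>} \<in> sets borel" for q
    unfolding case_prod_unfold
    by (intro sets.Int borel_closed R borel_open open_Collect_less continuous_intros)
  then have "(\<Union>q\<in>\<rat>. R q \<inter> {(X, t). q < \<bar>t\<bar>}) \<in> sets borel"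
    by (intro sets.countable_UN'[OF countable_rat]) auto
  ultimately show ?thesis
    unfolding borel_prod using borel_closed[OF D] by simp
qed

lemma arc_parameters_measurable: "e \<ge> 0 \<Longrightarrow> arc_parameters V e X \<in> sets borel"
  using sets_Pair1[OF borel_arc_parameters, of e X] by (simp add: vimage_def)

lemma torus_flow_measurable1: "(\<lambda>t. torus_flow V t X) \<in> borel_measurable borel"
  by (intro borel_measurable_continuous_onI continuous_intros)

lemma emeasure_arc_kernel:
  assumes "e \<ge> 0" "S \<in> sets borel"
  shows "emeasure (arc_kernel V e X) S =
    emeasure lborel {t \<in> arc_parameters V e X. torus_flow V t X \<in> S} / emeasure lborel (arc_parameters V e X)"
proof -
  have curve: "integral_curve_through V X = (\<lambda>t. torus_flow V t X)"
    by (simp add: torus_flow_def fun_eq_iff)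
  have [measurable]: "(\<lambda>t. torus_flow V t X) \<in> borel_measurable borel"
    by (rule torus_flow_measurable1)
  have "emeasure (arc_kernel V e X) S = emeasure (uniform_measure lborel (arc_parameters V e X)) ((\<lambda>t. torus_flow V t X) -` S)"
    unfolding arc_kernel_def curve using assms
    by (subst emeasure_distr) (auto simp: measurable_def intro: measurable_sets_borel[OF torus_flow_measurable1])
  also have "\<dots> = emeasure lborel (arc_parameters V e X \<inter> (\<lambda>t. torus_flow V t X) -` S) / emeasure lborel (arc_parameters V e X)"
    using assms arc_parameters_measurable measurable_sets_borel[OF torus_flow_measurable1]
    by (intro emeasure_uniform_measure) auto
  also have "arc_parameters V e X \<inter> (\<lambda>t. torus_flow V t X) -` S = {t \<in> arc_parameters V e X. torus_flow V t X \<in> S}"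
    by auto
  finally show ?thesis .
qed

lemma arc_kernel_measurable:
  assumes "e \<ge> 0"
  shows "arc_kernel V e \<in> measurable borel (subprob_algebra borel)"
proof (rule measurable_subprob_algebra)
  fix X
  show "sets (arc_kernel V e X) = sets borel"
    by (simp add: arc_kernel_def)
  have sp: "space (arc_kernel V e X) = UNIV"
    by (simp add: arc_kernel_def)
  \<comment> \<open>If the length is 0 or infinite, the quotient is 0 by the conventions of
    \<open>ennreal\<close>; hence a subprobability measure and not always a probability
    measure.\<close>
  have "emeasure (arc_kernel V e X) UNIV \<le> 1"
    using emeasure_arc_kernel[OF assms, of UNIV X]
    by (cases "emeasure lborel (arc_parameters V e X) = 0 \<or> emeasure lborel (arc_parameters V e X) = top")
      (auto simp: less_top)
  then show "subprob_space (arc_kernel V e X)"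
    by (intro subprob_spaceI) (auto simp: sp)
next
  fix S :: "'n torus set" assume S [measurable]: "S \<in> sets borel"
  have 1: "(\<lambda>X. emeasure lborel (Pair X -` Q)) \<in> borel_measurable borel"
    if "Q \<in> sets (borel \<Otimes>\<^sub>M borel)" for Q :: "('n torus \<times> real) set"
    using lborel.measurable_emeasure_Pair[of Q borel] that by (simp add: sets_pair_measure_cong[OF refl sets_lborel])
  have "(\<lambda>(X, t). torus_flow V t X) \<in> borel_measurable borel"
    unfolding case_prod_unfold by (intro borel_measurable_continuous_onI continuous_intros)
  then have "(\<lambda>(X, t). torus_flow V t X) -` S \<in> sets (borel \<Otimes>\<^sub>M borel)"
    using measurable_sets_borel[OF _ S] unfolding borel_prod by blast
  then have "{(X, t). t \<in> arc_parameters V e X} \<inter> (\<lambda>(X, t). torus_flow V t X) -` S \<in> sets (borel \<Otimes>\<^sub>M borel)"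
    by (intro sets.Int borel_arc_parameters assms)
  from 1[OF this] have "(\<lambda>X. emeasure lborel {t \<in> arc_parameters V e X. torus_flow V t X \<in> S}) \<in> borel_measurable borel"
    by (simp add: vimage_def Int_def)
  moreover from 1[OF borel_arc_parameters[OF assms]]
  have "(\<lambda>X. emeasure lborel (arc_parameters V e X)) \<in> borel_measurable borel"
    by (simp add: vimage_def)
  ultimately show "(\<lambda>X. emeasure (arc_kernel V e X) S) \<in> borel_measurable borel"
    unfolding emeasure_arc_kernel[OF assms S] by (rule borel_measurable_divide_ennreal)
qed

text \<open>At unit speed the curve stays within distance \<open>e\<close> up to time
  \<open>d\<close>, and it is injective on times differing by less than 2d. So all times near 0 are
  used by the kernel, with a bound uniform in \<open>X\<close>.\<close>

lemma interval_subset_arc_parameters: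
  assumes "0 < d" "d \<le> e" "d \<le> 1/2" "d \<le> 1 / (2 * L)"
  shows "{-d<..<d} \<subseteq> arc_parameters V e X"
proof
  fix t assume t: "t \<in> {-d<..<d}"
  have "t \<in> arc_domain V e X"
  proof (subst mem_arc_domain_iff, use assms in simp, intro ballI)
    fix r :: real assume "r \<in> {0..1}"
    then have "\<bar>r * t\<bar> \<le> 1 * \<bar>t\<bar>"
      unfolding abs_mult by (intro mult_right_mono) auto
    then show "dist (torus_flow V (r * t) X) X \<le> e"
      using dist_torus_flow_time[of "r * t" X 0] t assms by auto
  qed
  moreover have "\<bar>t\<bar> \<le> \<bar>s\<bar>" if "torus_flow V s X = torus_flow V t X" for s
  proof (rule ccontr)
    assume "\<not> \<bar>t\<bar> \<le> \<bar>s\<bar>"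
    then have "\<bar>t - s\<bar> < 2 * d" using t by auto
    moreover have "2 * d \<le> 1 / L" using assms(4) L_pos by (simp add: field_simps)
    ultimately have "t = s"
      using assms that by (intro torus_flow_inj[of t s X]) auto
    then show False using \<open>\<not> \<bar>t\<bar> \<le> \<bar>s\<bar>\<close> by simp
  qed
  ultimately show "t \<in> arc_parameters V e X"
    by (simp add: arc_parameters_def torus_flow_def)
qed

text \<open>The value 1 forces the arc to have finite length, since otherwise the kernel is the null
  measure. The parameters that miss \<open>S\<close> then form a Lebesgue null set.\<close>

lemma AE_flow_of_arc_kernel:
  assumes "0 < d" "d \<le> e" "d \<le> 1/2" "d \<le> 1 / (2 * L)"
    and S: "S \<in> sets borel" and one: "emeasure (arc_kernel V e X) S = 1"
  shows "AE t in lborel. t \<in> {-d<..<d} \<longrightarrow> torus_flow V t X \<in> S"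
proof -
  have e: "e \<ge> 0" using assms by simp
  define J where "J = arc_parameters V e X"
  define J' where "J' = {t \<in> J. torus_flow V t X \<in> S}"
  have J: "J \<in> sets lborel" using arc_parameters_measurable[OF e] by (simp add: J_def)
  have "J' = J \<inter> (\<lambda>t. torus_flow V t X) -` S" by (auto simp: J'_def)
  then have J': "J' \<in> sets lborel" using J measurable_sets_borel[OF torus_flow_measurable1 S] by simp
  have q: "emeasure lborel J' / emeasure lborel J = 1"
    using one emeasure_arc_kernel[OF e S] by (simp add: J_def J'_def)
  then have fin: "emeasure lborel J \<noteq> \<infinity>" and "emeasure lborel J' = emeasure lborel J"
    by (auto simp: divide_eq_1_ennreal)
  have "emeasure lborel (J - J') = 0"
    using J J' fin \<open>emeasure lborel J' = emeasure lborel J\<close>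
    by (subst emeasure_Diff) (auto simp: J'_def)
  then have "J - J' \<in> null_sets lborel" using J J' by (simp add: null_setsI)
  then have "AE t in lborel. t \<notin> J - J'" by (rule AE_not_in)
  then show ?thesis
    by (rule eventually_mono) (use interval_subset_arc_parameters[OF assms(1-4), of X] in \<open>auto simp: J'_def J_def\<close>)
qed

text \<open>The preimage is the image under the flow at time -t, which is Lipschitz and thus
  preserves null sets.\<close>

lemma null_vimage_flow:
  assumes "S \<in> null_sets lborel" "S \<in> sets borel"
  shows "\<Phi> t -` S \<in> null_sets lborel"
proof -
  have "negligible S" using assms(1) by (simp add: negligible_iff_null_sets null_sets_completionI)
  then have "negligible (\<Phi> (- t) ` S)"
  proof (rule negligible_locally_Lipschitz_image[rotated])
    show "\<exists>T B. open T \<and> x \<in> T \<and> (\<forall>y\<in>S \<inter> T. norm (\<Phi> (- t) y - \<Phi> (- t) x) \<le> B * norm (y - x))" for x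
      using flow_lipschitz[of "- t"] by (intro exI[of _ UNIV] exI[of _ "exp (L * \<bar>t\<bar>)"]) auto
  qed simp
  moreover have "\<Phi> t -` S \<subseteq> \<Phi> (- t) ` S"
    using flow_uminus[of "- t"] by (auto simp: image_iff) (metis)
  ultimately have "negligible (\<Phi> t -` S)" by (rule negligible_subset)
  moreover have "\<Phi> t -` S \<in> sets borel"
  proof (rule measurable_sets_borel[OF _ assms(2)])
    have "continuous_on UNIV (\<lambda>x. \<Phi> (fst (t, x)) (snd (t, x)))"
      using continuous_on_compose2[OF continuous_on_flow, of UNIV "\<lambda>x. (t, x)"]
        continuous_on_Pair[OF continuous_on_const continuous_on_id] by auto
    then show "\<Phi> t \<in> borel_measurable borel" by (simp add: borel_measurable_continuous_onI)
  qed
  ultimately show ?thesis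
    by (simp add: negligible_iff_null_sets null_sets_completion_iff)
qed

text \<open>Fubini: for each time almost every starting point avoids the null set, so almost every
  starting point avoids it at almost all times. This is what lets mass enter a null set only from a
  null set, and so keeps the singular part invariant.\<close>

lemma null_arc_kernel:
  assumes "e \<ge> 0" and S: "S \<in> sets borel" "emeasure torus_measure S = 0"
  shows "emeasure torus_measure {X. emeasure (arc_kernel V e X) S > 0} = 0"
proof -
  define T where "T = torus_of -` S"
  have T [measurable]: "T \<in> sets borel" unfolding T_def by (rule measurable_sets_borel[OF borel_measurable_torus_of S(1)])
  have "T \<in> null_sets lborel"
    using S null_torus_measure_iff[OF S(1)] by (auto simp: T_def[symmetric] null_sets_def)
  define Q where "Q = {(t, x). \<Phi> t x \<in> T}"
  have "Q = (\<lambda>(t, x). \<Phi> t x) -` T" by (auto simp: Q_def)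
  then have Q: "Q \<in> sets (borel :: (real \<times> (real ^ 'n)) measure)"
    using measurable_sets_borel[OF borel_measurable_continuous_onI[OF continuous_on_flow] T] by simp
  have "AE x in lborel. \<Phi> t x \<notin> T" for t
    using AE_not_in[OF null_vimage_flow[OF \<open>T \<in> null_sets lborel\<close> T]] by simp
  then have "AE t in lborel. AE x in lborel. \<Phi> t x \<notin> T"
    by (rule AE_I2)
  moreover have pred: "Measurable.pred (lborel \<Otimes>\<^sub>M lborel) (\<lambda>(t, x). \<Phi> t x \<notin> T)"
  proof -
    have "{z \<in> space (lborel \<Otimes>\<^sub>M lborel). (case z of (t, x) \<Rightarrow> \<Phi> t x \<notin> T)} = UNIV - Q"
      by (auto simp: Q_def space_pair_measure)
    moreover have "UNIV - Q \<in> sets (borel \<Otimes>\<^sub>M borel)"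
      using sets.compl_sets[OF Q] unfolding borel_prod by simp
    ultimately show ?thesis
      unfolding pred_def by simp
  qed
  ultimately have AE: "AE x in lborel. AE t in lborel. \<Phi> t x \<notin> T"
    using lborel_pair.AE_commute[of "\<lambda>t x. \<Phi> t x \<notin> T"] by (simp add: case_prod_unfold pred_def)
  define Z where "Z = {X. emeasure (arc_kernel V e X) S > 0}"
  have Zm: "Z \<in> sets borel"
  proof -
    have "(\<lambda>X. emeasure (arc_kernel V e X) S) \<in> borel_measurable borel"
      using measurable_emeasure_kernel[OF arc_kernel_measurable[OF assms(1)] S(1)] .
    then show ?thesis unfolding Z_def by measurable
  qed
  have "AE x in lborel. x \<notin> torus_of -` Z"
    using AE
  proof (rule AE_mp, intro AE_I2 impI)
    fix x assume "AE t in lborel. \<Phi> t x \<notin> T"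
    then have "AE t in lborel. \<not> (t \<in> arc_parameters V e (torus_of x) \<and> torus_flow V t (torus_of x) \<in> S)"
      by (rule AE_mp) (auto simp: torus_flow_torus_of T_def)
    moreover have "{t \<in> arc_parameters V e (torus_of x). torus_flow V t (torus_of x) \<in> S} \<in> sets lborel"
      using sets.Int[OF arc_parameters_measurable[OF assms(1), of "torus_of x"] measurable_sets_borel[OF torus_flow_measurable1 S(1), of "torus_of x"]]
      by (simp add: Int_def vimage_def)
    ultimately have "emeasure lborel {t \<in> arc_parameters V e (torus_of x). torus_flow V t (torus_of x) \<in> S} = 0"
      by (subst (asm) AE_iff_measurable[OF _ refl]) auto
    then show "x \<notin> torus_of -` Z"
      by (simp add: Z_def emeasure_arc_kernel[OF assms(1) S(1)])
  qed
  then have "emeasure lborel (torus_of -` Z) = 0"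
    using measurable_sets_borel[OF borel_measurable_torus_of Zm]
    by (subst (asm) AE_iff_measurable[of "torus_of -` Z"]) auto
  then show ?thesis
    using null_torus_measure_iff[OF Zm] by (simp add: Z_def)
qed

end

section \<open>Invariant measures that are not absolutely continuous\<close>

text \<open>
  The singular part of an invariant measure is invariant as well, hence carried by a null set
  from which the chain almost surely does not escape; removing exceptional points countably often
  makes this hold at every point.
\<close>

lemma singular_invariant_set:
  fixes P :: "'a::topological_space \<Rightarrow> 'a measure"
  assumes P: "P \<in> measurable borel (subprob_algebra borel)"
    and m: "sets m = sets borel"
    and null: "\<And>S. S \<in> sets borel \<Longrightarrow> emeasure m S = 0 \<Longrightarrow> emeasure m {X. emeasure (P X) S > 0} = 0"
    and inv: "invariant_measure P \<mu>" and nac: "\<not> absolutely_continuous m \<mu>"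
  shows "\<exists>B\<in>sets borel. B \<noteq> {} \<and> emeasure m B = 0 \<and> (\<forall>X\<in>B. emeasure (P X) B = 1)"
proof -
  interpret \<mu>: prob_space \<mu> using inv by (simp add: invariant_measure_def)
  have \<mu>: "sets \<mu> = sets borel" and sp: "space \<mu> = UNIV"
    and inv': "\<And>S. S \<in> sets borel \<Longrightarrow> (\<integral>\<^sup>+x. emeasure (P x) S \<partial>\<mu>) = emeasure \<mu> S"
    using inv by (auto simp: invariant_measure_def dest: sets_eq_imp_space_eq)
  have spm: "space m = UNIV" using m by (auto dest: sets_eq_imp_space_eq)
  have sub: "subprob_space (P X)" and setsP: "sets (P X) = sets borel" for X
    using subprob_space_kernel[OF P] sets_kernel[OF P] by auto
  have Pm: "(\<lambda>X. emeasure (P X) S) \<in> borel_measurable borel" if "S \<in> sets borel" for S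
    using measurable_emeasure_kernel[OF P that] .
  have Pm\<mu>: "(\<lambda>X. emeasure (P X) S) \<in> borel_measurable \<mu>" if "S \<in> sets borel" for S
    using Pm[OF that] measurable_cong_sets[OF \<mu> refl] by blast
  define \<N> where "\<N> = {S \<in> sets borel. emeasure m S = 0}"
  have "\<N> \<noteq> {}" by (auto simp: \<N>_def intro!: exI[of _ "{}"])
  then obtain F :: "nat \<Rightarrow> ennreal" where F: "range F \<subseteq> emeasure \<mu> ` \<N>" "Sup (emeasure \<mu> ` \<N>) = (SUP i. F i)"
    using ennreal_Sup_countable_SUP[of "emeasure \<mu> ` \<N>"] by auto
  then have "\<forall>i. \<exists>S\<in>\<N>. F i = emeasure \<mu> S" by blast
  then obtain S where S: "\<And>i. S i \<in> \<N>" "\<And>i. F i = emeasure \<mu> (S i)" by metis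
  \<comment> \<open>Exhaustion: \<open>A\<close> is a null set for \<open>m\<close> of largest mass
    for \<open>\<mu>\<close>, so it carries the singular part.\<close>
  define A where "A = (\<Union>i :: nat. S i)"
  have A: "A \<in> sets borel" using S by (auto simp: A_def \<N>_def)
  have mA: "emeasure m A = 0"
    unfolding A_def using S m by (intro emeasure_UN_eq_0) (auto simp: \<N>_def)
  have max: "emeasure \<mu> T \<le> emeasure \<mu> A" if "T \<in> \<N>" for T
  proof -
    have "emeasure \<mu> T \<le> (SUP i. F i)" using that F(2) by (metis Sup_upper imageI)
    also have "\<dots> \<le> emeasure \<mu> A"
      unfolding S(2) using A \<mu> by (intro SUP_least emeasure_mono) (auto simp: A_def)
    finally show ?thesis .
  qed
  obtain T where T: "T \<in> null_sets m" "T \<notin> null_sets \<mu>"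
    using nac by (auto simp: absolutely_continuous_def)
  then have "T \<in> \<N>" "emeasure \<mu> T \<noteq> 0"
    using m \<mu> by (auto simp: \<N>_def null_sets_def)
  then have \<mu>A: "emeasure \<mu> A \<noteq> 0" using max[of T] by auto
  \<comment> \<open>A null set with mass outside \<open>A\<close> could be added to
    \<open>A\<close>, against maximality.\<close>
  have small: "emeasure \<mu> (T - A) = 0" if "T \<in> \<N>" for T
  proof -
    have "T \<union> A \<in> \<N>"
      using that A mA m by (auto simp: \<N>_def intro!: emeasure_Un_null_set[THEN trans] simp: null_setsI)
    have "emeasure \<mu> A + emeasure \<mu> (T - A) = emeasure \<mu> (A \<union> (T - A))"
      using that A \<mu> by (intro plus_emeasure) (auto simp: \<N>_def)
    also have "A \<union> (T - A) = T \<union> A" by auto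
    also have "emeasure \<mu> \<dots> \<le> emeasure \<mu> A + 0"
      using max[OF \<open>T \<union> A \<in> \<N>\<close>] by simp
    finally show ?thesis
      by (simp add: ennreal_add_left_cancel_le)
  qed
  have Pone: "AE x in \<mu>. x \<in> A \<longrightarrow> emeasure (P x) A = 1"
  proof -
    define Z where "Z = {X. emeasure (P X) A > 0}"
    have "Z \<in> sets borel" using Pm[OF A] unfolding Z_def by measurable
    then have "Z \<in> \<N>" using null[OF A mA] by (simp add: \<N>_def Z_def)
    then have "Z - A \<in> null_sets \<mu>" using small A \<mu> by (auto simp: \<N>_def null_sets_def)
    then have "AE x in \<mu>. x \<notin> Z - A" by (rule AE_not_in)
    \<comment> \<open>Points that can jump into \<open>A\<close> form a null set for
      \<open>m\<close>, hence almost all of them lie in \<open>A\<close>. By invariance both sides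
      of the inequality have the same integral, so they agree almost everywhere.\<close>
    then have le: "AE x in \<mu>. emeasure (P x) A \<le> indicator A x"
    proof (rule eventually_mono)
      fix x assume "x \<notin> Z - A"
      then show "emeasure (P x) A \<le> indicator A x"
        using subprob_space.subprob_emeasure_le_1[OF sub] by (auto simp: Z_def indicator_def)
    qed
    have "(\<integral>\<^sup>+x. indicator A x - emeasure (P x) A \<partial>\<mu>) = (\<integral>\<^sup>+x. indicator A x \<partial>\<mu>) - (\<integral>\<^sup>+x. emeasure (P x) A \<partial>\<mu>)"
      using inv'[OF A] Pm\<mu>[OF A] A \<mu> le by (intro nn_integral_diff) auto
    also have "\<dots> = 0" using inv'[OF A] A \<mu> by simp
    finally have "AE x in \<mu>. indicator A x - emeasure (P x) A = 0"
      using Pm\<mu>[OF A] A \<mu> by (subst (asm) nn_integral_0_iff_AE) auto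
    then show ?thesis
    proof (rule eventually_mono, intro impI)
      fix x assume "indicator A x - emeasure (P x) A = 0" "x \<in> A"
      then have "1 \<le> emeasure (P x) A" by (simp add: ennreal_minus_eq_0)
      then show "emeasure (P x) A = 1"
        using subprob_space.subprob_emeasure_le_1[OF sub] by (simp add: antisym)
    qed
  qed
  \<comment> \<open>Points from which the chain may leave the current set are removed again and
    again; the intersection is closed under the chain at every point, not just at almost every
    one.\<close>
  define R where "R = rec_nat A (\<lambda>_ S. {x \<in> S. emeasure (P x) S = 1})"
  have R0: "R 0 = A" and RS: "R (Suc i) = {x \<in> R i. emeasure (P x) (R i) = 1}" for i
    by (simp_all add: R_def)
  have Rm: "R i \<in> sets borel" for i
  proof (induction i)
    case (Suc i)
    have "R i \<inter> {x. emeasure (P x) (R i) = 1} \<in> sets borel"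
      using Suc Pm[OF Suc] by measurable
    then show ?case by (simp add: RS Int_def)
  qed (simp add: R0 A)
  have "R (Suc i) \<subseteq> R i" for i by (auto simp: RS)
  then have dec: "decseq R" by (rule decseq_SucI)
  have RA: "R i \<subseteq> A" for i using decseqD[OF dec, of 0 i] by (simp add: R0)
  \<comment> \<open>No removal costs mass: if \<open>A - R i\<close> has mass 0, invariance shows
    that almost no point can jump into it, so almost every point of \<open>A\<close> passes the next
    test.\<close>
  have AE: "AE x in \<mu>. x \<in> A \<longrightarrow> x \<in> R i" for i
  proof (induction i)
    case (Suc i)
    have D: "A - R i \<in> sets borel" using A Rm by blast
    have "emeasure \<mu> (A - R i) = 0"
      using Suc D \<mu> sp by (subst (asm) AE_iff_measurable[of "A - R i"]) auto
    then have "(\<integral>\<^sup>+x. emeasure (P x) (A - R i) \<partial>\<mu>) = 0" using inv'[OF D] by simp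
    then have "AE x in \<mu>. emeasure (P x) (A - R i) = 0"
      using Pm\<mu>[OF D] by (subst (asm) nn_integral_0_iff_AE) auto
    with Suc Pone show ?case
    proof eventually_elim
      case (elim x)
      show ?case
      proof
        assume x: "x \<in> A"
        have "emeasure (P x) A = emeasure (P x) (R i \<union> (A - R i))"
          using RA[of i] by (intro arg_cong[of _ _ "emeasure (P x)"]) auto
        also have "\<dots> = emeasure (P x) (R i) + emeasure (P x) (A - R i)"
          using setsP Rm D by (intro plus_emeasure[symmetric]) auto
        finally show "x \<in> R (Suc i)"
          using elim x by (simp add: RS)
      qed
    qed
  qed (simp add: R0)
  define B where "B = (\<Inter>i. R i)"
  have B: "B \<in> sets borel" using Rm by (auto simp: B_def)
  have "AE x in \<mu>. \<forall>i. x \<in> A \<longrightarrow> x \<in> R i" using AE by (subst AE_all_countable) blast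
  then have AB: "AE x in \<mu>. x \<in> A \<longrightarrow> x \<in> B" by (rule eventually_mono) (auto simp: B_def)
  have "B \<noteq> {}"
  proof
    assume "B = {}"
    with AB have "AE x in \<mu>. x \<notin> A" by simp
    then have "emeasure \<mu> A = 0"
      using A \<mu> sp by (subst (asm) AE_iff_measurable[of A]) auto
    with \<mu>A show False by simp
  qed
  moreover have "emeasure m B = 0"
    using emeasure_mono[of B A m] A m mA RA by (auto simp: B_def)
  moreover have "emeasure (P X) B = 1" if "X \<in> B" for X
  proof -
    have "X \<in> R (Suc i)" for i using that by (auto simp: B_def)
    then have one: "emeasure (P X) (R i) = 1" for i by (simp add: RS)
    have "emeasure (P X) B = (INF i. emeasure (P X) (R i))"
      unfolding B_def using Rm setsP dec one by (intro INF_emeasure_decseq[symmetric]) auto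
    then show ?thesis by (simp add: one)
  qed
  ultimately show ?thesis using B by blast
qed

section \<open>Composition of the arc kernels\<close>

lemma composed_arc_kernel_measurable:
  assumes "\<And>i. i \<in> {1..k} \<Longrightarrow> arc_kernel (V i) (\<epsilon> i) \<in> measurable borel (subprob_algebra borel)"
  shows "composed_arc_kernel V \<epsilon> k \<in> measurable borel (subprob_algebra borel)"
  using assms
proof (induction k)
  case (Suc k)
  have "(\<lambda>x. composed_arc_kernel V \<epsilon> k x \<bind> arc_kernel (V (Suc k)) (\<epsilon> (Suc k))) \<in> measurable borel (subprob_algebra borel)"
    by (rule measurable_bind2[of _ _ borel]) (use Suc in auto)
  then show ?case by (simp add: fun_eq_iff cong: measurable_cong)
next
  case 0
  have "composed_arc_kernel V \<epsilon> 0 = return borel" by (simp add: fun_eq_iff)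
  then show ?case by simp
qed

lemma emeasure_composed_arc_kernel_Suc:
  assumes "\<And>i. i \<in> {1..Suc k} \<Longrightarrow> arc_kernel (V i) (\<epsilon> i) \<in> measurable borel (subprob_algebra borel)"
    and "S \<in> sets borel"
  shows "emeasure (composed_arc_kernel V \<epsilon> (Suc k) x) S =
    (\<integral>\<^sup>+y. emeasure (arc_kernel (V (Suc k)) (\<epsilon> (Suc k)) y) S \<partial>composed_arc_kernel V \<epsilon> k x)"
proof -
  have m: "composed_arc_kernel V \<epsilon> k \<in> measurable borel (subprob_algebra borel)"
    using assms by (intro composed_arc_kernel_measurable) auto
  then have s: "sets (composed_arc_kernel V \<epsilon> k x) = sets borel"
    by (simp add: subprob_measurableD)
  have "arc_kernel (V (Suc k)) (\<epsilon> (Suc k)) \<in> measurable (composed_arc_kernel V \<epsilon> k x) (subprob_algebra borel)"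
    using assms(1)[of "Suc k"] measurable_cong_sets[OF s refl] by auto
  then show ?thesis
    using assms(2) sets_eq_imp_space_eq[OF s] by (simp add: emeasure_bind)
qed

text \<open>The points from which the last arc can hit the null set form a null set
  \<open>Z\<close>; to hit \<open>S\<close> the earlier arcs must hit \<open>Z\<close>, and the
  induction hypothesis applies to \<open>Z\<close>.\<close>

lemma composed_arc_kernel_null:
  fixes V :: "nat \<Rightarrow> 'n::finite vector_field"
  assumes meas: "\<And>i. i \<in> {1..k} \<Longrightarrow> arc_kernel (V i) (\<epsilon> i) \<in> measurable borel (subprob_algebra borel)"
    and null: "\<And>i S. i \<in> {1..k} \<Longrightarrow> S \<in> sets borel \<Longrightarrow> emeasure torus_measure S = 0 \<Longrightarrow>
      emeasure torus_measure {X. emeasure (arc_kernel (V i) (\<epsilon> i) X) S > 0} = 0"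
    and "S \<in> sets borel" "emeasure torus_measure S = 0"
  shows "emeasure torus_measure {X. emeasure (composed_arc_kernel V \<epsilon> k X) S > 0} = 0"
  using assms
proof (induction k arbitrary: S)
  case 0
  then have "{X. emeasure (composed_arc_kernel V \<epsilon> 0 X) S > 0} = S"
    by (auto simp: indicator_def)
  then show ?case using 0 by simp
next
  case (Suc k)
  define K where "K = arc_kernel (V (Suc k)) (\<epsilon> (Suc k))"
  have K: "K \<in> measurable borel (subprob_algebra borel)" using Suc.prems(1) by (simp add: K_def)
  define Z where "Z = {X. emeasure (K X) S > 0}"
  have Km: "(\<lambda>X. emeasure (K X) S) \<in> borel_measurable borel"
    by (rule measurable_emeasure_kernel[OF K Suc.prems(3)])
  then have Z: "Z \<in> sets borel" unfolding Z_def by measurable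
  have cm: "composed_arc_kernel V \<epsilon> k \<in> measurable borel (subprob_algebra borel)"
    using Suc.prems(1) by (intro composed_arc_kernel_measurable) auto
  have "emeasure torus_measure Z = 0"
    using Suc.prems(2)[of "Suc k" S] Suc.prems(3,4) by (simp add: Z_def K_def)
  then have 0: "emeasure torus_measure {X. emeasure (composed_arc_kernel V \<epsilon> k X) Z > 0} = 0"
    using Suc.prems(1,2) Z by (intro Suc.IH) auto
  have "{X. emeasure (composed_arc_kernel V \<epsilon> (Suc k) X) S > 0} \<subseteq> {X. emeasure (composed_arc_kernel V \<epsilon> k X) Z > 0}"
  proof clarify
    fix X assume pos: "emeasure (composed_arc_kernel V \<epsilon> (Suc k) X) S > 0"
    have s: "sets (composed_arc_kernel V \<epsilon> k X) = sets borel"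
      using cm by (simp add: subprob_measurableD)
    show "emeasure (composed_arc_kernel V \<epsilon> k X) Z > 0"
    proof (rule ccontr)
      assume "\<not> emeasure (composed_arc_kernel V \<epsilon> k X) Z > 0"
      then have "Z \<in> null_sets (composed_arc_kernel V \<epsilon> k X)"
        using Z s by (simp add: null_sets_def)
      then have "AE y in composed_arc_kernel V \<epsilon> k X. y \<notin> Z" by (rule AE_not_in)
      then have "(\<integral>\<^sup>+y. emeasure (K y) S \<partial>composed_arc_kernel V \<epsilon> k X) = (\<integral>\<^sup>+y. 0 \<partial>composed_arc_kernel V \<epsilon> k X)"
        by (intro nn_integral_cong_AE) (auto simp: Z_def elim: eventually_mono)
      then show False
        using pos emeasure_composed_arc_kernel_Suc[of k V \<epsilon> S X, OF Suc.prems(1,3)] by (simp add: K_def del: composed_arc_kernel.simps)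
    qed
  qed
  moreover have "{X. emeasure (composed_arc_kernel V \<epsilon> k X) Z > 0} \<in> sets borel"
    using measurable_emeasure_kernel[OF cm Z] by measurable
  ultimately show ?case
    using 0 emeasure_mono[of _ "{X. emeasure (composed_arc_kernel V \<epsilon> k X) Z > 0}" torus_measure]
    by (simp add: sets_torus_measure)
qed

text \<open>Built backwards from \<open>S\<close>: the preceding set consists of the points whose
  next arc ends almost surely in the following set. Disintegrating in this way gives a statement
  about each single arc, valid at every point of the intermediate sets.\<close>

lemma composed_arc_kernel_chain:
  assumes "\<And>i. i \<in> {1..k} \<Longrightarrow> arc_kernel (V i) (\<epsilon> i) \<in> measurable borel (subprob_algebra borel)"
    and "S \<in> sets borel"
  shows "\<exists>C. C k = S \<and> (\<forall>i\<le>k. C i \<in> sets borel) \<and>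
    (\<forall>i<k. \<forall>X\<in>C i. emeasure (arc_kernel (V (Suc i)) (\<epsilon> (Suc i)) X) (C (Suc i)) = 1) \<and>
    (\<forall>y. emeasure (composed_arc_kernel V \<epsilon> k y) S = 1 \<longrightarrow> y \<in> C 0)"
  using assms
proof (induction k arbitrary: S)
  case 0
  then show ?case
    by (intro exI[of _ "\<lambda>_. S"]) (auto simp: indicator_def split: if_splits)
next
  case (Suc k)
  define K where "K = arc_kernel (V (Suc k)) (\<epsilon> (Suc k))"
  have K: "K \<in> measurable borel (subprob_algebra borel)" using Suc.prems(1) by (simp add: K_def)
  define Z where "Z = {X. emeasure (K X) S = 1}"
  have Km: "(\<lambda>X. emeasure (K X) S) \<in> borel_measurable borel"
    by (rule measurable_emeasure_kernel[OF K Suc.prems(2)])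
  then have Z: "Z \<in> sets borel" unfolding Z_def by measurable
  have cm: "composed_arc_kernel V \<epsilon> k \<in> measurable borel (subprob_algebra borel)"
    using Suc.prems(1) by (intro composed_arc_kernel_measurable) auto
  obtain C where C: "C k = Z" "\<forall>i\<le>k. C i \<in> sets borel"
    "\<forall>i<k. \<forall>X\<in>C i. emeasure (arc_kernel (V (Suc i)) (\<epsilon> (Suc i)) X) (C (Suc i)) = 1"
    "\<forall>y. emeasure (composed_arc_kernel V \<epsilon> k y) Z = 1 \<longrightarrow> y \<in> C 0"
    using Suc.IH[OF _ Z] Suc.prems(1) by auto
  have "emeasure (composed_arc_kernel V \<epsilon> k y) Z = 1"
    if one: "emeasure (composed_arc_kernel V \<epsilon> (Suc k) y) S = 1" for y
  proof -
    define M where "M = composed_arc_kernel V \<epsilon> k y"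
    have s: "sets M = sets borel" and "subprob_space M"
      using subprob_space_kernel[OF cm] sets_kernel[OF cm] by (auto simp: M_def)
    interpret subprob_space M by fact
    have spM: "space M = UNIV" using sets_eq_imp_space_eq[OF s] by simp
    have KmM: "(\<lambda>X. emeasure (K X) S) \<in> borel_measurable M"
      using Km measurable_cong_sets[OF s refl] by blast
    have K1: "emeasure (K z) S \<le> 1" for z
      using subprob_space.subprob_emeasure_le_1[OF subprob_space_kernel[OF K]] by simp
    have eq: "(\<integral>\<^sup>+z. emeasure (K z) S \<partial>M) = 1"
      using one emeasure_composed_arc_kernel_Suc[of k V \<epsilon> S y, OF Suc.prems] by (simp add: K_def M_def del: composed_arc_kernel.simps)
    have "(\<integral>\<^sup>+z. emeasure (K z) S \<partial>M) \<le> (\<integral>\<^sup>+z. 1 \<partial>M)"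
      by (intro nn_integral_mono K1)
    \<comment> \<open>The value 1 leaves no room for loss: the first \<open>k\<close> arcs carry
      full mass, and the last kernel has value 1 almost everywhere.\<close>
    then have "1 \<le> emeasure M (space M)" by (simp add: eq)
    then have tot: "emeasure M (space M) = 1"
      by (intro antisym emeasure_space_le_1)
    have "(\<integral>\<^sup>+z. 1 - emeasure (K z) S \<partial>M) = (\<integral>\<^sup>+z. 1 \<partial>M) - (\<integral>\<^sup>+z. emeasure (K z) S \<partial>M)"
      using eq KmM K1 by (intro nn_integral_diff) auto
    also have "\<dots> = 0" by (simp add: eq tot)
    finally have "AE z in M. 1 - emeasure (K z) S = 0"
      using KmM by (subst (asm) nn_integral_0_iff_AE) auto
    then have "AE z in M. z \<in> Z"
      by (rule eventually_mono) (use K1 in \<open>auto simp: Z_def ennreal_minus_eq_0 intro: antisym\<close>)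
    then have "emeasure M Z = emeasure M (space M)"
      using Z s by (intro emeasure_eq_AE) (auto simp: spM)
    then show ?thesis using tot by (simp add: M_def)
  qed
  then show ?case
    using C Suc.prems(2) Z
    by (intro exI[of _ "C(Suc k := S)"]) (auto simp: le_Suc_eq less_Suc_eq K_def Z_def)
qed

section \<open>Reachable sets\<close>

text \<open>
  Maps that stay close to the affine map with base point \<open>p\<close> and linear part \<open>\<Lambda>\<close> and send almost
  every small parameter into \<open>C\<close>. The error bound on differences (rather than on values) is strict
  differentiability; it passes to compositions and, for invertible \<open>\<Lambda>\<close>, makes the map
  bi-Lipschitz.
\<close>

definition reaches :: "'n::finite torus set \<Rightarrow> real ^ 'n \<Rightarrow> (real ^ 'n \<Rightarrow> real ^ 'n) \<Rightarrow> bool"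
  where "reaches C p \<Lambda> \<longleftrightarrow> bounded_linear \<Lambda> \<and> (\<forall>e>0. \<exists>d>0. \<exists>E. continuous_on UNIV E \<and>
    (\<forall>v v'. norm v \<le> d \<longrightarrow> norm v' \<le> d \<longrightarrow>
       norm (E v - p) \<le> e \<and> norm (E v - E v' - \<Lambda> (v - v')) \<le> e * norm (v - v')) \<and>
    (AE v in lborel. norm v \<le> d \<longrightarrow> torus_of (E v) \<in> C))"

lemma reaches_const: "torus_of p \<in> C \<Longrightarrow> reaches C p (\<lambda>_. 0)"
  unfolding reaches_def by (auto intro!: exI[of _ 1] exI[of _ "\<lambda>_. p"])

text \<open>One application of the automorphism, with \<open>A\<close> its linear lift. The
  tolerance e/K absorbs the norm of \<open>A\<close>.\<close>

lemma reaches_linear: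
  assumes r: "reaches C p \<Lambda>" and A: "bounded_linear A"
    and C: "\<And>x. torus_of x \<in> C \<Longrightarrow> torus_of (A x) \<in> C'"
  shows "reaches C' (A p) (\<lambda>v. A (\<Lambda> v))"
  unfolding reaches_def
proof (intro conjI allI impI)
  interpret A: bounded_linear A by fact
  show "bounded_linear (\<lambda>v. A (\<Lambda> v))"
    using r A by (auto simp: reaches_def intro: bounded_linear_compose)
  fix e :: real assume "e > 0"
  obtain K where K: "K > 0" "\<And>x. norm (A x) \<le> norm x * K"
    using A.pos_bounded by blast
  obtain d E where d: "d > 0" and E: "continuous_on UNIV E"
    and near: "\<And>v v'. norm v \<le> d \<Longrightarrow> norm v' \<le> d \<Longrightarrow> norm (E v - p) \<le> e / K \<and> norm (E v - E v' - \<Lambda> (v - v')) \<le> e / K * norm (v - v')"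
    and AE: "AE v in lborel. norm v \<le> d \<longrightarrow> torus_of (E v) \<in> C"
    using r[unfolded reaches_def, THEN conjunct2, rule_format, of "e / K"] \<open>e > 0\<close> \<open>K > 0\<close> by auto
  have "norm (A (E v) - A p) \<le> e \<and> norm (A (E v) - A (E v') - A (\<Lambda> (v - v'))) \<le> e * norm (v - v')"
    if "norm v \<le> d" "norm v' \<le> d" for v v'
  proof -
    have "norm (A (E v - p)) \<le> e / K * K"
      using near[OF that] K by (meson mult_right_mono less_imp_le order_trans)
    moreover have "norm (A (E v - E v' - \<Lambda> (v - v'))) \<le> e / K * norm (v - v') * K"
      using near[OF that] K by (meson mult_right_mono less_imp_le order_trans)
    ultimately show ?thesis
      using K(1) by (simp add: A.diff mult_ac)
  qed
  moreover have "continuous_on UNIV (\<lambda>v. A (E v))"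
    by (intro A.continuous_on E)
  moreover have "AE v in lborel. norm v \<le> d \<longrightarrow> torus_of (A (E v)) \<in> C'"
    using AE by (rule eventually_mono) (use C in blast)
  ultimately show "\<exists>d>0. \<exists>E. continuous_on UNIV E \<and>
    (\<forall>v v'. norm v \<le> d \<longrightarrow> norm v' \<le> d \<longrightarrow>
       norm (E v - A p) \<le> e \<and> norm (E v - E v' - A (\<Lambda> (v - v'))) \<le> e * norm (v - v')) \<and>
    (AE v in lborel. norm v \<le> d \<longrightarrow> torus_of (E v) \<in> C')"
    using d by (intro exI[of _ d] exI[of _ "\<lambda>v. A (E v)"] conjI) auto
qed

lemma AE_lborel_translate:
  fixes a :: "'a::euclidean_space"
  assumes "AE x in lborel. P x"
  shows "AE x in lborel. P (x + a)"
proof -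
  obtain N where N: "N \<in> null_sets lborel" "{x. \<not> P x} \<subseteq> N"
    using assms by (auto simp: eventually_ae_filter)
  show ?thesis
    by (rule AE_I'[OF null_sets_translation[OF N(1), of "- a"]]) (use N(2) in auto)
qed

text \<open>
  The time \<open>t\<close> of a step is split into \<open>s + w \<bullet> v\<close>: for almost every \<open>s\<close> almost all \<open>v\<close> lead
  into \<open>C'\<close>, and one such \<open>s\<close> is frozen.
\<close>

lemma (in unit_field) reaches_flow:
  assumes r: "reaches C p \<Lambda>" and C': "C' \<in> sets borel" and "\<delta> > 0"
    and C: "\<And>X. X \<in> C \<Longrightarrow> AE t in lborel. t \<in> {-\<delta><..<\<delta>} \<longrightarrow> torus_flow V t X \<in> C'"
  shows "reaches C' p (\<lambda>v. \<Lambda> v + (w \<bullet> v) *\<^sub>R lift_field V p)"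
  unfolding reaches_def
proof (intro conjI allI impI)
  have \<Lambda>: "bounded_linear \<Lambda>" using r by (simp add: reaches_def)
  interpret \<Lambda>: bounded_linear \<Lambda> by fact
  show "bounded_linear (\<lambda>v. \<Lambda> v + (w \<bullet> v) *\<^sub>R lift_field V p)"
    by (intro bounded_linear_add \<Lambda> bounded_linear_scaleR_const bounded_linear_inner_right)
  fix e :: real assume "e > 0"
  obtain K where K: "K > 0" "\<And>x. norm (\<Lambda> x) \<le> norm x * K"
    using \<Lambda>.pos_bounded by blast
  \<comment> \<open>The flow contributes half of the error. Its increments are controlled by the
    change of time plus the change of \<open>E\<close>, together at most (|w| + K + 1) |v -
    v'|.\<close>
  define e1 where "e1 = e / (2 * (norm w + K + 1))"
  have nw: "norm w + K + 1 > 0" using K norm_ge_zero[of w] by linarith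
  then have "e1 > 0" using \<open>e > 0\<close> by (simp add: e1_def)
  obtain d1 where "d1 > 0" and d1: "\<And>t t' x x'. \<bar>t\<bar> \<le> d1 \<Longrightarrow> \<bar>t'\<bar> \<le> d1 \<Longrightarrow> norm (x - p) \<le> d1 \<Longrightarrow> norm (x' - p) \<le> d1 \<Longrightarrow>
    norm (\<Phi> t x - \<Phi> t' x' - ((x - x') + (t - t') *\<^sub>R lift_field V p)) \<le> e1 * (\<bar>t - t'\<bar> + norm (x - x'))"
    using flow_strict_derivative[OF \<open>e1 > 0\<close>, of p] by blast
  define e2 where "e2 = min (e / 2) (min d1 1)"
  have "e2 > 0" using \<open>e > 0\<close> \<open>d1 > 0\<close> by (simp add: e2_def)
  have e2: "e2 \<le> e / 2" "e2 \<le> d1" "e2 \<le> 1" by (auto simp: e2_def)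
  obtain d2 E where d2: "d2 > 0" and E: "continuous_on UNIV E"
    and near: "\<And>v v'. norm v \<le> d2 \<Longrightarrow> norm v' \<le> d2 \<Longrightarrow> norm (E v - p) \<le> e2 \<and> norm (E v - E v' - \<Lambda> (v - v')) \<le> e2 * norm (v - v')"
    and AE: "AE v in lborel. norm v \<le> d2 \<longrightarrow> torus_of (E v) \<in> C"
    using r \<open>e2 > 0\<close> unfolding reaches_def by blast
  define \<eta> where "\<eta> = min (d1 / 2) (min (e / 4) (\<delta> / 4))"
  have "\<eta> > 0" using \<open>d1 > 0\<close> \<open>e > 0\<close> \<open>\<delta> > 0\<close> by (simp add: \<eta>_def)
  have \<eta>: "2 * \<eta> \<le> d1" "2 * \<eta> \<le> e / 2" "2 * \<eta> < \<delta>" using \<open>\<delta> > 0\<close> by (auto simp: \<eta>_def)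
  define d where "d = min d2 (\<eta> / (norm w + 1))"
  have nw1: "norm w + 1 > 0" using norm_ge_zero[of w] by linarith
  have "d > 0" using d2 \<open>\<eta> > 0\<close> nw1 by (simp add: d_def)
  have "d \<le> d2" by (simp add: d_def)
  have wv: "\<bar>w \<bullet> v\<bar> \<le> \<eta>" if "norm v \<le> d" for v
  proof -
    have "\<bar>w \<bullet> v\<bar> \<le> norm w * norm v" by (rule Cauchy_Schwarz_ineq2)
    also have "\<dots> \<le> (norm w + 1) * (\<eta> / (norm w + 1))"
      using that nw1 \<open>\<eta> > 0\<close> by (intro mult_mono) (auto simp: d_def)
    finally show ?thesis using nw1 by simp
  qed
  have cont: "continuous_on UNIV (\<lambda>(v, s). \<Phi> (s + w \<bullet> v) (E v))"
  proof -
    have "continuous_on UNIV (\<lambda>z. (snd z + w \<bullet> fst z, E (fst z)))"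
      by (intro continuous_intros continuous_on_compose2[OF E]) auto
    from continuous_on_compose2[OF continuous_on_flow this] show ?thesis
      by (simp add: case_prod_unfold)
  qed
  define Q where "Q v s \<longleftrightarrow> (norm v \<le> d \<longrightarrow> \<bar>s\<bar> \<le> \<eta> \<longrightarrow> torus_of (\<Phi> (s + w \<bullet> v) (E v)) \<in> C')" for v s
  have "AE v in lborel. AE s in lborel. Q v s"
    using AE
  proof (rule eventually_mono)
    fix v assume v: "norm v \<le> d2 \<longrightarrow> torus_of (E v) \<in> C"
    show "AE s in lborel. Q v s"
    proof (cases "norm v \<le> d")
      case True
      then have "torus_of (E v) \<in> C" using v \<open>d \<le> d2\<close> by simp
      from AE_lborel_translate[OF C[OF this], of "w \<bullet> v"]
      show ?thesis
        by (rule eventually_mono) (use wv[OF True] \<eta> in \<open>auto simp: Q_def torus_flow_torus_of\<close>)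
    qed (simp add: Q_def)
  qed
  moreover have "{z \<in> space (lborel \<Otimes>\<^sub>M lborel). Q (fst z) (snd z)} \<in> sets (lborel \<Otimes>\<^sub>M lborel)"
  proof -
    have "(\<lambda>z. \<Phi> (snd z + w \<bullet> fst z) (E (fst z))) \<in> borel_measurable borel"
      using borel_measurable_continuous_onI[OF cont] by (simp add: case_prod_unfold)
    then have "(\<lambda>z. torus_of (\<Phi> (snd z + w \<bullet> fst z) (E (fst z)))) \<in> borel_measurable borel"
      by measurable
    then have 1: "(\<lambda>z. torus_of (\<Phi> (snd z + w \<bullet> fst z) (E (fst z)))) -` C' \<in> sets borel"
      using C' by (rule measurable_sets_borel)
    have 2: "{z :: (real ^ 'n) \<times> real. norm (fst z) \<le> d} \<in> sets borel" "{z :: (real ^ 'n) \<times> real. \<bar>snd z\<bar> \<le> \<eta>} \<in> sets borel"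
      by (intro borel_closed closed_Collect_le continuous_intros)+
    have "{z. Q (fst z) (snd z)} = (- ({z. norm (fst z) \<le> d} \<inter> {z. \<bar>snd z\<bar> \<le> \<eta>})) \<union> (\<lambda>z. torus_of (\<Phi> (snd z + w \<bullet> fst z) (E (fst z)))) -` C'"
      by (auto simp: Q_def)
    also have "\<dots> \<in> sets borel"
      using 1 2 by (intro sets.Un borel_comp sets.Int) auto
    finally have "{z. Q (fst z) (snd z)} \<in> sets (borel \<Otimes>\<^sub>M borel)"
      unfolding borel_prod .
    then show ?thesis
      by (simp add: space_pair_measure)
  qed
  ultimately have "AE s in lborel. AE v in lborel. Q v s"
    using lborel_pair.AE_commute[of Q] by simp
  \<comment> \<open>The interval of offsets has positive length, so it contains a good one after the
    order of the quantifiers has been exchanged by Fubini.\<close>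
  then have "\<exists>s. \<bar>s\<bar> \<le> \<eta> \<and> (AE v in lborel. Q v s)"
  proof (rule contrapos_pp)
    assume no: "\<nexists>s. \<bar>s\<bar> \<le> \<eta> \<and> (AE v in lborel. Q v s)"
    show "\<not> (AE s in lborel. AE v in lborel. Q v s)"
    proof
      assume "AE s in lborel. AE v in lborel. Q v s"
      then have "AE s in lborel. s \<notin> {-\<eta>..\<eta>}"
        by (rule eventually_mono) (use no in \<open>auto simp: abs_le_iff\<close>)
      then have "emeasure lborel {-\<eta>..\<eta>} = 0"
        by (subst (asm) AE_iff_measurable[of "{-\<eta>..\<eta>}"]) auto
      then show False using \<open>\<eta> > 0\<close> by simp
    qed
  qed
  then obtain s where s: "\<bar>s\<bar> \<le> \<eta>" "AE v in lborel. Q v s" by blast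
  define E' where "E' v = \<Phi> (s + w \<bullet> v) (E v)" for v
  have "continuous_on UNIV E'"
    using continuous_on_compose2[OF cont, of UNIV "\<lambda>v. (v, s)"]
    by (auto simp: E'_def continuous_on_Pair continuous_on_const continuous_on_id)
  moreover have "AE v in lborel. norm v \<le> d \<longrightarrow> torus_of (E' v) \<in> C'"
    using s by (simp add: Q_def E'_def)
  moreover have "norm (E' v - p) \<le> e \<and>
      norm (E' v - E' v' - (\<Lambda> (v - v') + (w \<bullet> (v - v')) *\<^sub>R lift_field V p)) \<le> e * norm (v - v')"
    if v: "norm v \<le> d" "norm v' \<le> d" for v v'
  proof
    have t: "\<bar>s + w \<bullet> v\<bar> \<le> 2 * \<eta>" "\<bar>s + w \<bullet> v'\<bar> \<le> 2 * \<eta>"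
      using wv[OF v(1)] wv[OF v(2)] s by linarith+
    have n: "norm (E v - p) \<le> e2" "norm (E v' - p) \<le> e2" "norm (E v - E v' - \<Lambda> (v - v')) \<le> e2 * norm (v - v')"
      using near[of v v'] near[of v' v] v \<open>d \<le> d2\<close> by auto
    have "norm (E' v - p) \<le> norm (\<Phi> (s + w \<bullet> v) (E v) - \<Phi> 0 (E v)) + norm (E v - p)"
      using norm_triangle_ineq[of "\<Phi> (s + w \<bullet> v) (E v) - E v" "E v - p"] by (simp add: E'_def)
    then show "norm (E' v - p) \<le> e"
      using flow_time_lipschitz[of "s + w \<bullet> v" "E v" 0] t n e2 \<eta> by simp
    have "norm (E v - E v') \<le> norm (E v - E v' - \<Lambda> (v - v')) + norm (\<Lambda> (v - v'))"
      using norm_triangle_ineq[of "E v - E v' - \<Lambda> (v - v')" "\<Lambda> (v - v')"] by simp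
    also have "\<dots> \<le> 1 * norm (v - v') + norm (v - v') * K"
      using n(3) K(2) e2(3) by (intro add_mono order_trans[OF n(3)] mult_right_mono) auto
    finally have Elip: "norm (E v - E v') \<le> (K + 1) * norm (v - v')" by (simp add: algebra_simps)
    have wlip: "\<bar>w \<bullet> v - w \<bullet> v'\<bar> \<le> norm w * norm (v - v')"
      using Cauchy_Schwarz_ineq2[of w "v - v'"] by (simp add: inner_diff_right)
    have "norm (E' v - E' v' - ((E v - E v') + (w \<bullet> v - w \<bullet> v') *\<^sub>R lift_field V p))
        \<le> e1 * (\<bar>w \<bullet> v - w \<bullet> v'\<bar> + norm (E v - E v'))"
      using d1[of "s + w \<bullet> v" "s + w \<bullet> v'" "E v" "E v'"] t n e2 \<eta> by (simp add: E'_def)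
    also have "\<dots> \<le> e1 * ((norm w + K + 1) * norm (v - v'))"
      using Elip wlip \<open>e1 > 0\<close> by (intro mult_left_mono) (auto simp: algebra_simps)
    also have "\<dots> = e / 2 * norm (v - v')"
      using nw by (simp add: e1_def field_simps)
    finally have 1: "norm (E' v - E' v' - ((E v - E v') + (w \<bullet> v - w \<bullet> v') *\<^sub>R lift_field V p)) \<le> e / 2 * norm (v - v')" .
    have 2: "norm (E v - E v' - \<Lambda> (v - v')) \<le> e / 2 * norm (v - v')"
      using n(3) mult_right_mono[OF e2(1), of "norm (v - v')"] by simp
    have "E' v - E' v' - (\<Lambda> (v - v') + (w \<bullet> (v - v')) *\<^sub>R lift_field V p)
      = (E' v - E' v' - ((E v - E v') + (w \<bullet> v - w \<bullet> v') *\<^sub>R lift_field V p)) + (E v - E v' - \<Lambda> (v - v'))"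
      by (simp add: inner_diff_right)
    also have "norm \<dots> \<le> e / 2 * norm (v - v') + e / 2 * norm (v - v')"
      using 1 2 norm_triangle_mono by blast
    finally show "norm (E' v - E' v' - (\<Lambda> (v - v') + (w \<bullet> (v - v')) *\<^sub>R lift_field V p)) \<le> e * norm (v - v')"
      by simp
  qed
  ultimately show "\<exists>d>0. \<exists>E. continuous_on UNIV E \<and>
    (\<forall>v v'. norm v \<le> d \<longrightarrow> norm v' \<le> d \<longrightarrow>
       norm (E v - p) \<le> e \<and> norm (E v - E v' - (\<Lambda> (v - v') + (w \<bullet> (v - v')) *\<^sub>R lift_field V p)) \<le> e * norm (v - v')) \<and>
    (AE v in lborel. norm v \<le> d \<longrightarrow> torus_of (E v) \<in> C')"
    using \<open>d > 0\<close> by (intro exI[of _ d] exI[of _ E'] conjI) auto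
qed

text \<open>With tolerance 1/2 the map \<open>E\<close> shrinks distances at most by the factor 1/2,
  so its inverse \<open>G\<close> on the image of a ball is 2-Lipschitz. If \<open>B\<close> were
  null, \<open>G\<close> would produce a null set of parameters, yet almost every parameter in the
  ball leads into \<open>B\<close>.\<close>

lemma reaches_id_not_null:
  assumes r: "reaches B p (\<lambda>v. v)" and B: "B \<in> sets borel"
  shows "emeasure torus_measure B \<noteq> 0"
proof
  assume "emeasure torus_measure B = 0"
  then have null: "emeasure lborel (torus_of -` B) = 0" using null_torus_measure_iff[OF B] by simp
  have Tm: "torus_of -` B \<in> sets borel" by (rule measurable_sets_borel[OF borel_measurable_torus_of B])
  obtain d E where d: "d > 0" and E: "continuous_on UNIV E"
    and near: "\<And>v v'. norm v \<le> d \<Longrightarrow> norm v' \<le> d \<Longrightarrow> norm (E v - E v' - (v - v')) \<le> 1/2 * norm (v - v')"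
    and AE: "AE v in lborel. norm v \<le> d \<longrightarrow> torus_of (E v) \<in> B"
    using r[unfolded reaches_def, THEN conjunct2, rule_format, of "1/2"] by auto
  have low: "norm (v - v') \<le> 2 * norm (E v - E v')" if "norm v \<le> d" "norm v' \<le> d" for v v'
    using near[OF that] norm_triangle_ineq2[of "v - v'" "E v - E v'"] by (simp add: norm_minus_commute)
  then have inj: "inj_on E (cball 0 d)"
    by (intro inj_onI) force
  define G where "G = inv_into (cball 0 d) E"
  have G: "G (E v) = v" if "norm v \<le> d" for v
    using inj that by (simp add: G_def)
  have "negligible (torus_of -` B \<inter> E ` cball 0 d)"
  proof (rule negligible_subset)
    have "torus_of -` B \<in> null_sets lborel" using null Tm by (intro null_setsI) auto
    then show "negligible (torus_of -` B)"
      unfolding negligible_iff_null_sets by (rule null_sets_completionI)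
  qed simp
  then have "negligible (G ` (torus_of -` B \<inter> E ` cball 0 d))"
  proof (rule negligible_locally_Lipschitz_image[rotated])
    fix y assume "y \<in> torus_of -` B \<inter> E ` cball 0 d"
    then show "\<exists>T B'. open T \<and> y \<in> T \<and> (\<forall>z\<in>(torus_of -` B \<inter> E ` cball 0 d) \<inter> T. norm (G z - G y) \<le> B' * norm (z - y))"
      using low G by (intro exI[of _ UNIV] exI[of _ 2]) auto
  qed simp
  moreover have "{v. norm v \<le> d \<and> torus_of (E v) \<in> B} \<subseteq> G ` (torus_of -` B \<inter> E ` cball 0 d)"
    using G by (force simp: image_iff)
  ultimately have neg: "negligible {v. norm v \<le> d \<and> torus_of (E v) \<in> B}"
    by (rule negligible_subset)
  have "AE v in lebesgue. v \<notin> {v. norm v \<le> d \<and> torus_of (E v) \<in> B}"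
    using neg by (intro AE_not_in) (simp add: negligible_iff_null_sets)
  moreover have "AE v in lebesgue. norm v \<le> d \<longrightarrow> torus_of (E v) \<in> B"
    using AE by (rule AE_completion)
  ultimately have "AE v :: real ^ 'a in lebesgue. v \<notin> cball 0 d"
    by (rule eventually_elim2) auto
  then have "emeasure lebesgue (cball (0 :: real ^ 'a) d) = 0"
    by (subst (asm) AE_iff_measurable[of "cball 0 d"]) auto
  then have "negligible (cball (0 :: real ^ 'a) d)"
    by (simp add: negligible_iff_null_sets null_setsI)
  then show False
    using d negligible_subset[OF _ ball_subset_cball] open_not_negligible[of "ball (0 :: real ^ 'a) d"] by auto
qed

text \<open>The columns of the derivative span, expressed by covectors, which suits both the
  perturbation and the compactness argument. The index starts at 1 because the automorphism acts
  before the first arc: the field is never evaluated at \<open>x\<close> itself.\<close>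

definition spanning_at :: "real ^ 'n ^ 'n \<Rightarrow> nat \<Rightarrow> (real ^ 'n \<Rightarrow> real ^ 'n) \<Rightarrow> real ^ 'n \<Rightarrow> bool"
  where "spanning_at A N g x \<longleftrightarrow> (\<forall>u. u \<noteq> 0 \<longrightarrow> (\<exists>j\<in>{1..N}. u \<bullet> (((*v) A ^^ (N - j)) (g (((*v) A ^^ j) x))) \<noteq> 0))"

lemma bounded_linear_matrix_funpow: "bounded_linear ((*v) (A :: real ^ 'n ^ 'n) ^^ m)"
  by (induction m) (auto simp: o_def id_def bounded_linear_ident
      intro: bounded_linear_compose[OF matrix_vector_mul_bounded_linear])

text \<open>A proper span would have a nonzero orthogonal vector. Each axis vector is thus a
  combination of the columns, and the coefficients belonging to column \<open>j\<close> form the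
  covector \<open>w j\<close>: spending the time w j . v at step j makes the linear part the
  identity.\<close>

lemma spanning_at_right_inverse:
  fixes A :: "real ^ 'n ^ 'n"
  assumes "spanning_at A N g x"
  obtains w where "\<And>v. (\<Sum>j=1..N. (w j \<bullet> v) *\<^sub>R (((*v) A ^^ (N - j)) (g (((*v) A ^^ j) x)))) = v"
proof -
  define c where "c j = ((*v) A ^^ (N - j)) (g (((*v) A ^^ j) x))" for j
  define T where "T = range (\<lambda>a :: nat \<Rightarrow> real. \<Sum>j=1..N. a j *\<^sub>R c j)"
  have "subspace T"
    unfolding T_def
  proof (rule subspaceI)
    show "0 \<in> range (\<lambda>a :: nat \<Rightarrow> real. \<Sum>j=1..N. a j *\<^sub>R c j)"
      by (rule range_eqI[of _ _ "\<lambda>_. 0"]) simp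
  next
    fix y z assume "y \<in> range (\<lambda>a :: nat \<Rightarrow> real. \<Sum>j=1..N. a j *\<^sub>R c j)" "z \<in> range (\<lambda>a :: nat \<Rightarrow> real. \<Sum>j=1..N. a j *\<^sub>R c j)"
    then obtain a b where "y = (\<Sum>j=1..N. a j *\<^sub>R c j)" "z = (\<Sum>j=1..N. b j *\<^sub>R c j)" by blast
    then show "y + z \<in> range (\<lambda>a :: nat \<Rightarrow> real. \<Sum>j=1..N. a j *\<^sub>R c j)"
      by (intro range_eqI[of _ _ "\<lambda>j. a j + b j"]) (simp add: sum.distrib scaleR_add_left)
  next
    fix r :: real and y assume "y \<in> range (\<lambda>a :: nat \<Rightarrow> real. \<Sum>j=1..N. a j *\<^sub>R c j)"
    then obtain a where "y = (\<Sum>j=1..N. a j *\<^sub>R c j)" by blast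
    then show "r *\<^sub>R y \<in> range (\<lambda>a :: nat \<Rightarrow> real. \<Sum>j=1..N. a j *\<^sub>R c j)"
      by (intro range_eqI[of _ _ "\<lambda>j. r * a j"]) (simp add: scaleR_sum_right)
  qed
  have cT: "c i \<in> T" if "i \<in> {1..N}" for i
    unfolding T_def using that
    by (intro range_eqI[of _ _ "\<lambda>j. if j = i then 1 else 0"]) (simp add: if_distrib[of "\<lambda>r. r *\<^sub>R _"] sum.delta cong: if_cong)
  have "span T = UNIV"
  proof (rule ccontr)
    assume "span T \<noteq> UNIV"
    then obtain u where u: "u \<noteq> 0" "\<And>y. y \<in> span T \<Longrightarrow> orthogonal u y"
      using orthogonal_to_subspace_exists_gen[of T UNIV] by auto
    then show False
      using assms cT span_base[of _ T] unfolding spanning_at_def c_def[symmetric] orthogonal_def by blast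
  qed
  moreover have "span T = T" using \<open>subspace T\<close> by (rule span_eq_iff[THEN iffD2])
  ultimately have "T = UNIV" by simp
  then have "\<forall>l. \<exists>a :: nat \<Rightarrow> real. axis l 1 = (\<Sum>j=1..N. a j *\<^sub>R c j)"
    unfolding T_def by blast
  then obtain a where a: "\<And>l. axis l 1 = (\<Sum>j=1..N. a l j *\<^sub>R c j)" by metis
  have "(\<Sum>j=1..N. ((\<chi> l. a l j) \<bullet> v) *\<^sub>R c j) = v" for v
  proof -
    have "(\<Sum>j=1..N. ((\<chi> l. a l j) \<bullet> v) *\<^sub>R c j) = (\<Sum>j=1..N. \<Sum>l\<in>UNIV. v $ l *\<^sub>R (a l j *\<^sub>R c j))"
      by (simp add: inner_vec_def scaleR_sum_left mult.commute)
    also have "\<dots> = (\<Sum>l\<in>UNIV. v $ l *\<^sub>R axis l 1)"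
      by (subst sum.swap) (simp add: a scaleR_sum_right)
    also have "\<dots> = v"
      by (simp add: vec_eq_iff axis_def if_distrib[of "\<lambda>r. _ * r"] sum.delta cong: if_cong)
    finally show ?thesis .
  qed
  then show thesis using that[of "\<lambda>j. \<chi> l. a l j"] by (simp add: c_def)
qed

text \<open>One step of the chain turns the linear part \<open>\<Lambda>\<close> into
  \<open>A\<close> applied to \<open>\<Lambda>\<close> plus a rank one term along \<open>V 1\<close>
  with a freely chosen covector. From a constant map at a point of \<open>B\<close> outside
  \<open>F\<close>, N steps with the covectors of \<open>spanning_at_right_inverse\<close> reach the
  identity.\<close>

lemma spanning_not_invariant_null:
  fixes V :: "nat \<Rightarrow> 'n::finite vector_field" and A :: "real ^ 'n ^ 'n"
  assumes f: "\<And>x. f (torus_of x) = torus_of (A *v x)"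
    and V: "\<And>i. i \<in> {1..k} \<Longrightarrow> \<exists>L. unit_field (V i) L"
    and k: "k \<ge> 1" and \<epsilon>: "\<And>i. i \<in> {1..k} \<Longrightarrow> \<epsilon> i > 0"
    and F: "countable F" "\<And>x. x \<notin> F \<Longrightarrow> spanning_at A N (lift_field (V 1)) x"
    and B: "B \<in> sets borel" "B \<noteq> {}" "\<And>X. X \<in> B \<Longrightarrow> emeasure (random_perturbation f k V \<epsilon> X) B = 1"
  shows "emeasure torus_measure B \<noteq> 0"
proof -
  obtain L where L: "\<And>i. i \<in> {1..k} \<Longrightarrow> unit_field (V i) (L i)" using V by metis
  then have meas: "arc_kernel (V i) (\<epsilon> i) \<in> measurable borel (subprob_algebra borel)" if "i \<in> {1..k}" for i
    using unit_field.arc_kernel_measurable \<epsilon> that less_imp_le by metis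
  from composed_arc_kernel_chain[of k V \<epsilon> B, OF meas B(1)]
  obtain C where C: "C k = B" "\<forall>i\<le>k. C i \<in> sets borel"
    "\<forall>i<k. \<forall>X\<in>C i. emeasure (arc_kernel (V (Suc i)) (\<epsilon> (Suc i)) X) (C (Suc i)) = 1"
    "\<forall>y. emeasure (composed_arc_kernel V \<epsilon> k y) B = 1 \<longrightarrow> y \<in> C 0"
    by auto
  note Ck = C(1) and Cm = C(2)[rule_format] and C1 = C(3)[rule_format] and C0 = C(4)[rule_format]
  have fB: "f X \<in> C 0" if "X \<in> B" for X
    using C0 B(3)[OF that] by (simp add: random_perturbation_def)
  have step: "\<exists>\<delta>>0. \<delta> \<le> 1/2 \<and> \<delta> \<le> 1 / (2 * L (Suc i)) \<and> (\<forall>X\<in>C i. AE t in lborel. t \<in> {-\<delta><..<\<delta>} \<longrightarrow> torus_flow (V (Suc i)) t X \<in> C (Suc i))"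
    if i: "i < k" for i
  proof -
    interpret unit_field "V (Suc i)" "L (Suc i)" using L i by auto
    define \<delta> where "\<delta> = min (\<epsilon> (Suc i)) (min (1/2) (1 / (2 * L (Suc i))))"
    have "\<delta> > 0" using \<epsilon>[of "Suc i"] i L_pos by (simp add: \<delta>_def)
    moreover have "\<delta> \<le> \<epsilon> (Suc i)" "\<delta> \<le> 1/2" "\<delta> \<le> 1 / (2 * L (Suc i))" by (auto simp: \<delta>_def)
    ultimately show ?thesis
      using AE_flow_of_arc_kernel[OF _ _ _ _ Cm C1[OF i], of \<delta>] i by (intro exI[of _ \<delta>]) auto
  qed
  have ne: "C i \<noteq> {}" if "i \<le> k" for i
    using that
  proof (induction i)
    case 0
    then show ?case using fB B(2) by blast
  next
    case (Suc i)
    then obtain X where X: "X \<in> C i" by auto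
    obtain \<delta> where "\<delta> > 0" and AE: "AE t in lborel. t \<in> {-\<delta><..<\<delta>} \<longrightarrow> torus_flow (V (Suc i)) t X \<in> C (Suc i)"
      using step[of i] Suc.prems X by auto
    show ?case
    proof
      assume "C (Suc i) = {}"
      then have "AE t in lborel. t \<notin> {-\<delta><..<\<delta>}" using AE by simp
      then have "emeasure lborel {-\<delta><..<\<delta>} = 0"
        by (subst (asm) AE_iff_measurable[of "{-\<delta><..<\<delta>}"]) auto
      then show False using \<open>\<delta> > 0\<close> by simp
    qed
  qed
  \<comment> \<open>A short piece of the last arc is injective, so it meets the countable set
    \<open>F\<close> at countably many times only, while almost all times lead into
    \<open>B\<close>.\<close>
  have "\<exists>p. torus_of p \<in> B \<and> p \<notin> F"
  proof (rule ccontr)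
    assume no: "\<nexists>p. torus_of p \<in> B \<and> p \<notin> F"
    obtain i where i: "k = Suc i" using k by (cases k) auto
    interpret unit_field "V k" "L k" using L k by auto
    obtain X where "X \<in> C i" using ne[of i] i by auto
    then obtain \<delta> where \<delta>: "\<delta> > 0" "\<delta> \<le> 1/2" "\<delta> \<le> 1 / (2 * L k)"
      and AE: "AE t in lborel. t \<in> {-\<delta><..<\<delta>} \<longrightarrow> torus_flow (V k) t X \<in> B"
      using step[of i] i Ck by auto
    obtain x where x: "X = torus_of x" using surj_torus_of by blast
    define T where "T = {t \<in> {-\<delta><..<\<delta>}. \<Phi> t x \<in> F}"
    have "inj_on (\<lambda>t. \<Phi> t x) T"
    proof (rule inj_onI)
      fix s t assume st: "s \<in> T" "t \<in> T" "\<Phi> s x = \<Phi> t x"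
      have "2 * \<delta> \<le> 1 / L k" using \<delta>(3) L_pos by (simp add: field_simps)
      moreover have "\<bar>s - t\<bar> < 2 * \<delta>" using st by (auto simp: T_def)
      ultimately show "s = t"
        using st(3) \<delta>(2) by (intro torus_flow_inj[of s t "torus_of x"]) (auto simp: torus_flow_torus_of)
    qed
    moreover have "countable ((\<lambda>t. \<Phi> t x) ` T)"
      by (rule countable_subset[OF _ F(1)]) (auto simp: T_def)
    ultimately have "countable T" using countable_image_inj_on by blast
    then have "AE t in lborel. t \<notin> T" by (intro AE_not_in countable_imp_null_set_lborel)
    with AE have "AE t in lborel. t \<notin> {-\<delta><..<\<delta>}"
      by eventually_elim (use no in \<open>auto simp: T_def x torus_flow_torus_of\<close>)
    then have "emeasure lborel {-\<delta><..<\<delta>} = 0"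
      by (subst (asm) AE_iff_measurable[of "{-\<delta><..<\<delta>}"]) auto
    then show False using \<open>\<delta> > 0\<close> by simp
  qed
  then obtain p where p: "torus_of p \<in> B" "p \<notin> F" by blast
  obtain w where w: "\<And>v. (\<Sum>j=1..N. (w j \<bullet> v) *\<^sub>R (((*v) A ^^ (N - j)) (lift_field (V 1) (((*v) A ^^ j) p)))) = v"
    using spanning_at_right_inverse[OF F(2)[OF p(2)]] by blast
  \<comment> \<open>One step of the chain: the automorphism, then the arcs through the sets
    \<open>C i\<close>. Only the first arc contributes a column.\<close>
  have round: "reaches B (A *v q) (\<lambda>v. A *v \<Lambda> v + (u \<bullet> v) *\<^sub>R lift_field (V 1) (A *v q))"
    if q: "reaches B q \<Lambda>" for q \<Lambda> u
  proof -
    have 0: "reaches (C 0) (A *v q) (\<lambda>v. A *v \<Lambda> v)"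
      by (rule reaches_linear[OF q matrix_vector_mul_bounded_linear]) (use fB f in metis)
    have "reaches (C (Suc i)) (A *v q) (\<lambda>v. A *v \<Lambda> v + (u \<bullet> v) *\<^sub>R lift_field (V 1) (A *v q))"
      if "i < k" for i
      using that
    proof (induction i)
      case 0
      interpret unit_field "V 1" "L 1" using L k by auto
      obtain \<delta> where "\<delta> > 0" "\<And>X. X \<in> C 0 \<Longrightarrow> AE t in lborel. t \<in> {-\<delta><..<\<delta>} \<longrightarrow> torus_flow (V 1) t X \<in> C 1"
        using step[of 0] k by auto
      then show ?case
        using reaches_flow[OF \<open>reaches (C 0) (A *v q) (\<lambda>v. A *v \<Lambda> v)\<close> Cm[of 1]] k by simp
    next
      case (Suc i)
      interpret unit_field "V (Suc (Suc i))" "L (Suc (Suc i))" using L Suc.prems by auto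
      obtain \<delta> where "\<delta> > 0" "\<And>X. X \<in> C (Suc i) \<Longrightarrow> AE t in lborel. t \<in> {-\<delta><..<\<delta>} \<longrightarrow> torus_flow (V (Suc (Suc i))) t X \<in> C (Suc (Suc i))"
        using step[of "Suc i"] Suc.prems by auto
      then show ?case
        using reaches_flow[OF Suc.IH Cm[of "Suc (Suc i)"], where w = 0] Suc.prems by simp
    qed
    from this[of "k - 1"] show ?thesis using k Ck by simp
  qed
  have "reaches B (((*v) A ^^ m) p) (\<lambda>v. \<Sum>j=1..m. (w j \<bullet> v) *\<^sub>R (((*v) A ^^ (m - j)) (lift_field (V 1) (((*v) A ^^ j) p))))" for m
  proof (induction m)
    case 0
    then show ?case using reaches_const[OF p(1)] by simp
  next
    case (Suc m)
    have "A *v (\<Sum>j=1..m. (w j \<bullet> v) *\<^sub>R (((*v) A ^^ (m - j)) (lift_field (V 1) (((*v) A ^^ j) p))))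
        = (\<Sum>j=1..m. (w j \<bullet> v) *\<^sub>R (((*v) A ^^ (Suc m - j)) (lift_field (V 1) (((*v) A ^^ j) p))))" for v
      by (simp add: linear_sum[OF matrix_vector_mul_linear] Suc_diff_le matrix_vector_mult_scaleR)
    then show ?case
      using round[OF Suc.IH, of "w (Suc m)"] by simp
  qed
  from this[of N] have "reaches B (((*v) A ^^ N) p) (\<lambda>v. v)"
    by (simp only: w)
  then show ?thesis by (rule reaches_id_not_null[OF _ B(1)])
qed

section \<open>Periodic points of hyperbolic automorphisms\<close>

lemma det_map_matrix_of_int:
  "det (map_matrix of_int A :: 'a::comm_ring_1 ^ 'n ^ 'n) = of_int (det (A :: int ^ 'n ^ 'n))"
  by (simp add: det_def map_matrix_def)

text \<open>
  A vector fixed by \<open>A ^ d\<close> is a sum of eigenvectors for \<open>d\<close>-th roots of unity, by discrete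
  Fourier inversion.
\<close>

lemma hyperbolic_fixed_vector:
  fixes A :: "int ^ 'n ^ 'n" and v :: "real ^ 'n"
  assumes hyp: "\<And>(c :: complex) v. v \<noteq> 0 \<Longrightarrow> map_matrix of_int A *v v = c *s v \<Longrightarrow> cmod c \<noteq> 1"
    and d: "d \<ge> 1" and fix_v: "((*v) (map_matrix of_int A) ^^ d) v = v"
  shows "v = 0"
proof -
  define AC where "AC = (map_matrix of_int A :: complex ^ 'n ^ 'n)"
  define C :: "real ^ 'n \<Rightarrow> complex ^ 'n" where "C = (\<lambda>v. \<chi> i. complex_of_real (v $ i))"
  have AC: "AC *v C v = C (map_matrix of_int A *v v)" for v
    by (simp add: vec_eq_iff AC_def C_def matrix_vector_mult_def map_matrix_def)
  define y where "y m = C (((*v) (map_matrix of_int A) ^^ m) v)" for m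
  have y: "AC *v y m = y (Suc m)" for m by (simp add: y_def AC)
  have yd: "y d = y 0" by (simp add: y_def fix_v)
  define \<xi> where "\<xi> = exp (2 * of_real pi * \<i> * of_nat 1 / of_nat d)"
  have \<xi>d: "\<xi> ^ d = 1" unfolding \<xi>_def by (rule complex_root_unity) (use d in simp)
  have \<xi>rd: "\<xi> ^ (r * d) = 1" for r
    by (simp add: mult.commute[of r d] power_mult \<xi>d)
  have \<xi>n: "cmod \<xi> = 1" by (simp add: \<xi>_def)
  have \<xi>m: "\<xi> ^ m \<noteq> 1" if "0 < m" "m < d" for m
  proof -
    have "\<xi> ^ m = exp (2 * of_real pi * \<i> * of_nat m / of_nat d)"
      by (simp add: \<xi>_def mult_ac flip: exp_of_nat_mult)
    then show ?thesis
      using complex_root_unity_eq_1[of d m] d that by (auto dest: dvd_imp_le)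
  qed
  \<comment> \<open>The Fourier components of the periodic orbit \<open>y\<close>. The shift of the
    orbit makes \<open>z r\<close> either 0 or an eigenvector for the inverse of
    \<open>\<xi> ^ r\<close>, which has modulus 1; hyperbolicity leaves only 0.\<close>
  define z where "z r = (\<Sum>m<d. \<xi> ^ (r * m) *s y m)" for r
  have "z r = 0" for r
  proof -
    have AC_sum: "AC *v (\<Sum>m<d. c m *s y m) = (\<Sum>m<d. c m *s (AC *v y m))" for c
      by (induction d) (simp_all add: matrix_vector_right_distrib vector_scalar_commute)
    have "\<xi> ^ r *s (AC *v z r) = (\<Sum>m<d. \<xi> ^ (r * Suc m) *s y (Suc m))"
      by (simp add: z_def AC_sum y vec.scale_sum_right vec.scale_scale power_add)
    also have "\<dots> = (\<Sum>m<Suc d. \<xi> ^ (r * m) *s y m) - y 0"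
      by (simp add: sum.lessThan_Suc_shift del: sum.lessThan_Suc)
    also have "\<dots> = z r"
      by (simp add: z_def yd \<xi>rd)
    finally have eq: "\<xi> ^ r *s (AC *v z r) = z r" .
    have ne: "\<xi> ^ r \<noteq> 0" using \<xi>n by auto
    have "AC *v z r = inverse (\<xi> ^ r) *s (\<xi> ^ r *s (AC *v z r))"
      using ne by simp
    then have "AC *v z r = inverse (\<xi> ^ r) *s z r" by (simp only: eq)
    moreover have "cmod (inverse (\<xi> ^ r)) = 1" by (simp add: norm_inverse norm_power \<xi>n)
    ultimately show ?thesis using hyp[of "z r" "inverse (\<xi> ^ r)"] by (auto simp: AC_def)
  qed
  then have "0 = (\<Sum>r<d. z r)" by simp
  also have "\<dots> = (\<Sum>m<d. (\<Sum>r<d. (\<xi> ^ m) ^ r) *s y m)"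
    unfolding z_def by (subst sum.swap) (simp add: vec.scale_sum_left power_mult[symmetric] mult.commute)
  also have "\<dots> = (\<Sum>m<d. if m = 0 then of_nat d *s y m else 0)"
  proof (rule sum.cong[OF refl])
    fix m assume "m \<in> {..<d}"
    have "(\<Sum>r<d. (\<xi> ^ m) ^ r) = 0" if "m \<noteq> 0"
      using \<xi>m[of m] that \<open>m \<in> {..<d}\<close> \<xi>rd[of m] geometric_sum[of "\<xi> ^ m" d]
      by (simp flip: power_mult)
    then show "(\<Sum>r<d. (\<xi> ^ m) ^ r) *s y m = (if m = 0 then of_nat d *s y m else 0)"
      by auto
  qed
  also have "\<dots> = of_nat d *s y 0" using d by (simp add: sum.delta)
  finally have "y 0 = 0" using d by simp
  then show ?thesis by (simp add: y_def C_def vec_eq_iff)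
qed

text \<open>The difference of the two powers of \<open>T\<close> is injective: after cancelling the
  lower power, a vector in its kernel is fixed by a power of \<open>T\<close>, hence 0. It maps the
  collision points into the countable lattice.\<close>

lemma countable_early_collisions:
  fixes A :: "int ^ 'n ^ 'n"
  assumes hyp: "\<And>(c :: complex) v. v \<noteq> 0 \<Longrightarrow> map_matrix of_int A *v v = c *s v \<Longrightarrow> cmod c \<noteq> 1"
    and det: "\<bar>det A\<bar> = 1"
  defines "T \<equiv> (*v) (map_matrix of_int A :: real ^ 'n ^ 'n)"
  shows "countable {x. \<exists>i j. i < j \<and> j \<le> N \<and> torus_of ((T ^^ i) x) = torus_of ((T ^^ j) x)}"
proof -
  have "det (map_matrix of_int A :: real ^ 'n ^ 'n) \<noteq> 0"
    using det by (auto simp: det_map_matrix_of_int)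
  then have "inj T"
    unfolding T_def by (metis inj_matrix_vector_mult invertible_det_nz)
  have lin: "linear (T ^^ i)" for i
    unfolding T_def by (intro bounded_linear.linear bounded_linear_matrix_funpow)
  have "countable {x. torus_of ((T ^^ i) x) = torus_of ((T ^^ j) x)}" if "i < j" for i j
  proof -
    define D where "D x = (T ^^ i) x - (T ^^ j) x" for x
    have "linear D" unfolding D_def by (intro linear_compose_sub lin)
    have "inj D"
      unfolding linear_injective_0[OF \<open>linear D\<close>]
    proof (intro allI impI)
      fix v assume "D v = 0"
      then have "(T ^^ i) v = (T ^^ i) ((T ^^ (j - i)) v)"
        using that by (simp add: D_def flip: funpow_add[THEN fun_cong, unfolded o_def])
      then have "(T ^^ (j - i)) v = v"
        using inj_fn[OF \<open>inj T\<close>, of i] by (metis injD)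
      then show "v = 0"
        using hyperbolic_fixed_vector[of A "j - i" v, OF hyp] that by (simp add: T_def)
    qed
    have "D ` {x. torus_of ((T ^^ i) x) = torus_of ((T ^^ j) x)} \<subseteq> int_lattice"
      by (auto simp: D_def torus_of_eq_iff)
    then have "countable (D ` {x. torus_of ((T ^^ i) x) = torus_of ((T ^^ j) x)})"
      using countable_int_lattice by (rule countable_subset)
    then show ?thesis
      by (rule countable_image_inj_on) (use \<open>inj D\<close> in \<open>auto intro: inj_on_subset\<close>)
  qed
  then have "countable (\<Union>i. \<Union>j\<in>{i<..}. {x. torus_of ((T ^^ i) x) = torus_of ((T ^^ j) x)})"
    by (intro countable_UN) auto
  then show ?thesis by (rule countable_subset[rotated]) auto
qed

section \<open>Convergence together with derivatives\<close>

text \<open>The derivatives are explicit data with values in bounded linear maps, so that second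
  order convergence is first order convergence twice. Boundedness of the limits is what makes
  products of uniformly convergent sequences converge uniformly.\<close>

definition C1_conv ::
    "(nat \<Rightarrow> 'a::real_normed_vector \<Rightarrow> 'b::real_normed_vector) \<Rightarrow> (nat \<Rightarrow> 'a \<Rightarrow> 'a \<Rightarrow>\<^sub>L 'b) \<Rightarrow>
      ('a \<Rightarrow> 'b) \<Rightarrow> ('a \<Rightarrow> 'a \<Rightarrow>\<^sub>L 'b) \<Rightarrow> bool"
  where "C1_conv G G' g g' \<longleftrightarrow>
    (\<forall>i x. (G i has_derivative blinfun_apply (G' i x)) (at x)) \<and>
    (\<forall>x. (g has_derivative blinfun_apply (g' x)) (at x)) \<and>
    (\<forall>i. continuous_on UNIV (G' i)) \<and> continuous_on UNIV g' \<and>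
    uniform_limit UNIV G g sequentially \<and> uniform_limit UNIV G' g' sequentially \<and>
    bounded (range g) \<and> bounded (range g')"

definition C2_conv ::
    "(nat \<Rightarrow> 'a::real_normed_vector \<Rightarrow> 'b::real_normed_vector) \<Rightarrow> ('a \<Rightarrow> 'b) \<Rightarrow> bool"
  where "C2_conv G g \<longleftrightarrow> (\<exists>G' G'' g' g''. C1_conv G G' g g' \<and> C1_conv G' G'' g' g'')"

lemma C1_conv_continuous:
  assumes "C1_conv G G' g g'"
  shows "continuous_on S (G i)" "continuous_on S g"
  using assms unfolding C1_conv_def
  by (meson continuous_at_imp_continuous_on has_derivative_continuous)+

context bounded_bilinear
begin

text \<open>With \<open>blin_left\<close>, the two halves of the product rule for
  \<open>prod\<close>. As bounded bilinear maps of the factors and their derivatives they allow the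
  product rule to be applied a second time.\<close>

definition blin_right :: "'a \<Rightarrow> ('d::real_normed_vector \<Rightarrow>\<^sub>L 'b) \<Rightarrow> 'd \<Rightarrow>\<^sub>L 'c"
  where "blin_right y T = Blinfun (\<lambda>v. prod y (T v))"

definition blin_left :: "('d::real_normed_vector \<Rightarrow>\<^sub>L 'a) \<Rightarrow> 'b \<Rightarrow> 'd \<Rightarrow>\<^sub>L 'c"
  where "blin_left T z = Blinfun (\<lambda>v. prod (T v) z)"

lemma blin_right_apply: "blinfun_apply (blin_right y T) v = prod y (blinfun_apply T v)"
  unfolding blin_right_def
  by (subst bounded_linear_Blinfun_apply) (auto intro: bounded_linear_compose[OF bounded_linear_right] blinfun.bounded_linear_right)

lemma blin_left_apply: "blinfun_apply (blin_left T z) v = prod (blinfun_apply T v) z"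
  unfolding blin_left_def
  by (subst bounded_linear_Blinfun_apply) (auto intro: bounded_linear_compose[OF bounded_linear_left] blinfun.bounded_linear_right)

lemma bounded_bilinear_blin_right:
  "bounded_bilinear (blin_right :: 'a \<Rightarrow> ('d::real_normed_vector \<Rightarrow>\<^sub>L 'b) \<Rightarrow> 'd \<Rightarrow>\<^sub>L 'c)"
proof
  show "\<exists>K. \<forall>a. \<forall>b :: 'd \<Rightarrow>\<^sub>L 'b. norm (blin_right a b) \<le> norm a * norm b * K"
  proof -
    obtain K where K: "K \<ge> 0" "\<And>a b. norm (prod a b) \<le> norm a * norm b * K"
      using nonneg_bounded by blast
    have b: "norm (blin_right a b) \<le> norm a * norm b * K" for a and b :: "'d \<Rightarrow>\<^sub>L 'b"
    proof (rule norm_blinfun_bound)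
      fix x
      have "norm (prod a (b x)) \<le> norm a * norm (b x) * K" by (rule K)
      also have "\<dots> \<le> norm a * (norm b * norm x) * K"
        using K(1) by (intro mult_right_mono mult_left_mono norm_blinfun) auto
      finally show "norm (blin_right a b x) \<le> norm a * norm b * K * norm x"
        by (simp add: blin_right_apply mult_ac)
    qed (use K in auto)
    show ?thesis by (intro exI[of _ K] allI b)
  qed
qed (auto intro!: blinfun_eqI simp: blin_right_apply blinfun.add_left blinfun.scaleR_left
    add_left add_right scaleR_left scaleR_right)

lemma bounded_bilinear_blin_left:
  "bounded_bilinear (blin_left :: ('d::real_normed_vector \<Rightarrow>\<^sub>L 'a) \<Rightarrow> 'b \<Rightarrow> 'd \<Rightarrow>\<^sub>L 'c)"
proof
  show "\<exists>K. \<forall>a :: 'd \<Rightarrow>\<^sub>L 'a. \<forall>b. norm (blin_left a b) \<le> norm a * norm b * K"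
  proof -
    obtain K where K: "K \<ge> 0" "\<And>a b. norm (prod a b) \<le> norm a * norm b * K"
      using nonneg_bounded by blast
    have b: "norm (blin_left a b) \<le> norm a * norm b * K" for a :: "'d \<Rightarrow>\<^sub>L 'a" and b
    proof (rule norm_blinfun_bound)
      fix x
      have "norm (prod (a x) b) \<le> norm (a x) * norm b * K" by (rule K)
      also have "\<dots> \<le> (norm a * norm x) * norm b * K"
        using K(1) by (intro mult_right_mono norm_blinfun) auto
      finally show "norm (blin_left a b x) \<le> norm a * norm b * K * norm x"
        by (simp add: blin_left_apply mult_ac)
    qed (use K in auto)
    show ?thesis by (intro exI[of _ K] allI b)
  qed
qed (auto intro!: blinfun_eqI simp: blin_left_apply blinfun.add_left blinfun.scaleR_left
    add_left add_right scaleR_left scaleR_right)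

lemma bounded_range_prod:
  assumes "bounded (range g)" "bounded (range h)"
  shows "bounded (range (\<lambda>x. prod (g x) (h x)))"
proof -
  obtain K where K: "K \<ge> 0" "\<And>a b. norm (prod a b) \<le> norm a * norm b * K"
    using nonneg_bounded by blast
  obtain b c where bc: "\<And>x. norm (g x) \<le> b" "\<And>x. norm (h x) \<le> c"
    using assms by (auto simp: bounded_iff)
  have "norm (prod (g x) (h x)) \<le> b * c * K" for x
    using K(1) bc order_trans[OF norm_ge_zero bc(1)[of x]]
    by (intro order_trans[OF K(2)] mult_right_mono mult_mono) auto
  then show ?thesis by (auto simp: bounded_iff)
qed

end

lemma C1_conv_add:
  assumes "C1_conv G G' g g'" "C1_conv H H' h h'"
  shows "C1_conv (\<lambda>i x. G i x + H i x) (\<lambda>i x. G' i x + H' i x) (\<lambda>x. g x + h x) (\<lambda>x. g' x + h' x)"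
  using assms unfolding C1_conv_def plus_blinfun.rep_eq
  by (auto intro!: has_derivative_add continuous_on_add uniform_limit_add bounded_plus_comp)

lemma C1_conv_bilinear:
  assumes B: "bounded_bilinear B" and G: "C1_conv G G' g g'" and H: "C1_conv H H' h h'"
  shows "C1_conv (\<lambda>i x. B (G i x) (H i x))
    (\<lambda>i x. bounded_bilinear.blin_right B (G i x) (H' i x) + bounded_bilinear.blin_left B (G' i x) (H i x))
    (\<lambda>x. B (g x) (h x))
    (\<lambda>x. bounded_bilinear.blin_right B (g x) (h' x) + bounded_bilinear.blin_left B (g' x) (h x))"
proof -
  interpret bounded_bilinear B by fact
  interpret r: bounded_bilinear "blin_right :: _ \<Rightarrow> ('d \<Rightarrow>\<^sub>L 'b) \<Rightarrow> _" by (rule bounded_bilinear_blin_right)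
  interpret l: bounded_bilinear "blin_left :: ('d \<Rightarrow>\<^sub>L 'a) \<Rightarrow> _ \<Rightarrow> _" by (rule bounded_bilinear_blin_left)
  have d: "((\<lambda>x. B (a x) (b x)) has_derivative blinfun_apply (blin_right (a x) b' + blin_left a' (b x))) (at x)"
    if "(a has_derivative blinfun_apply a') (at x)" "(b has_derivative blinfun_apply b') (at x)" for a b a' b' x
    using FDERIV[OF that] by (simp add: plus_blinfun.rep_eq blin_right_apply blin_left_apply)
  note cont = C1_conv_continuous[OF G] C1_conv_continuous[OF H]
  have "continuous_on UNIV (\<lambda>x. blin_right (G i x) (H' i x) + blin_left (G' i x) (H i x))" for i
    using G H by (intro continuous_on_add r.continuous_on l.continuous_on cont) (auto simp: C1_conv_def)
  moreover have "continuous_on UNIV (\<lambda>x. blin_right (g x) (h' x) + blin_left (g' x) (h x))"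
    using G H by (intro continuous_on_add r.continuous_on l.continuous_on cont) (auto simp: C1_conv_def)
  moreover have "uniform_limit UNIV (\<lambda>i x. blin_right (G i x) (H' i x) + blin_left (G' i x) (H i x))
      (\<lambda>x. blin_right (g x) (h' x) + blin_left (g' x) (h x)) sequentially"
    using G H by (intro uniform_limit_add r.bounded_uniform_limit l.bounded_uniform_limit) (auto simp: C1_conv_def)
  moreover have "uniform_limit UNIV (\<lambda>i x. B (G i x) (H i x)) (\<lambda>x. B (g x) (h x)) sequentially"
    using G H by (intro bounded_uniform_limit) (auto simp: C1_conv_def)
  moreover have "bounded (range (\<lambda>x. B (g x) (h x)))"
    using G H by (intro bounded_range_prod) (auto simp: C1_conv_def)
  moreover have "bounded (range (\<lambda>x. blin_right (g x) (h' x) + blin_left (g' x) (h x)))"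
    using G H by (intro bounded_plus_comp r.bounded_range_prod l.bounded_range_prod) (auto simp: C1_conv_def)
  ultimately show ?thesis
    using G H unfolding C1_conv_def by (auto intro!: d)
qed

text \<open>The first derivative is a sum of two bilinear expressions, to each of which
  \<open>C1_conv_bilinear\<close> applies again.\<close>

lemma C2_conv_bilinear:
  assumes B: "bounded_bilinear B" and G: "C2_conv G g" and H: "C2_conv H h"
  shows "C2_conv (\<lambda>i x. B (G i x) (H i x)) (\<lambda>x. B (g x) (h x))"
proof -
  obtain G' G'' g' g'' where G: "C1_conv G G' g g'" "C1_conv G' G'' g' g''"
    using G by (auto simp: C2_conv_def)
  obtain H' H'' h' h'' where H: "C1_conv H H' h h'" "C1_conv H' H'' h' h''"
    using H by (auto simp: C2_conv_def)
  show ?thesis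
    unfolding C2_conv_def
    by (intro exI conjI, rule C1_conv_bilinear[OF B G(1) H(1)])
      (rule C1_conv_add[OF C1_conv_bilinear[OF bounded_bilinear.bounded_bilinear_blin_right[OF B] G(1) H(2)]
          C1_conv_bilinear[OF bounded_bilinear.bounded_bilinear_blin_left[OF B] G(2) H(1)]])
qed

lemma C2_conv_add:
  assumes G: "C2_conv G g" and H: "C2_conv H h"
  shows "C2_conv (\<lambda>i x. G i x + H i x) (\<lambda>x. g x + h x)"
proof -
  obtain G' G'' g' g'' where G: "C1_conv G G' g g'" "C1_conv G' G'' g' g''"
    using G by (auto simp: C2_conv_def)
  obtain H' H'' h' h'' where H: "C1_conv H H' h h'" "C1_conv H' H'' h' h''"
    using H by (auto simp: C2_conv_def)
  show ?thesis
    unfolding C2_conv_def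
    by (intro exI conjI, rule C1_conv_add[OF G(1) H(1)]) (rule C1_conv_add[OF G(2) H(2)])
qed

lemma C1_conv_const:
  assumes "c \<longlonglongrightarrow> d"
  shows "C1_conv (\<lambda>i _. c i) (\<lambda>_ _. 0) (\<lambda>_. d) (\<lambda>_. 0)"
  using assms by (auto simp: C1_conv_def uniform_limit_const zero_blinfun.rep_eq uniform_limit_iff tendsto_iff)

lemma C2_conv_const: "c \<longlonglongrightarrow> d \<Longrightarrow> C2_conv (\<lambda>i _. c i) (\<lambda>_. d)"
  unfolding C2_conv_def
  by (intro exI conjI, erule C1_conv_const) (rule C1_conv_const[OF tendsto_const])

lemma C2_conv_sum:
  assumes "\<And>m. m \<in> I \<Longrightarrow> C2_conv (G m) (g m)"
  shows "C2_conv (\<lambda>i x. \<Sum>m\<in>I. G m i x) (\<lambda>x. \<Sum>m\<in>I. g m x)"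
  using assms
  by (induction I rule: infinite_finite_induct) (auto intro!: C2_conv_add C2_conv_const[where c = "\<lambda>_. 0"])

text \<open>On the compact set \<open>S\<close> the outer function and its derivative are uniformly
  continuous and bounded, so composition preserves uniform convergence.\<close>

lemma C1_conv_compose:
  fixes r :: "real \<Rightarrow> real"
  assumes G: "C1_conv G G' g g'" and S: "compact S" "\<And>i x. G i x \<in> S" "\<And>x. g x \<in> S"
    and r: "\<And>y. y \<in> S \<Longrightarrow> (r has_real_derivative r' y) (at y)" and r': "continuous_on S r'"
  shows "C1_conv (\<lambda>i x. r (G i x)) (\<lambda>i x. r' (G i x) *\<^sub>R G' i x) (\<lambda>x. r (g x)) (\<lambda>x. r' (g x) *\<^sub>R g' x)"
proof -
  have rc: "continuous_on S r"
    using r by (meson DERIV_isCont continuous_at_imp_continuous_on)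
  have d: "((\<lambda>x. r (a x)) has_derivative blinfun_apply (r' (a x) *\<^sub>R a')) (at x)"
    if "(a has_derivative blinfun_apply a') (at x)" "a x \<in> S" for a a' x
    using has_derivative_compose[OF that(1) r[OF that(2), unfolded has_field_derivative_def]]
    by (simp add: scaleR_blinfun.rep_eq)
  have ul: "uniform_limit UNIV (\<lambda>i x. q (G i x)) (\<lambda>x. q (g x)) sequentially" if "continuous_on S q" for q :: "real \<Rightarrow> real"
    by (rule uniform_limit_compose_uniformly_continuous_on[of _ _ _ _ S])
      (use G S that in \<open>auto simp: C1_conv_def compact_uniformly_continuous compact_imp_closed\<close>)
  have bd: "bounded (range (\<lambda>x. q (g x)))" if "continuous_on S q" for q :: "real \<Rightarrow> real"
    using compact_imp_bounded[OF compact_continuous_image[OF that S(1)]]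
    by (rule bounded_subset) (use S(3) in auto)
  note cont = C1_conv_continuous[OF G]
  have "continuous_on UNIV (\<lambda>x. r' (G i x) *\<^sub>R G' i x)" for i
    using G S(2) by (intro continuous_on_scaleR continuous_on_compose2[OF r' cont(1)]) (auto simp: C1_conv_def)
  moreover have "continuous_on UNIV (\<lambda>x. r' (g x) *\<^sub>R g' x)"
    using G S(3) by (intro continuous_on_scaleR continuous_on_compose2[OF r' cont(2)]) (auto simp: C1_conv_def)
  moreover have "uniform_limit UNIV (\<lambda>i x. r' (G i x) *\<^sub>R G' i x) (\<lambda>x. r' (g x) *\<^sub>R g' x) sequentially"
    using G by (intro bounded_bilinear.bounded_uniform_limit[OF bounded_bilinear_scaleR] ul bd r') (auto simp: C1_conv_def)
  moreover have "bounded (range (\<lambda>x. r' (g x) *\<^sub>R g' x))"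
    using G by (intro bounded_bilinear.bounded_range_prod[OF bounded_bilinear_scaleR] bd r') (auto simp: C1_conv_def)
  ultimately show ?thesis
    using G S ul[OF rc] bd[OF rc] unfolding C1_conv_def by (auto intro!: d)
qed

lemma C2_conv_compose:
  fixes r :: "real \<Rightarrow> real"
  assumes G: "C2_conv G g" and S: "compact S" "\<And>i x. G i x \<in> S" "\<And>x. g x \<in> S"
    and r: "\<And>y. y \<in> S \<Longrightarrow> (r has_real_derivative r' y) (at y)"
      "\<And>y. y \<in> S \<Longrightarrow> (r' has_real_derivative r'' y) (at y)" "continuous_on S r''"
  shows "C2_conv (\<lambda>i x. r (G i x)) (\<lambda>x. r (g x))"
proof -
  obtain G' G'' g' g'' where G: "C1_conv G G' g g'" "C1_conv G' G'' g' g''"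
    using G by (auto simp: C2_conv_def)
  have r'c: "continuous_on S r'"
    using r(2) by (meson DERIV_isCont continuous_at_imp_continuous_on)
  show ?thesis
    unfolding C2_conv_def
    using C1_conv_compose[OF G(1) S r(1) r'c]
      C1_conv_bilinear[OF bounded_bilinear_scaleR C1_conv_compose[OF G(1) S r(2,3)] G(2)] by blast
qed

lemma C2_conv_shift:
  assumes "C2_conv G g"
  shows "C2_conv (\<lambda>i. G (i + n)) g"
proof -
  have "C1_conv (\<lambda>i. G (i + n)) (\<lambda>i. G' (i + n)) g g'" if "C1_conv G G' g g'"
    for G :: "nat \<Rightarrow> 'c::real_normed_vector \<Rightarrow> 'd::real_normed_vector" and G' g g'
    using that unfolding C1_conv_def by (auto intro: filterlim_compose[OF _ filterlim_add_const_nat_at_top])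
  note shift = this
  obtain G' G'' g' g'' where G: "C1_conv G G' g g'" "C1_conv G' G'' g' g''"
    using assms by (auto simp: C2_conv_def)
  show ?thesis
    unfolding C2_conv_def
    by (intro exI conjI, rule shift[OF G(1)]) (rule shift[OF G(2)])
qed

text \<open>The inverse norm is 1/sqrt of the inner product, which takes values in an interval away
  from 0 where this function is smooth. The limit has norm 1 and is unchanged by
  normalization.\<close>

lemma C2_conv_inverse_norm:
  fixes G :: "nat \<Rightarrow> 'a::real_normed_vector \<Rightarrow> 'b::real_inner"
  assumes G: "C2_conv G g" and norm: "\<And>i x. (norm (G i x))\<^sup>2 \<in> {1/2..2}" "\<And>x. norm (g x) = 1"
  shows "C2_conv (\<lambda>i x. G i x /\<^sub>R norm (G i x)) g"
proof -
  have N: "C2_conv (\<lambda>i x. G i x \<bullet> G i x) (\<lambda>x. g x \<bullet> g x)"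
    by (rule C2_conv_bilinear[OF bounded_bilinear_inner G G])
  have "C2_conv (\<lambda>i x. 1 / sqrt (G i x \<bullet> G i x)) (\<lambda>x. 1 / sqrt (g x \<bullet> g x))"
  proof (rule C2_conv_compose[OF N, where S = "{1/2..2}" and r = "\<lambda>y. 1 / sqrt y"
        and r' = "\<lambda>y. - (1 / (2 * (y * sqrt y)))" and r'' = "\<lambda>y. 3 / (4 * (y * y * sqrt y))"])
    fix y :: real assume y: "y \<in> {1/2..2}"
    have s: "sqrt y * sqrt y = y" "sqrt y > 0" using y by auto
    have "((\<lambda>y. 1 / sqrt y) has_real_derivative - (inverse (sqrt y) / 2) / (sqrt y * sqrt y)) (at y)"
      using y by (auto intro!: derivative_eq_intros)
    moreover have "- (inverse (sqrt y) / 2) / (sqrt y * sqrt y) = - (1 / (2 * (y * sqrt y)))"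
      using s y by (simp add: field_simps)
    ultimately show "((\<lambda>y. 1 / sqrt y) has_real_derivative - (1 / (2 * (y * sqrt y)))) (at y)" by simp
    have "((\<lambda>y. - (1 / (2 * (y * sqrt y)))) has_real_derivative
        (2 * (sqrt y + y * (inverse (sqrt y) / 2))) / ((2 * (y * sqrt y)) * (2 * (y * sqrt y)))) (at y)"
      using y by (auto intro!: derivative_eq_intros simp: add_divide_distrib diff_divide_distrib)
    moreover have "(2 * (sqrt y + y * (inverse (sqrt y) / 2))) / ((2 * (y * sqrt y)) * (2 * (y * sqrt y))) = 3 / (4 * (y * y * sqrt y))"
    proof -
      define q where "q = sqrt y"
      have "y = q * q" "q > 0" using s by (simp_all add: q_def)
      then show ?thesis unfolding q_def[symmetric] by (simp add: field_simps)
    qed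
    ultimately show "((\<lambda>y. - (1 / (2 * (y * sqrt y)))) has_real_derivative 3 / (4 * (y * y * sqrt y))) (at y)" by simp
  next
    show "continuous_on {1/2..2::real} (\<lambda>y. 3 / (4 * (y * y * sqrt y)))"
      by (intro continuous_intros) auto
  qed (use norm in \<open>auto simp: power2_norm_eq_inner norm_eq_1\<close>)
  then have "C2_conv (\<lambda>i x. (1 / sqrt (G i x \<bullet> G i x)) *\<^sub>R G i x) (\<lambda>x. (1 / sqrt (g x \<bullet> g x)) *\<^sub>R g x)"
    by (rule C2_conv_bilinear[OF bounded_bilinear_scaleR _ G])
  moreover have "sqrt (g x \<bullet> g x) = 1" for x
    using norm(2)[of x] by (simp add: norm_eq_sqrt_inner)
  ultimately show ?thesis
    by (simp add: norm_eq_sqrt_inner[symmetric] inverse_eq_divide)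
qed

lemma blinfun_derivative_eq:
  assumes "(g has_derivative blinfun_apply D) (at x)"
  shows "blinfun_derivative g x = D"
  unfolding blinfun_derivative_def frechet_derivative_at[OF assms, symmetric] blinfun_apply_inverse ..

lemma C2_conv_derivatives:
  assumes "C1_conv G G' g g'" "C1_conv G' G'' g' g''"
  shows "C2_map (G i)" "C2_map g"
    and "blinfun_derivative (G i) = G' i" "blinfun_derivative g = g'"
    and "blinfun_derivative (blinfun_derivative (G i)) = G'' i" "blinfun_derivative (blinfun_derivative g) = g''"
proof -
  show 1: "blinfun_derivative (G i) = G' i" "blinfun_derivative g = g'"
    using assms(1) by (auto simp: C1_conv_def intro!: blinfun_derivative_eq)
  show 2: "blinfun_derivative (blinfun_derivative (G i)) = G'' i" "blinfun_derivative (blinfun_derivative g) = g''"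
    using assms(2) unfolding 1 by (auto simp: C1_conv_def intro!: blinfun_derivative_eq)
  show "C2_map (G i)" "C2_map g"
    using assms unfolding C2_map_def 2 unfolding 1 C1_conv_def differentiable_def by blast+
qed

lemma C2_conv_C2_field:
  assumes "V \<in> C2_fields"
  shows "C2_conv (\<lambda>_. lift_field V) (lift_field V)"
proof -
  have der: "(g has_derivative blinfun_apply (blinfun_derivative g x)) (at x)" if "g differentiable at x"
    for g :: "'c::real_normed_vector \<Rightarrow> 'd::real_normed_vector" and x
    using that frechet_derivative_works has_derivative_bounded_linear
    by (metis blinfun_derivative_def bounded_linear_Blinfun_apply)
  have C2: "C2_map (lift_field V)" using assms by (simp add: C2_fields_def)
  then have "continuous_on UNIV (blinfun_derivative (lift_field V))"
    unfolding C2_map_def by (meson continuous_at_imp_continuous_on differentiable_imp_continuous_within)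
  then show ?thesis
    unfolding C2_conv_def
    using C2 bounded_C2_field[OF assms]
    by (intro exI[of _ "\<lambda>_. blinfun_derivative (lift_field V)"] exI[of _ "\<lambda>_. blinfun_derivative (blinfun_derivative (lift_field V))"]
        exI[of _ "blinfun_derivative (lift_field V)"] exI[of _ "blinfun_derivative (blinfun_derivative (lift_field V))"])
      (auto simp: C1_conv_def C2_map_def uniform_limit_const intro!: der)
qed

lemma C2_conv_C2_dist:
  fixes V :: "'n::finite vector_field"
  assumes "C2_conv (\<lambda>i. lift_field (W i)) (lift_field V)"
  shows "W i \<in> C2_fields" "V \<in> C2_fields" "(\<lambda>i. C2_dist (W i) V) \<longlonglongrightarrow> 0"
proof -
  obtain G' G'' g' g'' where G: "C1_conv (\<lambda>i. lift_field (W i)) G' (lift_field V) g'" "C1_conv G' G'' g' g''"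
    using assms by (auto simp: C2_conv_def)
  note d = C2_conv_derivatives[OF G]
  show W: "W i \<in> C2_fields" and V: "V \<in> C2_fields" for i using d by (auto simp: C2_fields_def)
  have lim: "(\<lambda>i. sup_dist (F i) h) \<longlonglongrightarrow> 0"
    if "uniform_limit UNIV F h sequentially" for F :: "nat \<Rightarrow> 'x \<Rightarrow> 'y::metric_space" and h
  proof (rule metric_LIMSEQ_I)
    fix e :: real assume "e > 0"
    then have "\<forall>\<^sub>F i in sequentially. \<forall>x. dist (F i x) (h x) < e / 2"
      using uniform_limitD[OF that, of "e / 2"] by simp
    then obtain n where n: "\<And>i x. i \<ge> n \<Longrightarrow> dist (F i x) (h x) < e / 2"
      by (auto simp: eventually_sequentially)
    have "dist (sup_dist (F i) h) 0 < e" if "i \<ge> n" for i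
    proof -
      have "sup_dist (F i) h \<le> e / 2"
        unfolding sup_dist_def using n[OF that] by (intro cSUP_least) (auto simp: less_imp_le)
      moreover have "0 \<le> sup_dist (F i) h"
      proof -
        have "bdd_above (range (\<lambda>x. dist (F i x) (h x)))"
          using n[OF that] by (intro bdd_aboveI[of _ "e / 2"]) (auto simp: less_imp_le)
        from cSUP_upper[OF UNIV_I this] have "dist (F i undefined) (h undefined) \<le> (SUP x. dist (F i x) (h x))" .
        then show ?thesis
          unfolding sup_dist_def using zero_le_dist[of "F i undefined" "h undefined"] by linarith
      qed
      ultimately show ?thesis using \<open>e > 0\<close> by simp
    qed
    then show "\<exists>no. \<forall>n\<ge>no. dist (sup_dist (F n) h) 0 < e" by blast
  qed
  have "(\<lambda>i. sup_dist (lift_field (W i)) (lift_field V) + sup_dist (G' i) g' + sup_dist (G'' i) g'') \<longlonglongrightarrow> 0 + 0 + 0"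
    using G by (intro tendsto_add lim) (auto simp: C1_conv_def)
  then show "(\<lambda>i. C2_dist (W i) V) \<longlonglongrightarrow> 0"
    using W V by (simp add: C2_dist_def d(3,4) d(5,6)[unfolded d(3,4)])
qed

section \<open>Periodic bump functions\<close>

lemma C1_conv_trig:
  fixes a :: "'a::real_inner"
  shows "C1_conv (\<lambda>_ x. sin (a \<bullet> x + c)) (\<lambda>_ x. cos (a \<bullet> x + c) *\<^sub>R blinfun_inner_left a) (\<lambda>x. sin (a \<bullet> x + c)) (\<lambda>x. cos (a \<bullet> x + c) *\<^sub>R blinfun_inner_left a)"
proof -
  have "((\<lambda>x. sin (a \<bullet> x + c)) has_derivative blinfun_apply (cos (a \<bullet> x + c) *\<^sub>R blinfun_inner_left a)) (at x)" for x
    by (auto intro!: derivative_eq_intros simp: scaleR_blinfun.rep_eq blinfun_inner_left.rep_eq inner_commute mult_ac)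
  moreover have "norm (cos (a \<bullet> x + c) *\<^sub>R blinfun_inner_left a) \<le> 1 * norm (blinfun_inner_left a)" for x
    unfolding norm_scaleR by (intro mult_right_mono) auto
  ultimately show ?thesis
    unfolding C1_conv_def
    by (auto intro!: uniform_limit_const continuous_intros simp: bounded_iff intro: exI[of _ 1])
qed

text \<open>Written as shifted sines, the cosine and its derivative fall under the same lemma
  \<open>C1_conv_trig\<close>.\<close>

lemma C2_conv_cos:
  fixes a :: "'a::real_inner"
  shows "C2_conv (\<lambda>_ x. cos (a \<bullet> x + c)) (\<lambda>x. cos (a \<bullet> x + c))"
proof -
  have eq: "cos (a \<bullet> x + c) = sin (a \<bullet> x + (c + pi / 2))" for x
    using sin_add[of "a \<bullet> x + c" "pi / 2"] by (simp add: add.assoc)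
  have eq2: "cos (a \<bullet> x + (c + pi / 2)) = sin (a \<bullet> x + (c + pi))" for x
    using cos_add[of "a \<bullet> x + c" "pi / 2"] sin_add[of "a \<bullet> x + c" pi] by (simp add: add.assoc)
  show ?thesis
    unfolding C2_conv_def eq
    by (intro exI conjI, rule C1_conv_trig, unfold eq2)
      (rule C1_conv_bilinear[OF bounded_bilinear_scaleR C1_conv_trig C1_conv_const[OF tendsto_const]])
qed

text \<open>Away from 0 this is a power or constant; at 0 the difference quotient is bounded by
  |h|^(n+1). The shift by 2 excludes the exponent 1, where there is a corner.\<close>

lemma DERIV_positive_part_power:
  "((\<lambda>y::real. max 0 y ^ (n + 2)) has_real_derivative (of_nat (n + 2) * max 0 y ^ (n + 1))) (at y)"
proof (cases "y = 0")
  case True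
  have "((\<lambda>h::real. max 0 h ^ (n + 2) / h) \<longlongrightarrow> 0) (at 0)"
  proof (rule Lim_null_comparison)
    show "\<forall>\<^sub>F h in at 0. norm (max 0 h ^ (n + 2) / h) \<le> \<bar>h\<bar> ^ (n + 1)"
    proof (rule always_eventually, intro allI)
      fix h :: real
      show "norm (max 0 h ^ (n + 2) / h) \<le> \<bar>h\<bar> ^ (n + 1)"
      proof (cases "h > 0")
        case False
        then have "norm (max 0 h ^ (n + 2) / h) = 0" by (simp add: max_absorb1)
        also have "\<dots> \<le> \<bar>h\<bar> ^ (n + 1)" by (intro zero_le_power abs_ge_zero)
        finally show ?thesis .
      qed simp
    qed
    have "((\<lambda>h::real. \<bar>h\<bar> ^ (n + 1)) \<longlongrightarrow> \<bar>0\<bar> ^ (n + 1)) (at 0)"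
      by (intro tendsto_intros)
    then show "((\<lambda>h::real. \<bar>h\<bar> ^ (n + 1)) \<longlongrightarrow> 0) (at 0)" by simp
  qed
  then show ?thesis using True by (simp add: DERIV_def)
next
  case False
  show ?thesis
  proof (cases "y > 0")
    case True
    have "((\<lambda>y. y ^ (n + 2)) has_real_derivative (of_nat (n + 2) * y ^ (n + 1))) (at y)"
      using DERIV_pow[of "n + 2" y UNIV] by simp
    then have "((\<lambda>y::real. max 0 y ^ (n + 2)) has_real_derivative (of_nat (n + 2) * y ^ (n + 1))) (at y)"
      by (rule has_field_derivative_transform_within_open[of _ _ _ "{0<..}"]) (use True in \<open>auto simp: max_def\<close>)
    then show ?thesis using True by simp
  next
    case False
    then have "y < 0" using \<open>y \<noteq> 0\<close> by simp
    have "((\<lambda>y::real. max 0 y ^ (n + 2)) has_real_derivative 0) (at y)"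
      by (rule has_field_derivative_transform_within_open[of "\<lambda>_. 0" _ _ "{..<0}"]) (use \<open>y < 0\<close> in \<open>auto simp: max_def\<close>)
    then show ?thesis using \<open>y < 0\<close> by simp
  qed
qed

text \<open>A smooth, lattice-periodic substitute for the squared distance on the torus: it vanishes
  exactly on the lattice translates of \<open>p\<close>.\<close>

definition torus_gap :: "real ^ 'n \<Rightarrow> real ^ 'n \<Rightarrow> real"
  where "torus_gap p x = (\<Sum>i\<in>UNIV. 1 - cos (2 * pi * (x $ i - p $ i)))"

text \<open>The cube is the lowest integer power of the positive part with a continuous second
  derivative.\<close>

definition bump :: "real ^ 'n \<Rightarrow> real \<Rightarrow> real ^ 'n \<Rightarrow> real"
  where "bump p a x = max 0 (a - torus_gap p x) ^ 3"

lemma torus_gap_eq_0_iff: "torus_gap p x = 0 \<longleftrightarrow> torus_of x = torus_of p"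
proof -
  have "torus_gap p x = 0 \<longleftrightarrow> (\<forall>i. cos (2 * pi * (x $ i - p $ i)) = 1)"
    unfolding torus_gap_def by (subst sum_nonneg_eq_0_iff) auto
  also have "\<dots> \<longleftrightarrow> (\<forall>i. x $ i - p $ i \<in> \<int>)"
  proof -
    have "cos (2 * pi * r) = 1 \<longleftrightarrow> r \<in> \<int>" for r :: real
      by (auto simp: cos_one_2pi_int Ints_def)
    then show ?thesis by simp
  qed
  finally show ?thesis by (simp add: torus_of_eq_iff int_lattice_def)
qed

lemma torus_gap_nonneg: "torus_gap p x \<ge> 0"
  unfolding torus_gap_def by (intro sum_nonneg) simp

lemma torus_gap_add_lattice:
  assumes "v \<in> int_lattice"
  shows "torus_gap p (x + v) = torus_gap p x"
  unfolding torus_gap_def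
proof (intro sum.cong refl)
  fix i
  obtain n where "v $ i = of_int n" using assms by (auto simp: int_lattice_def Ints_def)
  then have "2 * pi * ((x + v) $ i - p $ i) = 2 * pi * (x $ i - p $ i) + 2 * pi * of_int n"
    by (simp add: algebra_simps)
  moreover have "cos (y + 2 * pi * of_int n) = cos y" for y
    by (simp add: cos_add)
  ultimately show "1 - cos (2 * pi * ((x + v) $ i - p $ i)) = 1 - cos (2 * pi * (x $ i - p $ i))"
    by simp
qed

lemma C2_conv_torus_gap: "C2_conv (\<lambda>_. torus_gap p) (torus_gap (p :: real ^ 'n))"
proof -
  have t: "C2_conv (\<lambda>_ x. 1 + (- 1) * cos (2 * pi * (x $ i - p $ i))) (\<lambda>x :: real ^ 'n. 1 + (- 1) * cos (2 * pi * (x $ i - p $ i)))" for i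
  proof -
    have "2 * pi * (x $ i - p $ i) = axis i (2 * pi) \<bullet> x + (- (2 * pi * p $ i))" for x :: "real ^ 'n"
      by (simp add: inner_axis' algebra_simps)
    then show "C2_conv (\<lambda>_ x. 1 + (- 1) * cos (2 * pi * (x $ i - p $ i))) (\<lambda>x :: real ^ 'n. 1 + (- 1) * cos (2 * pi * (x $ i - p $ i)))"
      by (simp only:) (intro C2_conv_add C2_conv_const[OF tendsto_const] C2_conv_bilinear[OF bounded_bilinear_mult] C2_conv_cos)
  qed
  have "C2_conv (\<lambda>_ x. \<Sum>i\<in>UNIV. 1 + (- 1) * cos (2 * pi * (x $ i - p $ i))) (\<lambda>x :: real ^ 'n. \<Sum>i\<in>UNIV. 1 + (- 1) * cos (2 * pi * (x $ i - p $ i)))"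
    by (intro C2_conv_sum t)
  then show ?thesis
    by (simp add: torus_gap_def[abs_def])
qed

lemma C2_conv_bump: "C2_conv (\<lambda>_. bump p a) (bump (p :: real ^ 'n) a)"
proof -
  obtain M where M: "\<And>x. \<bar>torus_gap p x\<bar> \<le> M"
    using C2_conv_torus_gap[of p] by (auto simp: C2_conv_def C1_conv_def bounded_iff)
  have d: "((\<lambda>s. max 0 (a - s) ^ (n + 2)) has_real_derivative - (of_nat (n + 2) * max 0 (a - s) ^ (n + 1))) (at s)" for n s
  proof -
    have "((\<lambda>s. a - s) has_real_derivative -1) (at s)"
      by (auto intro!: derivative_eq_intros)
    from DERIV_chain2[where f = "\<lambda>y. max 0 y ^ (n + 2)" and g = "\<lambda>s. a - s", OF DERIV_positive_part_power this]
    show ?thesis by simp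
  qed
  have "C2_conv (\<lambda>_ x. max 0 (a - torus_gap p x) ^ (1 + 2)) (\<lambda>x. max 0 (a - torus_gap p x) ^ (1 + 2))"
  proof (rule C2_conv_compose[OF C2_conv_torus_gap, where S = "cball 0 M"])
    show "((\<lambda>s. max 0 (a - s) ^ (1 + 2)) has_real_derivative - (of_nat (1 + 2) * max 0 (a - s) ^ (1 + 1))) (at s)" for s
      by (rule d)
    show "((\<lambda>s. - (of_nat (1 + 2) * max 0 (a - s) ^ (1 + 1))) has_real_derivative 6 * max 0 (a - s)) (at s)" for s
      using DERIV_cmult[OF d[of 0 s], of "-3"] by (simp add: numeral_2_eq_2)
    show "continuous_on (cball 0 M) (\<lambda>s. 6 * max 0 (a - s))"
      by (intro continuous_intros)
  qed (use M in auto)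
  moreover have "1 + 2 = (3 :: nat)" by simp
  ultimately show ?thesis by (simp only: bump_def[abs_def])
qed

section \<open>Generic frames are spanning\<close>

lemma continuous_torus_gap: "continuous_on S (torus_gap p)"
  unfolding torus_gap_def[abs_def] by (intro continuous_intros)

lemma spanning_at_normalize:
  fixes g :: "real ^ 'n \<Rightarrow> real ^ 'n"
  assumes "spanning_at A N g x" "\<And>y. h y > 0"
  shows "spanning_at A N (\<lambda>y. h y *\<^sub>R g y) x"
proof -
  have "((*v) A ^^ m) (c *\<^sub>R y) = c *\<^sub>R ((*v) A ^^ m) y" for m c y
    by (rule linear_scale[OF bounded_linear.linear[OF bounded_linear_matrix_funpow]])
  then show ?thesis
    using assms by (simp add: spanning_at_def less_imp_neq[THEN not_sym])
qed

lemma vec_lambda_eq_sum_axis: "(\<chi> m. e m) = (\<Sum>m\<in>UNIV. e m *\<^sub>R axis m (1 :: real))"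
  by (simp add: vec_eq_iff axis_def if_distrib[of "\<lambda>r. _ * r"] cong: if_cong)

text \<open>
  The bumps at the first \<open>N\<close> images of \<open>x0\<close> have disjoint supports, so that near \<open>x0\<close> each
  parameter moves exactly one of the covectors' values. For a covector \<open>u\<close> with \<open>u $ l = 1\<close>, the
  parameters indexed by \<open>l\<close> for which \<open>u\<close> annihilates all vectors at a point near \<open>x0\<close> form the
  image of a \<open>2n\<close>-dimensional set in dimension \<open>2n + 1\<close>.
\<close>

lemma spanning_perturbation:
  fixes A :: "real ^ 'n ^ 'n" and idx :: "('n + 'n) option \<times> 'n \<Rightarrow> nat"
  defines "T \<equiv> (*v) A"
  assumes inj: "inj T"
    and idx: "inj idx" "\<And>z. idx z \<in> {1..N}"
    and x0: "\<And>i j. i < j \<Longrightarrow> j \<le> N \<Longrightarrow> torus_of ((T ^^ i) x0) \<noteq> torus_of ((T ^^ j) x0)"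
  obtains U a w where "open U" "x0 \<in> U"
    "\<And>g :: real ^ 'n \<Rightarrow> real ^ 'n. (\<And>x. g differentiable at x) \<Longrightarrow>
      \<exists>\<tau>. (\<forall>z. (\<lambda>i. \<tau> i z) \<longlonglongrightarrow> 0) \<and>
        (\<forall>i. \<forall>x\<in>U. spanning_at A N (\<lambda>y. g y + (\<Sum>z\<in>UNIV. (\<tau> i z * bump ((T ^^ idx z) x0) a y) *\<^sub>R w z)) x)"
proof -
  define p where "p z = (T ^^ idx z) x0" for z
  have lin: "linear (T ^^ m)" for m
    unfolding T_def by (intro bounded_linear.linear bounded_linear_matrix_funpow)
  have Tc: "continuous_on S (T ^^ m)" for m S
    by (rule linear_continuous_on) (simp add: T_def bounded_linear_matrix_funpow)
  have surj: "surj (T ^^ m)" for m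
    using linear_injective_imp_surjective[OF lin inj_fn[OF inj]] by simp
  \<comment> \<open>Pulled back through the remaining iterations, so that the perturbation arrives
    as a multiple of an axis vector and its pairing with \<open>u\<close> involves only the
    coordinate \<open>snd z\<close>.\<close>
  define w where "w z = inv (T ^^ (N - idx z)) (axis (snd z) 1)" for z
  have w: "(T ^^ (N - idx z)) (w z) = axis (snd z) 1" for z
    unfolding w_def by (rule surj_f_inv_f[OF surj])
  have pne: "torus_of (p z) \<noteq> torus_of (p z')" if "z \<noteq> z'" for z z'
  proof -
    have "idx z \<noteq> idx z'" using idx(1) that by (auto dest: injD)
    then show ?thesis
      using x0[of "idx z" "idx z'"] x0[of "idx z'" "idx z"] idx(2)[of z] idx(2)[of z']
      by (cases "idx z < idx z'") (auto simp: p_def)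
  qed
  \<comment> \<open>The gaps between distinct images of \<open>x0\<close> are finitely many positive
    numbers; a bump radius below all of them separates the images.\<close>
  define H where "H = (\<lambda>q. torus_gap (p (snd q)) (p (fst q))) ` {q. fst q \<noteq> snd q}"
  have "finite H" unfolding H_def by simp
  moreover have Hpos: "h > 0" if h: "h \<in> H" for h
  proof -
    obtain q where q: "fst q \<noteq> snd q" "h = torus_gap (p (snd q)) (p (fst q))"
      using h unfolding H_def by blast
    then have "h \<noteq> 0"
      using pne[OF q(1)] torus_gap_eq_0_iff[of "p (snd q)" "p (fst q)"] by simp
    then show ?thesis using torus_gap_nonneg[of "p (snd q)" "p (fst q)"] q(2) by simp
  qed
  ultimately obtain a where a: "a > 0" "\<And>h. h \<in> H \<Longrightarrow> a < h"
  proof (cases "H = {}")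
    case False
    have "Min H > 0" using Hpos Min_in[OF \<open>finite H\<close> False] by auto
    then show ?thesis
      using that[of "Min H / 2"] Min_le[OF \<open>finite H\<close>] by (smt (verit) field_sum_of_halves)
  qed (use that[of 1] in auto)
  \<comment> \<open>Near \<open>x0\<close>, the image with index \<open>idx z\<close> lies inside
    the bump of \<open>z\<close> and outside all other bumps.\<close>
  define U where "U = (\<Inter>z. {x. torus_gap (p z) ((T ^^ idx z) x) < a} \<inter> (\<Inter>z'\<in>- {z}. {x. torus_gap (p z') ((T ^^ idx z) x) > a}))"
  have "open {x. torus_gap (p z) ((T ^^ m) x) < a}" "open {x. torus_gap (p z) ((T ^^ m) x) > a}" for z m
    by (intro open_Collect_less continuous_intros continuous_on_compose2[OF continuous_torus_gap[of UNIV] Tc]; simp)+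
  then have "open U" unfolding U_def by (intro open_INT open_Int ballI) auto
  moreover have "x0 \<in> U"
  proof -
    have "torus_gap (p z) (p z) = 0" for z by (simp add: torus_gap_eq_0_iff)
    moreover have "torus_gap (p z') (p z) > a" if "z' \<noteq> z" for z z'
      using that unfolding H_def by (intro a(2)[unfolded H_def] image_eqI[of _ _ "(z, z')"]) auto
    ultimately show ?thesis using a(1) by (auto simp: U_def p_def)
  qed
  moreover have pert: "\<exists>\<tau>. (\<forall>z. (\<lambda>i. \<tau> i z) \<longlonglongrightarrow> 0) \<and>
      (\<forall>i. \<forall>x\<in>U. spanning_at A N (\<lambda>y. g y + (\<Sum>z\<in>UNIV. (\<tau> i z * bump ((T ^^ idx z) x0) a y) *\<^sub>R w z)) x)"
    if g: "\<And>x. g differentiable at x" for g :: "real ^ 'n \<Rightarrow> real ^ 'n"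
  proof -
    define \<beta> where "\<beta> z x = bump (p z) a ((T ^^ idx z) x)" for z x
    have \<beta>pos: "\<beta> z x > 0" if "x \<in> U" for z x
    proof -
      have "torus_gap (p z) ((T ^^ idx z) x) < a" using that unfolding U_def by blast
      then show ?thesis by (simp add: \<beta>_def bump_def)
    qed
    have off: "bump (p z') a ((T ^^ idx z) x) = 0" if "x \<in> U" "z' \<noteq> z" for x z z'
    proof -
      have "torus_gap (p z') ((T ^^ idx z) x) > a" using that unfolding U_def by blast
      then show ?thesis by (simp add: bump_def max_def)
    qed
    define c where "c z x u = u \<bullet> (T ^^ (N - idx z)) (g ((T ^^ idx z) x))" for z x u
    \<comment> \<open>For a covector with coordinate \<open>l\<close> equal to 1, annihilation of
      the perturbed vector with index (m, l) reads c + t * beta = 0. Solving for t gives the only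
      bad parameters for this point and covector.\<close>
    define F :: "'n \<Rightarrow> (real ^ 'n) \<times> (real ^ 'n) \<Rightarrow> real ^ (('n + 'n) option)"
      where "F l = (\<lambda>(x, u). \<chi> m. - c (m, l) x u / \<beta> (m, l) x)" for l
    have neg: "negligible (F l ` (U \<times> UNIV))" for l
    proof (rule negligible_differentiable_image_lowdim)
      show "DIM((real ^ 'n) \<times> (real ^ 'n)) < DIM(real ^ (('n + 'n) option))" by simp
      show "F l differentiable_on (U \<times> UNIV)"
        unfolding differentiable_on_def
      proof
        fix q :: "(real ^ 'n) \<times> (real ^ 'n)" assume q: "q \<in> U \<times> UNIV"
        have d1: "(\<lambda>q. (T ^^ m) (h q)) differentiable at q" if "h differentiable at q"
          for m and h :: "(real ^ 'n) \<times> (real ^ 'n) \<Rightarrow> real ^ 'n"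
          using differentiable_chain_at[OF that linear_imp_differentiable[OF lin]] by (simp add: o_def)
        have fst: "fst differentiable at q" "snd differentiable at q"
          by (intro bounded_linear_imp_differentiable bounded_linear_fst bounded_linear_snd)+
        have d2: "(\<lambda>q. g ((T ^^ m) (fst q))) differentiable at q" for m
          using differentiable_chain_at[OF d1[OF fst(1)] g] by (simp add: o_def)
        have d3: "(\<lambda>q. c z (fst q) (snd q)) differentiable at q" for z
          unfolding c_def by (intro differentiable_inner fst d1 d2)
        have bd: "bump (p z) a differentiable at y" for z y
          using C2_conv_bump[of "p z" a] unfolding C2_conv_def C1_conv_def differentiable_def by blast
        have d4: "(\<lambda>q. \<beta> z (fst q)) differentiable at q" for z
          unfolding \<beta>_def using differentiable_chain_at[OF d1[OF fst(1)] bd] by (simp add: o_def)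
        have d5: "(\<lambda>q. - c z (fst q) (snd q) / \<beta> z (fst q)) differentiable at q" for z
          using \<beta>pos[of "fst q" z] q by (intro differentiable_divide differentiable_minus d3 d4) auto
        have "F l = (\<lambda>q. \<Sum>m\<in>UNIV. (- c (m, l) (fst q) (snd q) / \<beta> (m, l) (fst q)) *\<^sub>R axis m 1)"
          unfolding F_def case_prod_unfold vec_lambda_eq_sum_axis ..
        then have "F l differentiable at q"
          by (simp only:) (intro differentiable_sum ballI differentiable_scaleR d5 differentiable_const; simp)
        then show "F l differentiable at q within U \<times> UNIV"
          by (rule differentiable_at_withinI)
      qed
    qed
    \<comment> \<open>The bad parameters form a negligible set, which contains no ball; good
      parameters can therefore be chosen tending to 0.\<close>
    have "\<exists>t. norm t < 1 / real (Suc i) \<and> t \<notin> F l ` (U \<times> UNIV)" for i l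
    proof (rule ccontr)
      assume "\<not> ?thesis"
      then have "ball 0 (1 / real (Suc i)) \<subseteq> F l ` (U \<times> UNIV)" by auto
      then have "negligible (ball (0 :: real ^ (('n + 'n) option)) (1 / real (Suc i)))"
        using neg negligible_subset by blast
      then show False
        using open_not_negligible[of "ball (0 :: real ^ (('n + 'n) option)) (1 / real (Suc i))"] by simp
    qed
    then obtain t where t: "\<And>i l. norm (t i l) < 1 / real (Suc i)" "\<And>i l. t i l \<notin> F l ` (U \<times> UNIV)"
      by metis
    define \<tau> where "\<tau> i z = t i (snd z) $ fst z" for i z
    have "(\<lambda>i. \<tau> i z) \<longlonglongrightarrow> 0" for z
    proof (rule Lim_null_comparison)
      show "\<forall>\<^sub>F i in sequentially. norm (\<tau> i z) \<le> 1 / real (Suc i)"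
      proof (intro always_eventually allI)
        fix i
        show "norm (\<tau> i z) \<le> 1 / real (Suc i)"
          using t(1)[of i "snd z"] component_le_norm_cart[of "t i (snd z)" "fst z"]
          unfolding \<tau>_def real_norm_def by linarith
      qed
      show "(\<lambda>i. 1 / real (Suc i)) \<longlonglongrightarrow> 0" by (rule LIMSEQ_Suc[OF lim_1_over_n])
    qed
    moreover have "spanning_at A N (\<lambda>y. g y + (\<Sum>z\<in>UNIV. (\<tau> i z * bump (p z) a y) *\<^sub>R w z)) x" if x: "x \<in> U" for i x
      unfolding spanning_at_def T_def[symmetric]
    proof (intro allI impI, rule ccontr)
      fix u :: "real ^ 'n"
      assume "u \<noteq> 0" and no: "\<not> (\<exists>j\<in>{1..N}. u \<bullet> (T ^^ (N - j)) (g ((T ^^ j) x) + (\<Sum>z\<in>UNIV. (\<tau> i z * bump (p z) a ((T ^^ j) x)) *\<^sub>R w z)) \<noteq> 0)"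
      obtain l where l: "u $ l \<noteq> 0" using \<open>u \<noteq> 0\<close> by (auto simp: vec_eq_iff)
      define u' where "u' = u /\<^sub>R (u $ l)"
      \<comment> \<open>Only the condition at the image of index \<open>idx z\<close> is used; there
        all bumps except that of \<open>z\<close> vanish.\<close>
      have eq: "c z x u + \<tau> i z * \<beta> z x * u $ snd z = 0" for z
      proof -
        have "(\<Sum>z'\<in>UNIV. (\<tau> i z' * bump (p z') a ((T ^^ idx z) x)) *\<^sub>R w z')
          = (\<Sum>z'\<in>UNIV. if z' = z then (\<tau> i z * \<beta> z x) *\<^sub>R w z else 0)"
          by (intro sum.cong refl) (auto simp: off[OF x] \<beta>_def)
        also have "\<dots> = (\<tau> i z * \<beta> z x) *\<^sub>R w z" by simp
        finally have sum: "(\<Sum>z'\<in>UNIV. (\<tau> i z' * bump (p z') a ((T ^^ idx z) x)) *\<^sub>R w z') = (\<tau> i z * \<beta> z x) *\<^sub>R w z" .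
        have "u \<bullet> (T ^^ (N - idx z)) (g ((T ^^ idx z) x) + (\<Sum>z'\<in>UNIV. (\<tau> i z' * bump (p z') a ((T ^^ idx z) x)) *\<^sub>R w z')) = 0"
          using no idx(2)[of z] by blast
        then have "u \<bullet> (T ^^ (N - idx z)) (g ((T ^^ idx z) x) + (\<tau> i z * \<beta> z x) *\<^sub>R w z) = 0"
          unfolding sum .
        then show ?thesis
          by (simp add: linear_add[OF lin] linear_scale[OF lin] w inner_add_right c_def inner_axis)
      qed
      have "t i l = F l (x, u')"
      proof -
        have "t i l $ m = - c (m, l) x u' / \<beta> (m, l) x" for m
        proof -
          have "c (m, l) x u = u $ l * c (m, l) x u'"
            using l by (simp add: c_def u'_def)
          then have "u $ l * (c (m, l) x u' + t i l $ m * \<beta> (m, l) x) = 0"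
            using eq[of "(m, l)"] by (simp add: \<tau>_def algebra_simps)
          then have "c (m, l) x u' + t i l $ m * \<beta> (m, l) x = 0" using l by simp
          then have "t i l $ m * \<beta> (m, l) x = - c (m, l) x u'" by linarith
          then show ?thesis
            using \<beta>pos[OF x, of "(m, l)"] by (metis less_irrefl nonzero_eq_divide_eq)
        qed
        then show ?thesis by (simp add: F_def vec_eq_iff)
      qed
      then show False using t(2)[of i l] x by blast
    qed
    ultimately show ?thesis unfolding p_def by blast
  qed
  ultimately show thesis using that[of U a w] by blast
qed

lemma lift_field_rep_torus:
  fixes h :: "real ^ 'n \<Rightarrow> real ^ 'n"
  assumes "lattice_periodic h"
  shows "lift_field (\<lambda>X. h (rep_torus X)) = h"
proof
  fix x :: "real ^ 'n"
  have "torus_of (rep_torus (torus_of x)) = torus_of x"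
    by (rule Quotient_abs_rep[OF Quotient_torus])
  then have v: "rep_torus (torus_of x) - x \<in> int_lattice" by (simp add: torus_of_eq_iff)
  have "h (x + (rep_torus (torus_of x) - x)) = h x"
    using assms v unfolding lattice_periodic_def by blast
  then show "lift_field (\<lambda>X. h (rep_torus X)) x = h x" by (simp add: lift_field_def)
qed

text \<open>Scaling does not affect spanning, so the perturbed field may be normalized.\<close>

lemma spanning_unit_fields_dense:
  fixes A :: "real ^ 'n ^ 'n" and idx :: "('n + 'n) option \<times> 'n \<Rightarrow> nat"
  assumes inj: "inj ((*v) A)"
    and idx: "inj idx" "\<And>z. idx z \<in> {1..N}"
    and x0: "\<And>i j. i < j \<Longrightarrow> j \<le> N \<Longrightarrow> torus_of (((*v) A ^^ i) x0) \<noteq> torus_of (((*v) A ^^ j) x0)"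
  obtains U where "open U" "x0 \<in> U"
    "\<And>V :: 'n vector_field. V \<in> C2_fields \<Longrightarrow> (\<And>X. norm (V X) = 1) \<Longrightarrow>
      \<exists>W. (\<forall>i. W i \<in> C2_fields \<and> (\<forall>X. norm (W i X) = 1) \<and> (\<forall>x\<in>U. spanning_at A N (lift_field (W i)) x)) \<and>
        (\<lambda>i. C2_dist (W i) V) \<longlonglongrightarrow> 0"
proof (rule spanning_perturbation[OF inj idx x0], assumption+)
  fix U a and w :: "('n + 'n) option \<times> 'n \<Rightarrow> real ^ 'n"
  assume U: "open U" "x0 \<in> U"
    and pert: "\<And>g :: real ^ 'n \<Rightarrow> real ^ 'n. (\<And>x. g differentiable at x) \<Longrightarrow>
      \<exists>\<tau>. (\<forall>z. (\<lambda>i. \<tau> i z) \<longlonglongrightarrow> 0) \<and>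
        (\<forall>i. \<forall>x\<in>U. spanning_at A N (\<lambda>y. g y + (\<Sum>z\<in>UNIV. (\<tau> i z * bump (((*v) A ^^ idx z) x0) a y) *\<^sub>R w z)) x)"
  show thesis
  proof (rule that[OF U])
    fix V :: "'n vector_field"
    assume V: "V \<in> C2_fields" and unit: "\<And>X. norm (V X) = 1"
    define g where "g = lift_field V"
    define b where "b z = bump (((*v) A ^^ idx z) x0) a" for z
    have "g differentiable at x" for x using V by (simp add: g_def C2_fields_def C2_map_def)
    from pert[OF this] obtain \<tau> where \<tau>: "\<And>z. (\<lambda>i. \<tau> i z) \<longlonglongrightarrow> 0"
      and span: "\<And>i x. x \<in> U \<Longrightarrow> spanning_at A N (\<lambda>y. g y + (\<Sum>z\<in>UNIV. (\<tau> i z * b z y) *\<^sub>R w z)) x"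
      unfolding b_def by blast
    define G where "G i y = g y + (\<Sum>z\<in>UNIV. (\<tau> i z * b z y) *\<^sub>R w z)" for i y
    have "C2_conv (\<lambda>i y. g y + (\<Sum>z\<in>UNIV. (\<tau> i z * b z y) *\<^sub>R w z)) (\<lambda>y. g y + (\<Sum>z\<in>UNIV. (0 * b z y) *\<^sub>R w z))"
      unfolding g_def b_def
      by (intro C2_conv_add C2_conv_C2_field[OF V] C2_conv_sum C2_conv_bilinear[OF bounded_bilinear_scaleR]
          C2_conv_bilinear[OF bounded_bilinear_mult] C2_conv_bump C2_conv_const \<tau> tendsto_const)
    then have "C2_conv G g" unfolding G_def[abs_def] by simp
    have g1: "norm (g x) = 1" for x by (simp add: g_def lift_field_def unit)
    have "uniform_limit UNIV G g sequentially"
      using \<open>C2_conv G g\<close> by (auto simp: C2_conv_def C1_conv_def)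
    \<comment> \<open>The margin 1/4 puts the norms between 3/4 and 5/4, hence their squares in
      [1/2, 2] as required for normalizing. Finitely many terms are dropped.\<close>
    from uniform_limitD[OF this, of "1/4"] obtain n where n: "\<And>i x. i \<ge> n \<Longrightarrow> dist (G i x) (g x) < 1/4"
      by (auto simp: eventually_sequentially)
    have G1: "(norm (G (i + n) x))\<^sup>2 \<in> {1/2..2}" and G0: "norm (G (i + n) x) > 0" for i x
    proof -
      have "dist (G (i + n) x) (g x) < 1/4" using n by simp
      then have "norm (G (i + n) x) \<ge> 3/4" "norm (G (i + n) x) \<le> 5/4"
        using norm_triangle_ineq2[of "G (i + n) x" "g x"] norm_triangle_ineq3[of "G (i + n) x" "g x"] g1[of x]
        by (auto simp: dist_norm)
      moreover from this have "(3/4)\<^sup>2 \<le> (norm (G (i + n) x))\<^sup>2" "(norm (G (i + n) x))\<^sup>2 \<le> (5/4)\<^sup>2"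
        by (intro power_mono; simp)+
      ultimately show "(norm (G (i + n) x))\<^sup>2 \<in> {1/2..2}" "norm (G (i + n) x) > 0"
        by (auto simp: power2_eq_square)
    qed
    define h where "h i x = G (i + n) x /\<^sub>R norm (G (i + n) x)" for i x
    define W where "W i X = h i (rep_torus X)" for i X
    have per: "lattice_periodic (h i)" for i
      unfolding lattice_periodic_def h_def G_def b_def g_def bump_def
      by (simp add: torus_gap_add_lattice lift_field_def torus_of_add_lattice)
    have lift: "lift_field (W i) = h i" for i
      unfolding W_def by (rule lift_field_rep_torus[OF per])
    have conv: "C2_conv (\<lambda>i. lift_field (W i)) (lift_field V)"
      unfolding lift h_def[abs_def] g_def[symmetric]
      by (rule C2_conv_inverse_norm[OF C2_conv_shift[OF \<open>C2_conv G g\<close>] G1 g1])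
    have "spanning_at A N (lift_field (W i)) x" if "x \<in> U" for i x
      unfolding lift h_def
      by (rule spanning_at_normalize) (use span[OF that] G0 in \<open>simp_all add: G_def[abs_def]\<close>)
    moreover have "norm (W i X) = 1" for i X
      using G0[of i "rep_torus X"] by (simp add: W_def h_def)
    ultimately show "\<exists>W. (\<forall>i. W i \<in> C2_fields \<and> (\<forall>X. norm (W i X) = 1) \<and> (\<forall>x\<in>U. spanning_at A N (lift_field (W i)) x)) \<and>
        (\<lambda>i. C2_dist (W i) V) \<longlonglongrightarrow> 0"
      using C2_conv_C2_dist[OF conv] by blast
  qed
qed

section \<open>Openness and density in the space of frames\<close>

lemma C2_dist_upper:
  assumes "V \<in> C2_fields" "W \<in> C2_fields"
  shows "norm (V X - W X) \<le> C2_dist V W"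
proof -
  obtain x where "X = torus_of x" using surj_torus_of by blast
  then have "norm (V X - W X) \<le> sup_dist (lift_field V) (lift_field W)"
    using sup_dist_upper[OF bounded_C2_field(1)[OF assms(1)] bounded_C2_field(1)[OF assms(2)], of x]
    by (simp add: lift_field_def dist_norm)
  then show ?thesis
    using sup_dist_nonneg[OF bounded_C2_field(2)[OF assms(1)] bounded_C2_field(2)[OF assms(2)]]
      sup_dist_nonneg[OF bounded_C2_field(3)[OF assms(1)] bounded_C2_field(3)[OF assms(2)]] assms
    by (simp add: C2_dist_def)
qed

lemma continuous_C2_field: "V \<in> C2_fields \<Longrightarrow> continuous_on S (lift_field V)"
  by (auto simp: C2_fields_def C2_map_def intro!: continuous_at_imp_continuous_on differentiable_imp_continuous_within)

text \<open>By homogeneity unit covectors suffice. The sum of the absolute pairings has a positive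
  minimum over the compact product of \<open>K\<close> with the unit sphere, and a field at distance
  below \<open>r\<close> changes the sum by at most B r, where \<open>B\<close> adds the operator
  norms; r is the minimum divided by B + 1.\<close>

lemma openin_spanning_fields:
  fixes A :: "real ^ 'n ^ 'n"
  assumes K: "compact K"
  shows "openin C2_topology {V \<in> C2_fields. \<forall>x\<in>K. spanning_at A N (lift_field V) x}"
proof -
  interpret Metric_space C2_fields "C2_dist :: 'n vector_field \<Rightarrow> _" by (rule Metric_space_C2)
  have lin: "linear ((*v) A ^^ m)" for m
    by (intro bounded_linear.linear bounded_linear_matrix_funpow)
  have Tc: "continuous_on S ((*v) A ^^ m)" for m S
    by (rule linear_continuous_on) (rule bounded_linear_matrix_funpow)
  have "\<exists>r>0. mball V r \<subseteq> {V \<in> C2_fields. \<forall>x\<in>K. spanning_at A N (lift_field V) x}"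
    if V: "V \<in> C2_fields" and span: "\<forall>x\<in>K. spanning_at A N (lift_field V) x" for V
  proof (cases "K = {}")
    case True
    then show ?thesis by (intro exI[of _ 1]) (auto simp: mball_def)
  next
    case False
    define c where "c W x u j = u \<bullet> (((*v) A ^^ (N - j)) (lift_field W (((*v) A ^^ j) x)))" for W x u j
    define \<psi> where "\<psi> W q = (\<Sum>j=1..N. \<bar>c W (fst q) (snd q) j\<bar>)" for W q
    have cont: "continuous_on (K \<times> sphere 0 1) (\<psi> V)"
      unfolding \<psi>_def c_def
      by (intro continuous_intros continuous_on_compose2[OF Tc[of UNIV]] continuous_on_compose2[OF continuous_C2_field[OF V, of UNIV]]; simp)
    have "K \<times> sphere 0 1 \<noteq> ({} :: ((real ^ 'n) \<times> (real ^ 'n)) set)"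
      using False by simp
    then obtain q where q: "q \<in> K \<times> sphere 0 1" "\<And>y. y \<in> K \<times> sphere 0 1 \<Longrightarrow> \<psi> V q \<le> \<psi> V y"
      using continuous_attains_inf[OF compact_Times[OF K compact_sphere] _ cont] by blast
    have "\<psi> V q > 0"
    proof -
      have "spanning_at A N (lift_field V) (fst q)" "snd q \<noteq> 0" using q(1) span by auto
      then obtain j where j: "j \<in> {1..N}" "c V (fst q) (snd q) j \<noteq> 0"
        unfolding spanning_at_def c_def by blast
      then show ?thesis unfolding \<psi>_def by (intro sum_pos2[of _ j]) auto
    qed
    define B where "B = (\<Sum>j=1..N. onorm ((*v) A ^^ (N - j)))"
    have B: "B \<ge> 0" unfolding B_def by (intro sum_nonneg onorm_pos_le bounded_linear_matrix_funpow)
    define r where "r = \<psi> V q / (B + 1)"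
    have "r > 0" using \<open>\<psi> V q > 0\<close> B by (simp add: r_def)
    have "spanning_at A N (lift_field W) x" if W: "W \<in> mball V r" and x: "x \<in> K" for W x
      unfolding spanning_at_def
    proof (intro allI impI, rule ccontr)
      fix u :: "real ^ 'n" assume u: "u \<noteq> 0" and no: "\<not> (\<exists>j\<in>{1..N}. u \<bullet> ((*v) A ^^ (N - j)) (lift_field W (((*v) A ^^ j) x)) \<noteq> 0)"
      define u' where "u' = u /\<^sub>R norm u"
      have u': "norm u' = 1" using u by (simp add: u'_def)
      have 0: "c W x u' j = 0" if "j \<in> {1..N}" for j
        using no that by (simp add: c_def u'_def)
      have Wf: "W \<in> C2_fields" and lt: "C2_dist V W < r" using W by (auto simp: mball_def)
      have "\<bar>c V x u' j\<bar> \<le> onorm ((*v) A ^^ (N - j)) * r" if "j \<in> {1..N}" for j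
      proof -
        let ?y = "((*v) A ^^ j) x"
        have "c V x u' j = c V x u' j - c W x u' j" using 0[OF that] by simp
        also have "\<dots> = u' \<bullet> (((*v) A ^^ (N - j)) (lift_field V ?y - lift_field W ?y))"
          by (simp add: c_def linear_diff[OF lin] inner_diff_right)
        also have "\<bar>\<dots>\<bar> \<le> norm u' * norm (((*v) A ^^ (N - j)) (lift_field V ?y - lift_field W ?y))"
          by (rule Cauchy_Schwarz_ineq2)
        also have "\<dots> \<le> onorm ((*v) A ^^ (N - j)) * norm (lift_field V ?y - lift_field W ?y)"
          by (simp add: u' onorm[OF bounded_linear_matrix_funpow])
        also have "\<dots> \<le> onorm ((*v) A ^^ (N - j)) * r"
          using C2_dist_upper[OF V Wf, of "torus_of ?y"] lt
          by (intro mult_left_mono onorm_pos_le bounded_linear_matrix_funpow) (auto simp: lift_field_def)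
        finally show ?thesis .
      qed
      then have "\<psi> V (x, u') \<le> B * r"
        unfolding \<psi>_def B_def sum_distrib_right by (intro sum_mono) simp
      also have "\<dots> < \<psi> V q"
        using \<open>\<psi> V q > 0\<close> B by (simp add: r_def field_simps)
      finally show False using q(2)[of "(x, u')"] x u' by simp
    qed
    then show ?thesis
      using \<open>r > 0\<close> by (intro exI[of _ r]) (auto simp: mball_def)
  qed
  then show ?thesis
    unfolding C2_topology_def openin_mtopology by auto
qed

lemma openin_C2_topology_iff:
  fixes O' :: "'n::finite vector_field set"
  shows
  "openin C2_topology O' \<longleftrightarrow> O' \<subseteq> C2_fields \<and>
    (\<forall>V\<in>O'. \<exists>r>0. \<forall>W\<in>C2_fields. C2_dist V W < r \<longrightarrow> W \<in> O')"
proof -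
  interpret Metric_space C2_fields "C2_dist :: 'n vector_field \<Rightarrow> _" by (rule Metric_space_C2)
  have "mball V r \<subseteq> O' \<longleftrightarrow> (\<forall>W\<in>C2_fields. C2_dist V W < r \<longrightarrow> W \<in> O')" if "V \<in> C2_fields" for V r
    using that by (auto simp: in_mball subset_eq)
  then have "(\<exists>r>0. mball V r \<subseteq> O') \<longleftrightarrow> (\<exists>r>0. \<forall>W\<in>C2_fields. C2_dist V W < r \<longrightarrow> W \<in> O')"
    if "V \<in> C2_fields" for V
    using that by simp
  then show ?thesis
    unfolding C2_topology_def openin_mtopology by (simp add: Ball_def subset_eq cong: conj_cong)
qed

lemma topspace_C2_topology: "topspace C2_topology = C2_fields"
  by (simp add: C2_topology_def Metric_space.topspace_mtopology[OF Metric_space_C2])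

text \<open>Independence gives k at most n. The injection stores tuples of \<open>k\<close>
  coefficients as vectors in \<open>real ^ 'n\<close>, where the unit sphere is compact;
  \<open>k\<close> is a number and not a type.\<close>

lemma frame_coefficients_injection:
  fixes V :: "nat \<Rightarrow> 'n::finite vector_field"
  assumes "V \<in> unit_frames k"
  obtains \<iota> :: "nat \<Rightarrow> 'n" where "inj_on \<iota> {1..k}"
proof -
  let ?x = "undefined :: 'n torus"
  have "inj_on (\<lambda>i. V i ?x) {1..k}" "independent ((\<lambda>i. V i ?x) ` {1..k})"
    using assms by (auto simp: unit_frames_def)
  then have "card {1..k} \<le> CARD('n)"
    using independent_bound[of "(\<lambda>i. V i ?x) ` {1..k}"] card_image[of "\<lambda>i. V i ?x" "{1..k}"] by simp
  then obtain \<iota> :: "nat \<Rightarrow> 'n" where "inj_on \<iota> {1..k}"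
    using card_le_inj[of "{1..k}" "UNIV :: 'n set"] by auto
  then show thesis by (rule that)
qed

text \<open>Independence of the image as a set overlooks repeated vectors, so injectivity has to be
  added to get independence of the family. A repetition is detected by the coefficients 1 and
  -1.\<close>

lemma independent_family_iff:
  fixes v :: "nat \<Rightarrow> 'a::real_vector"
  assumes "finite I"
  shows "inj_on v I \<and> independent (v ` I) \<longleftrightarrow> (\<forall>c. (\<Sum>i\<in>I. c i *\<^sub>R v i) = 0 \<longrightarrow> (\<forall>i\<in>I. c i = 0))"
proof (intro iffI allI impI)
  fix c assume ind: "inj_on v I \<and> independent (v ` I)" and sum: "(\<Sum>i\<in>I. c i *\<^sub>R v i) = 0"
  have eq: "(\<Sum>i\<in>I. c i *\<^sub>R v i) = (\<Sum>y\<in>v ` I. c (inv_into I v y) *\<^sub>R y)"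
    using ind by (subst sum.reindex) auto
  have "\<And>u. (\<Sum>y\<in>v ` I. u y *\<^sub>R y) = 0 \<Longrightarrow> \<forall>y\<in>v ` I. u y = 0"
    using ind dependent_finite[of "v ` I"] assms by blast
  then have "\<forall>y\<in>v ` I. c (inv_into I v y) = 0"
    using sum unfolding eq .
  then show "\<forall>i\<in>I. c i = 0" using ind by (metis image_eqI inv_into_f_f)
next
  assume *: "\<forall>c. (\<Sum>i\<in>I. c i *\<^sub>R v i) = 0 \<longrightarrow> (\<forall>i\<in>I. c i = 0)"
  have inj: "inj_on v I"
  proof (rule inj_onI, rule ccontr)
    fix i j assume ij: "i \<in> I" "j \<in> I" "v i = v j" "i \<noteq> j"
    define c where "c l = (if l = i then 1 else 0) - (if l = j then 1 else 0 :: real)" for l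
    have "(\<Sum>l\<in>I. c l *\<^sub>R v l) = (\<Sum>l\<in>I. if l = i then v i else 0) - (\<Sum>l\<in>I. if l = j then v j else 0)"
      unfolding sum_subtractf[symmetric] by (intro sum.cong) (auto simp: c_def)
    also have "\<dots> = 0" using ij assms by simp
    finally have "c i = 0" using * ij(1) by blast
    then show False using ij(4) by (simp add: c_def)
  qed
  moreover have "independent (v ` I)"
    unfolding dependent_finite[OF finite_imageI[OF assms]]
  proof clarify
    fix u i assume "(\<Sum>y\<in>v ` I. u y *\<^sub>R y) = 0" and i: "i \<in> I" "u (v i) \<noteq> 0"
    then have "(\<Sum>i\<in>I. u (v i) *\<^sub>R v i) = 0" using inj by (simp add: sum.reindex)
    then show False using *[rule_format, of "\<lambda>i. u (v i)"] i by blast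
  qed
  ultimately show "inj_on v I \<and> independent (v ` I)" by blast
qed

text \<open>The combinations of the frame with unit coefficient vectors have a positive minimal
  norm, by compactness of the torus and of the set \<open>S\<close> of coefficients. Replacing
  \<open>V 1\<close> changes such a combination by less than this minimum, so it stays
  nonzero.\<close>

lemma unit_frames_stable:
  fixes V :: "nat \<Rightarrow> 'n::finite vector_field"
  assumes V: "V \<in> unit_frames k" and C2: "\<And>i. i \<in> {1..k} \<Longrightarrow> V i \<in> C2_fields" and k: "k \<ge> 1"
  shows "\<exists>c>0. \<forall>W. (\<forall>X. norm (W X) = 1) \<longrightarrow> (\<forall>X. norm (W X - V 1 X) < c) \<longrightarrow> V(1 := W) \<in> unit_frames k"
proof -
  obtain \<iota> :: "nat \<Rightarrow> 'n" where \<iota>: "inj_on \<iota> {1..k}"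
    using frame_coefficients_injection[OF V] by blast
  define S where "S = {a :: real ^ 'n. norm a = 1 \<and> (\<forall>l. l \<notin> \<iota> ` {1..k} \<longrightarrow> a $ l = 0)}"
  have "S = sphere 0 1 \<inter> (\<Inter>l\<in>- \<iota> ` {1..k}. {a. a $ l = 0})" by (auto simp: S_def)
  moreover have "closed {a :: real ^ 'n. a $ l = 0}" for l by (intro closed_Collect_eq continuous_intros)
  ultimately have "compact S" by (metis closed_INT compact_Int_closed compact_sphere)
  define \<psi> where "\<psi> q = norm (\<Sum>i=1..k. (snd q $ \<iota> i) *\<^sub>R lift_field (V i) (fst q))" for q
  have cont: "continuous_on (cbox 0 1 \<times> S) \<psi>"
    unfolding \<psi>_def
    by (intro continuous_intros continuous_on_compose2[OF continuous_C2_field[OF C2, of _ UNIV]]) auto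
  have a1: "axis (\<iota> 1) 1 \<in> S" using k by (auto simp: S_def axis_def norm_axis_1[unfolded axis_def])
  have "(0 :: real ^ 'n, axis (\<iota> 1) 1) \<in> cbox 0 1 \<times> S"
    using a1 by (simp add: mem_box_cart)
  then have "cbox 0 1 \<times> S \<noteq> ({} :: ((real ^ 'n) \<times> (real ^ 'n)) set)" by blast
  then obtain q where q: "q \<in> cbox 0 1 \<times> S" "\<And>y. y \<in> cbox 0 1 \<times> S \<Longrightarrow> \<psi> q \<le> \<psi> y"
    using continuous_attains_inf[OF compact_Times[OF compact_cbox \<open>compact S\<close>] _ cont] by blast
  have ind: "(\<forall>i\<in>{1..k}. c i = 0)" if "(\<Sum>i=1..k. c i *\<^sub>R V i X) = 0" for c X
    using V that independent_family_iff[of "{1..k}" "\<lambda>i. V i X"] by (auto simp: unit_frames_def)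
  have "\<psi> q > 0"
  proof (rule ccontr)
    assume "\<not> \<psi> q > 0"
    then have "(\<Sum>i=1..k. (snd q $ \<iota> i) *\<^sub>R V i (torus_of (fst q))) = 0"
      by (simp add: \<psi>_def lift_field_def)
    from ind[OF this] have "snd q $ l = 0" for l
      using q(1) by (cases "l \<in> \<iota> ` {1..k}") (auto simp: S_def)
    then have "snd q = 0" by (simp add: vec_eq_iff)
    then show False using q(1) by (auto simp: S_def)
  qed
  moreover have "V(1 := W) \<in> unit_frames k"
    if W: "\<And>X. norm (W X) = 1" "\<And>X. norm (W X - V 1 X) < \<psi> q" for W
  proof -
    have "\<forall>i\<in>{1..k}. c i = 0" if sum: "(\<Sum>i=1..k. c i *\<^sub>R (V(1 := W)) i X) = 0" for c X
    proof (rule ccontr)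
      assume no: "\<not> (\<forall>i\<in>{1..k}. c i = 0)"
      obtain x where x: "x \<in> cbox 0 1" "X = torus_of x" using exists_cbox surj_torus_of by metis
      define a0 where "a0 = (\<chi> l. if l \<in> \<iota> ` {1..k} then c (inv_into {1..k} \<iota> l) else 0)"
      have a0: "a0 $ \<iota> i = c i" if "i \<in> {1..k}" for i
        using that \<iota> by (simp add: a0_def)
      have "a0 \<noteq> 0" using no a0 by (metis zero_index)
      define a where "a = a0 /\<^sub>R norm a0"
      have aS: "a \<in> S" using \<open>a0 \<noteq> 0\<close> by (auto simp: S_def a_def a0_def)
      have a: "a $ \<iota> i = c i / norm a0" if "i \<in> {1..k}" for i
        using a0[OF that] by (simp add: a_def inverse_eq_divide)
      have "(\<Sum>i=1..k. (a $ \<iota> i) *\<^sub>R (V(1 := W)) i X) = (\<Sum>i=1..k. (1 / norm a0) *\<^sub>R (c i *\<^sub>R (V(1 := W)) i X))"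
        by (intro sum.cong) (simp_all add: a)
      also have "\<dots> = 0" by (simp only: scaleR_sum_right[symmetric] sum scaleR_zero_right)
      finally have z: "(\<Sum>i=1..k. (a $ \<iota> i) *\<^sub>R (V(1 := W)) i X) = 0" .
      have "(\<Sum>i=1..k. (a $ \<iota> i) *\<^sub>R V i X)
        = (\<Sum>i=1..k. (a $ \<iota> i) *\<^sub>R (V(1 := W)) i X) + (\<Sum>i=1..k. if i = 1 then (a $ \<iota> 1) *\<^sub>R (V 1 X - W X) else 0)"
        unfolding sum.distrib[symmetric] by (intro sum.cong) (auto simp: scaleR_diff_right)
      also have "\<dots> = (a $ \<iota> 1) *\<^sub>R (V 1 X - W X)" using k z by simp
      finally have eq: "\<psi> (x, a) = norm ((a $ \<iota> 1) *\<^sub>R (V 1 X - W X))"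
        by (simp add: \<psi>_def lift_field_def x)
      have "\<bar>a $ \<iota> 1\<bar> \<le> 1"
        using component_le_norm_cart[of a "\<iota> 1"] aS by (simp add: S_def)
      then have "\<psi> (x, a) \<le> 1 * norm (V 1 X - W X)"
        unfolding eq norm_scaleR by (intro mult_right_mono) auto
      also have "\<dots> < \<psi> q" using W(2)[of X] by (simp add: norm_minus_commute)
      finally show False using q(2)[of "(x, a)"] x aS by simp
    qed
    then have "inj_on (\<lambda>i. (V(1 := W)) i X) {1..k} \<and> independent ((\<lambda>i. (V(1 := W)) i X) ` {1..k})" for X
      using independent_family_iff[of "{1..k}" "\<lambda>i. (V(1 := W)) i X"] by blast
    moreover have "norm ((V(1 := W)) i X) = 1" if "i \<in> {1..k}" for i X
      using V W(1) that by (auto simp: unit_frames_def)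
    ultimately show ?thesis unfolding unit_frames_def by blast
  qed
  ultimately show ?thesis by blast
qed

text \<open>Openness is pulled back along the projection to the first field. For density only the
  first field is replaced; \<open>unit_frames_stable\<close> keeps the tuple a frame when the
  replacement is close.\<close>

lemma spanning_frames_open_dense:
  fixes A :: "real ^ 'n ^ 'n"
  assumes k: "k \<ge> 1" and K: "compact K" "K \<subseteq> U"
    and dense: "\<And>V :: 'n vector_field. V \<in> C2_fields \<Longrightarrow> (\<And>X. norm (V X) = 1) \<Longrightarrow>
      \<exists>W. (\<forall>i. W i \<in> C2_fields \<and> (\<forall>X. norm (W i X) = 1) \<and> (\<forall>x\<in>U. spanning_at A N (lift_field (W i)) x)) \<and>
        (\<lambda>i. C2_dist (W i) V) \<longlonglongrightarrow> 0"
  defines "D \<equiv> {V \<in> topspace (frame_topology k). \<forall>x\<in>K. spanning_at A N (lift_field (V 1)) x}"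
  shows "openin (frame_topology k) D" "frame_topology k closure_of D = topspace (frame_topology k)"
proof -
  have proj: "continuous_map (frame_topology k) C2_topology (\<lambda>V :: nat \<Rightarrow> 'n vector_field. V 1)"
    unfolding frame_topology_def
    by (rule continuous_map_from_subtopology[OF continuous_map_product_projection]) (use k in simp)
  have "V 1 \<in> C2_fields" if "V \<in> topspace (frame_topology k)" for V :: "nat \<Rightarrow> 'n vector_field"
    using that k by (auto simp: topspace_frame_topology PiE_iff)
  then have "D = {V \<in> topspace (frame_topology k). V 1 \<in> {V \<in> C2_fields. \<forall>x\<in>K. spanning_at A N (lift_field V) x}}"
    by (auto simp: D_def)
  also have "openin (frame_topology k) \<dots>"
    by (rule openin_continuous_map_preimage[OF proj openin_spanning_fields[OF K(1)]])
  finally show "openin (frame_topology k) D" .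
  have sub: "V \<in> frame_topology k closure_of D" if V: "V \<in> topspace (frame_topology k)" for V
    unfolding in_closure_of
  proof (intro conjI allI impI V)
    fix O' assume O': "V \<in> O' \<and> openin (frame_topology k) O'"
    then obtain O1 where O1: "openin (product_topology (\<lambda>i. C2_topology) {1..k}) O1" "O' = O1 \<inter> unit_frames k"
      by (auto simp: frame_topology_def openin_subtopology)
    have Vf: "V \<in> unit_frames k" and Vp: "V \<in> (\<Pi>\<^sub>E i\<in>{1..k}. C2_fields)"
      using V by (auto simp: topspace_frame_topology)
    then have V2: "V i \<in> C2_fields" if "i \<in> {1..k}" for i using that by auto
    \<comment> \<open>Continuity of the substitution reduces a neighbourhood in the product topology
      to a ball around \<open>V 1\<close>.\<close>
    have "continuous_map C2_topology (product_topology (\<lambda>i. C2_topology) {1..k}) (\<lambda>W. V(1 := W))"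
      unfolding continuous_map_componentwise
    proof (intro conjI ballI)
      show "(\<lambda>W. V(1 := W)) ` topspace C2_topology \<subseteq> extensional {1..k}"
        using Vp k by (auto simp: PiE_iff extensional_def)
      fix i assume i: "i \<in> {1..k}"
      show "continuous_map C2_topology C2_topology (\<lambda>W. (V(1 := W)) i)"
        using V2[OF i] by (cases "i = 1") (simp_all add: topspace_C2_topology)
    qed
    from openin_continuous_map_preimage[OF this O1(1)]
    have "openin C2_topology {W \<in> C2_fields. V(1 := W) \<in> O1}" by (simp add: topspace_C2_topology)
    moreover have "V 1 \<in> {W \<in> C2_fields. V(1 := W) \<in> O1}" using O' O1 V2 k by auto
    ultimately obtain r where r: "r > 0" "\<And>W. W \<in> C2_fields \<Longrightarrow> C2_dist (V 1) W < r \<Longrightarrow> V(1 := W) \<in> O1"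
      unfolding openin_C2_topology_iff by blast
    obtain c where c: "c > 0" "\<And>W. (\<And>X. norm (W X) = 1) \<Longrightarrow> (\<And>X. norm (W X - V 1 X) < c) \<Longrightarrow> V(1 := W) \<in> unit_frames k"
      using unit_frames_stable[OF Vf V2 k] by blast
    have V1: "V 1 \<in> C2_fields" "\<And>X. norm (V 1 X) = 1"
      using V2 Vf k by (auto simp: unit_frames_def)
    obtain W where W: "\<And>i. W i \<in> C2_fields" "\<And>i X. norm (W i X) = 1"
      "\<And>i x. x \<in> U \<Longrightarrow> spanning_at A N (lift_field (W i)) x" "(\<lambda>i. C2_dist (W i) (V 1)) \<longlonglongrightarrow> 0"
      using dense[OF V1] by blast
    have "\<forall>\<^sub>F i in sequentially. C2_dist (W i) (V 1) < min r c"
      using W(4) r(1) c(1) by (intro order_tendstoD(2)[of _ 0]) auto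
    then obtain i where i: "C2_dist (W i) (V 1) < r" "C2_dist (W i) (V 1) < c"
      by (auto simp: eventually_sequentially)
    have "C2_dist (V 1) (W i) = C2_dist (W i) (V 1)"
      by (rule Metric_space.commute[OF Metric_space_C2])
    then have inO: "V(1 := W i) \<in> O1" using r(2)[OF W(1)] i by simp
    have inF: "V(1 := W i) \<in> unit_frames k"
      using C2_dist_upper[OF W(1) V1(1)] i(2) by (intro c(2) W(2)) (meson le_less_trans)
    have "V(1 := W i) \<in> topspace (frame_topology k)"
      using inF inO openin_subset[OF O1(1)] by (auto simp: topspace_frame_topology topspace_C2_topology)
    then have "V(1 := W i) \<in> D"
      using W(3) K(2) by (auto simp: D_def)
    then show "\<exists>y. y \<in> D \<and> y \<in> O'" using inO inF O1(2) by blast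
  qed
  show "frame_topology k closure_of D = topspace (frame_topology k)"
    by (intro antisym closure_of_subset_topspace subsetI sub)
qed

lemma residual_spanning_frames:
  fixes A :: "int ^ 'n ^ 'n"
  assumes hyp: "\<forall>(c :: complex) v. v \<noteq> 0 \<and> map_matrix of_int A *v v = c *s v \<longrightarrow> cmod c \<noteq> 1"
    and det: "\<bar>det A\<bar> = 1" and k: "k \<ge> 1"
  shows "\<exists>(\<V> :: (nat \<Rightarrow> 'n vector_field) set) F N. residual_in (frame_topology k) \<V> \<and> countable F \<and>
    (\<forall>V\<in>\<V>. \<forall>x. x \<notin> F \<longrightarrow> spanning_at (map_matrix of_int A) N (lift_field (V 1)) x)"
proof -
  define AR where "AR = (map_matrix of_int A :: real ^ 'n ^ 'n)"
  have "det AR \<noteq> 0" using det by (auto simp: AR_def det_map_matrix_of_int)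
  then have inj: "inj ((*v) AR)" by (metis inj_matrix_vector_mult invertible_det_nz)
  \<comment> \<open>N is n (2n + 1): one image of the point for every bump. The successor in
    \<open>idx\<close> shifts the indices to 1..N, since the field is not evaluated at the point
    itself.\<close>
  define N where "N = CARD(('n + 'n) option \<times> 'n)"
  obtain h :: "('n + 'n) option \<times> 'n \<Rightarrow> nat" where h: "bij_betw h UNIV {0..<N}"
    using ex_bij_betw_finite_nat[of "UNIV :: (('n + 'n) option \<times> 'n) set"] by (auto simp: N_def)
  define idx where "idx z = Suc (h z)" for z
  have idx: "inj idx" "\<And>z. idx z \<in> {1..N}"
    using h by (auto simp: idx_def bij_betw_def inj_on_def Suc_le_eq)
  define F where "F = {x. \<exists>i j. i < j \<and> j \<le> N \<and> torus_of (((*v) AR ^^ i) x) = torus_of (((*v) AR ^^ j) x)}"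
  have F: "countable F"
    unfolding F_def AR_def by (rule countable_early_collisions[OF _ det]) (use hyp in blast)
  define D where "D K = {V \<in> topspace (frame_topology k). \<forall>x\<in>K. spanning_at AR N (lift_field (V 1)) x}"
    for K and V :: "nat \<Rightarrow> 'n vector_field"
  have "\<exists>r>0. openin (frame_topology k) (D (cball x r)) \<and> frame_topology k closure_of D (cball x r) = topspace (frame_topology k)"
    if x: "x \<notin> F" for x
  proof -
    have "torus_of (((*v) AR ^^ i) x) \<noteq> torus_of (((*v) AR ^^ j) x)" if "i < j" "j \<le> N" for i j
      using x that by (auto simp: F_def)
    from spanning_unit_fields_dense[OF inj idx this] obtain U where U: "open U" "x \<in> U"
      and dense: "\<And>V :: 'n vector_field. V \<in> C2_fields \<Longrightarrow> (\<And>X. norm (V X) = 1) \<Longrightarrow>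
      \<exists>W. (\<forall>i. W i \<in> C2_fields \<and> (\<forall>X. norm (W i X) = 1) \<and> (\<forall>x\<in>U. spanning_at AR N (lift_field (W i)) x)) \<and>
        (\<lambda>i. C2_dist (W i) V) \<longlonglongrightarrow> 0"
      by metis
    obtain r where "r > 0" "cball x r \<subseteq> U" using U open_contains_cball by blast
    then show ?thesis
      using spanning_frames_open_dense[OF k compact_cball _ dense] unfolding D_def by blast
  qed
  then obtain r where r: "\<And>x. x \<notin> F \<Longrightarrow> r x > 0"
    "\<And>x. x \<notin> F \<Longrightarrow> openin (frame_topology k) (D (cball x (r x)))"
    "\<And>x. x \<notin> F \<Longrightarrow> frame_topology k closure_of D (cball x (r x)) = topspace (frame_topology k)"
    by metis
  \<comment> \<open>Lindelof: countably many of the open balls still cover the complement of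
    \<open>F\<close>. The corresponding closed balls are compact, as openness of the spanning
    condition requires.\<close>
  obtain \<F> where \<F>: "\<F> \<subseteq> (\<lambda>x. ball x (r x)) ` (- F)" "countable \<F>" "\<Union>\<F> = \<Union>((\<lambda>x. ball x (r x)) ` (- F))"
    using Lindelof[of "(\<lambda>x. ball x (r x)) ` (- F)"] by auto
  obtain C where C: "countable C" "C \<subseteq> - F" "\<F> = (\<lambda>x. ball x (r x)) ` C"
    using \<F>(1,2) countable_subset_image[of \<F> "\<lambda>x. ball x (r x)" "- F"] by auto
  define \<V> where "\<V> = topspace (frame_topology k) \<inter> \<Inter>((\<lambda>x. D (cball x (r x))) ` C)"
  show ?thesis
  proof (intro exI conjI ballI allI impI)
    show "residual_in (frame_topology k) \<V>"
      unfolding residual_in_def \<V>_def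
      by (intro conjI exI[of _ "(\<lambda>x. D (cball x (r x))) ` C"]) (use C r in auto)
    show "countable F" by (rule F)
    fix V x assume V: "V \<in> \<V>" and x: "x \<notin> F"
    have "x \<in> \<Union>((\<lambda>x. ball x (r x)) ` (- F))"
      using r(1)[OF x] x by (intro UnionI[of "ball x (r x)"]) auto
    then have "x \<in> \<Union>((\<lambda>x. ball x (r x)) ` C)" unfolding \<F>(3)[symmetric] C(3) .
    then obtain y where y: "y \<in> C" "x \<in> ball y (r y)" by blast
    then have "V \<in> D (cball y (r y))" "x \<in> cball y (r y)" using V by (auto simp: \<V>_def)
    then show "spanning_at (map_matrix of_int A) N (lift_field (V 1)) x"
      unfolding D_def AR_def by blast
  qed
qed

section \<open>Null sets under the automorphism, and the conclusion\<close>

lemma borel_measurable_automorphism: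
  fixes A :: "real ^ 'n ^ 'n"
  assumes f: "\<And>x. f (torus_of x) = torus_of (A *v x)"
  shows "f \<in> borel_measurable borel"
proof -
  have "torus_of -` (f -` S) = (*v) A -` (torus_of -` S)" for S
    by (auto simp: f)
  then have "continuous_on UNIV f"
    unfolding continuous_on_open_vimage[OF open_UNIV]
    by (auto simp: open_torus_iff_open_vimage intro!: open_vimage linear_continuous_on matrix_vector_mul_bounded_linear)
  then show ?thesis by (rule borel_measurable_continuous_onI)
qed

text \<open>In the covering space the preimage lies in the image of a null set under the inverse
  matrix, a linear and hence null-preserving map.\<close>

lemma null_vimage_automorphism:
  fixes A :: "real ^ 'n ^ 'n"
  assumes f: "\<And>x. f (torus_of x) = torus_of (A *v x)" and det: "det A \<noteq> 0"
    and Z: "Z \<in> sets borel" "emeasure torus_measure Z = 0"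
  shows "emeasure torus_measure (f -` Z) = 0"
proof -
  have vimage: "torus_of -` (f -` S) = (*v) A -` (torus_of -` S)" for S
    by (auto simp: f)
  have fZ: "f -` Z \<in> sets borel"
    by (rule measurable_sets_borel[OF borel_measurable_automorphism[OF f] Z(1)])
  obtain A' where A': "A' ** A = mat 1" using det by (metis invertible_det_nz invertible_def)
  have T: "torus_of -` Z \<in> sets borel" by (rule measurable_sets_borel[OF borel_measurable_torus_of Z(1)])
  have "torus_of -` Z \<in> null_sets lborel"
    using Z(2) null_torus_measure_iff[OF Z(1)] T by (intro null_setsI) auto
  then have "negligible (torus_of -` Z)" unfolding negligible_iff_null_sets by (rule null_sets_completionI)
  then have "negligible ((*v) A' ` (torus_of -` Z))"
    by (intro negligible_differentiable_image_negligible)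
      (auto intro!: linear_imp_differentiable_on)
  moreover have "(*v) A -` (torus_of -` Z) \<subseteq> (*v) A' ` (torus_of -` Z)"
  proof
    fix x assume "x \<in> (*v) A -` (torus_of -` Z)"
    moreover have "x = A' *v (A *v x)" by (simp add: matrix_vector_mul_assoc A')
    ultimately show "x \<in> (*v) A' ` (torus_of -` Z)" by blast
  qed
  ultimately have "negligible (torus_of -` (f -` Z))"
    unfolding vimage by (rule negligible_subset)
  then have "torus_of -` (f -` Z) \<in> null_sets lborel"
    using measurable_sets_borel[OF borel_measurable_torus_of fZ]
    by (simp add: negligible_iff_null_sets null_sets_completion_iff)
  then show ?thesis
    using null_torus_measure_iff[OF fZ] by (simp add: null_setsD1)
qed

theorem theorem11:
  fixes f :: "'n::finite torus \<Rightarrow> 'n torus"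
    and k :: nat
    and \<epsilon> :: "nat \<Rightarrow> real"
  assumes "hyperbolic_toral_automorphism f"
    and "k \<ge> 1"
    and "\<forall>i\<in>{1..k}. \<epsilon> i > 0"
  shows "\<exists>\<V>. residual_in (frame_topology k :: (nat \<Rightarrow> 'n vector_field) topology) \<V> \<and>
    (\<forall>V\<in>\<V>. \<forall>\<mu>. invariant_measure (random_perturbation f k V \<epsilon>) \<mu> \<longrightarrow>
      absolutely_continuous torus_measure \<mu>)"
proof -
  obtain A :: "int ^ 'n ^ 'n" where det: "\<bar>det A\<bar> = 1"
    and hyp: "\<forall>(c :: complex) v. v \<noteq> 0 \<and> map_matrix of_int A *v v = c *s v \<longrightarrow> cmod c \<noteq> 1"
    and f: "\<And>x. f (torus_of x) = torus_of (map_matrix of_int A *v x)"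
    using assms(1) unfolding hyperbolic_toral_automorphism_def by blast
  have det': "det (map_matrix of_int A :: real ^ 'n ^ 'n) \<noteq> 0"
    using det by (auto simp: det_map_matrix_of_int)
  obtain \<V> :: "(nat \<Rightarrow> 'n vector_field) set" and F N where \<V>: "residual_in (frame_topology k) \<V>" and F: "countable F"
    and span: "\<And>V x. V \<in> \<V> \<Longrightarrow> x \<notin> F \<Longrightarrow> spanning_at (map_matrix of_int A) N (lift_field (V 1)) x"
    using residual_spanning_frames[OF hyp det assms(2)] by blast
  have "absolutely_continuous torus_measure \<mu>"
    if V: "V \<in> \<V>" and inv: "invariant_measure (random_perturbation f k V \<epsilon>) \<mu>" for V \<mu>
  proof (rule ccontr)
    assume nac: "\<not> absolutely_continuous torus_measure \<mu>"
    have "V \<in> topspace (frame_topology k)" using V \<V> by (auto simp: residual_in_def)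
    then have "V i \<in> C2_fields" "norm (V i X) = 1" if "i \<in> {1..k}" for i X
      using that by (auto simp: topspace_frame_topology unit_frames_def)
    then have Vu: "\<exists>L. unit_field (V i) L" if "i \<in> {1..k}" for i
      using C2_field_lipschitz that by blast
    have \<epsilon>: "\<epsilon> i > 0" if "i \<in> {1..k}" for i using assms(3) that by blast
    have meas: "arc_kernel (V i) (\<epsilon> i) \<in> measurable borel (subprob_algebra borel)" if "i \<in> {1..k}" for i
      using Vu[OF that] unit_field.arc_kernel_measurable \<epsilon>[OF that] by (metis less_imp_le)
    have null: "emeasure torus_measure {X. emeasure (arc_kernel (V i) (\<epsilon> i) X) S > 0} = 0"
      if "i \<in> {1..k}" "S \<in> sets borel" "emeasure torus_measure S = 0" for i S
      using Vu[OF that(1)] unit_field.null_arc_kernel \<epsilon>[OF that(1)] that(2,3) by (metis less_imp_le)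
    have comp: "composed_arc_kernel V \<epsilon> k \<in> measurable borel (subprob_algebra borel)"
      by (rule composed_arc_kernel_measurable[OF meas])
    have "random_perturbation f k V \<epsilon> \<in> measurable borel (subprob_algebra borel)"
      using measurable_compose[OF borel_measurable_automorphism[OF f] comp] by (simp add: random_perturbation_def[abs_def])
    \<comment> \<open>The whole chain enters a null set only from a null set: the arcs have this
      property, and the automorphism pulls null sets back to null sets.\<close>
    moreover have "emeasure torus_measure {X. emeasure (random_perturbation f k V \<epsilon> X) S > 0} = 0"
      if S: "S \<in> sets borel" "emeasure torus_measure S = 0" for S
    proof -
      define Z where "Z = {X. emeasure (composed_arc_kernel V \<epsilon> k X) S > 0}"
      have "Z \<in> sets borel"
        using measurable_emeasure_kernel[OF comp S(1)] unfolding Z_def by measurable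
      moreover have "emeasure torus_measure Z = 0"
        unfolding Z_def by (rule composed_arc_kernel_null[OF meas null S])
      ultimately have "emeasure torus_measure (f -` Z) = 0"
        by (rule null_vimage_automorphism[OF f det'])
      moreover have "f -` Z = {X. emeasure (random_perturbation f k V \<epsilon> X) S > 0}"
        by (auto simp: Z_def random_perturbation_def)
      ultimately show ?thesis by simp
    qed
    ultimately obtain B where B: "B \<in> sets borel" "B \<noteq> {}" "emeasure torus_measure B = 0"
      "\<And>X. X \<in> B \<Longrightarrow> emeasure (random_perturbation f k V \<epsilon> X) B = 1"
      using singular_invariant_set[OF _ sets_torus_measure _ inv nac] by blast
    have "emeasure torus_measure B \<noteq> 0"
      by (rule spanning_not_invariant_null[OF f Vu assms(2) \<epsilon> F span[OF V] B(1,2,4)])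
    then show False using B(3) by simp
  qed
  then show ?thesis using \<V> by blast
qed

end
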